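(* Let $\Gamma$ be a finite connected simple graph with at least two vertices, and let $\mathcal{G}=\{G_v \mid v\in V(\Gamma)\}$ be a collection of finitely generated infinite groups. A subgroup $H$ of the graph product $\Gamma\mathcal{G}$ is stable if and only if it has infinite index in $\Gamma\mathcal{G}$ and is Morse.
   Context: Graph product: $\Gamma\mathcal{G}$ is the quotient of the free product $\ast_{v\in V(\Gamma)}G_v$ by the normal closure of all commutators $[g,h]$ with $g\in G_u$, $h\in G_v$, $\{u,v\}\in E(\Gamma)$. Stable: a subgroup $H$ of a finitely generated group $G$ is stable if $H$ is finitely generated, the inclusion $H\hookrightarrow G$ is a quasi-isometric embedding (word metrics from finite generating sets), and for all $\lambda\ge1$, $c\ge0$ there is $M\ge0$ such that any two $(\lambda,c)$-quasi-geodesics in $G$ with the same endpoints in $H$ are each contained in the $M$-neighborhood of the other. Morse: a subgroup $H$ of a finitely generated group $G$ is Morse if for all $\lambda\ge1$, $c\ge0$ there is $M\ge0$ such that every $(\lambda,c)$-quasi-geodesic in $G$ with endpoints in $H$ is contained in the $M$-neighborhood of $H$. *)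

theory Defs
  imports
    "HOL-Algebra.Algebra"
    "Graph_Theory.Digraph_Component"
    Complex_Main
begin

section \<open>Free products and graph products\<close>

definition free_words :: "'v set \<Rightarrow> ('v \<Rightarrow> ('g, 'm) monoid_scheme) \<Rightarrow> ('v \<times> 'g) list set" where
  "free_words V \<G> = lists (SIGMA v:V. carrier (\<G> v))"

text \<open>The smallest congruence on the monoid of words that identifies, for each \<open>v \<in> V\<close>, the
  unit of \<open>\<G> v\<close> with the empty word and formal products in \<open>\<G> v\<close> with actual ones.\<close>

inductive free_eq ::
    "'v set \<Rightarrow> ('v \<Rightarrow> ('g, 'm) monoid_scheme) \<Rightarrow> ('v \<times> 'g) list \<Rightarrow> ('v \<times> 'g) list \<Rightarrow> bool"
  for V \<G> where
  unit: "v \<in> V \<Longrightarrow> free_eq V \<G> [(v, \<one>\<^bsub>\<G> v\<^esub>)] []"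
| mult: "\<lbrakk>v \<in> V; g \<in> carrier (\<G> v); h \<in> carrier (\<G> v)\<rbrakk>
    \<Longrightarrow> free_eq V \<G> [(v, g), (v, h)] [(v, g \<otimes>\<^bsub>\<G> v\<^esub> h)]"
| refl: "x \<in> free_words V \<G> \<Longrightarrow> free_eq V \<G> x x"
| sym: "free_eq V \<G> x y \<Longrightarrow> free_eq V \<G> y x"
| trans: "\<lbrakk>free_eq V \<G> x y; free_eq V \<G> y z\<rbrakk> \<Longrightarrow> free_eq V \<G> x z"
| append: "\<lbrakk>free_eq V \<G> x y; free_eq V \<G> x' y'\<rbrakk> \<Longrightarrow> free_eq V \<G> (x @ x') (y @ y')"

definition free_class ::
    "'v set \<Rightarrow> ('v \<Rightarrow> ('g, 'm) monoid_scheme) \<Rightarrow> ('v \<times> 'g) list \<Rightarrow> ('v \<times> 'g) list set" where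
  "free_class V \<G> x = {y. free_eq V \<G> x y}"

definition free_product ::
    "'v set \<Rightarrow> ('v \<Rightarrow> ('g, 'm) monoid_scheme) \<Rightarrow> ('v \<times> 'g) list set monoid" where
  "free_product V \<G> =
    \<lparr>carrier = free_class V \<G> ` free_words V \<G>,
     monoid.mult = (\<lambda>A B. \<Union>a\<in>A. \<Union>b\<in>B. free_class V \<G> (a @ b)),
     one = free_class V \<G> []\<rparr>"

definition free_incl ::
    "'v set \<Rightarrow> ('v \<Rightarrow> ('g, 'm) monoid_scheme) \<Rightarrow> 'v \<Rightarrow> 'g \<Rightarrow> ('v \<times> 'g) list set" where
  "free_incl V \<G> v g = free_class V \<G> [(v, g)]"

definition commutator :: "('a, 'm) monoid_scheme \<Rightarrow> 'a \<Rightarrow> 'a \<Rightarrow> 'a" where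
  "commutator K x y = x \<otimes>\<^bsub>K\<^esub> y \<otimes>\<^bsub>K\<^esub> inv\<^bsub>K\<^esub> x \<otimes>\<^bsub>K\<^esub> inv\<^bsub>K\<^esub> y"

definition normal_closure :: "('a, 'm) monoid_scheme \<Rightarrow> 'a set \<Rightarrow> 'a set" where
  "normal_closure K S = \<Inter>{N. N \<lhd> K \<and> S \<subseteq> N}"

definition graph_commutators ::
    "('v, 'e) pre_digraph \<Rightarrow> ('v \<Rightarrow> ('g, 'm) monoid_scheme) \<Rightarrow> ('v \<times> 'g) list set set" where
  "graph_commutators \<Gamma> \<G> =
    {commutator (free_product (verts \<Gamma>) \<G>)
        (free_incl (verts \<Gamma>) \<G> u g) (free_incl (verts \<Gamma>) \<G> v h) | u v g h.
      u \<rightarrow>\<^bsub>\<Gamma>\<^esub> v \<and> g \<in> carrier (\<G> u) \<and> h \<in> carrier (\<G> v)}"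

definition graph_product ::
    "('v, 'e) pre_digraph \<Rightarrow> ('v \<Rightarrow> ('g, 'm) monoid_scheme) \<Rightarrow> ('v \<times> 'g) list set set monoid" where
  "graph_product \<Gamma> \<G> =
    free_product (verts \<Gamma>) \<G> Mod
      normal_closure (free_product (verts \<Gamma>) \<G>) (graph_commutators \<Gamma> \<G>)"

lemma free_eq_words:
  assumes "\<And>v. v \<in> V \<Longrightarrow> group (\<G> v)" "free_eq V \<G> x y"
  shows "x \<in> free_words V \<G> \<and> y \<in> free_words V \<G>"
  using assms(2)
  by induction (simp_all add: free_words_def assms(1) group.is_monoid monoid.m_closed)

lemma free_class_eq_iff:
  assumes "y \<in> free_words V \<G>"
  shows "free_class V \<G> x = free_class V \<G> y \<longleftrightarrow> free_eq V \<G> x y"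
proof
  assume "free_class V \<G> x = free_class V \<G> y"
  then show "free_eq V \<G> x y"
    using free_eq.refl[OF assms] unfolding free_class_def by blast
next
  assume xy: "free_eq V \<G> x y"
  show "free_class V \<G> x = free_class V \<G> y"
    unfolding free_class_def
    using free_eq.trans[OF xy] free_eq.trans[OF free_eq.sym[OF xy]] by blast
qed

lemma free_product_mult:
  assumes "x \<in> free_words V \<G>" "y \<in> free_words V \<G>"
  shows "free_class V \<G> x \<otimes>\<^bsub>free_product V \<G>\<^esub> free_class V \<G> y = free_class V \<G> (x @ y)"
proof -
  have *: "free_class V \<G> (a @ b) = free_class V \<G> (x @ y)"
    if "a \<in> free_class V \<G> x" "b \<in> free_class V \<G> y" for a b
  proof -
    have "free_eq V \<G> (a @ b) (x @ y)"
      using that unfolding free_class_def by (intro free_eq.append) (simp_all add: free_eq.sym)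
    then show ?thesis
      by (subst free_class_eq_iff) (use assms in \<open>auto simp: free_words_def\<close>)
  qed
  have "x \<in> free_class V \<G> x" "y \<in> free_class V \<G> y"
    using assms by (simp_all add: free_class_def free_eq.refl)
  then have "free_class V \<G> x \<noteq> {}" "free_class V \<G> y \<noteq> {}"
    by blast+
  then show ?thesis
    by (simp add: free_product_def * cong: SUP_cong)
qed

lemma free_word_inverse:
  assumes G: "\<And>v. v \<in> V \<Longrightarrow> group (\<G> v)" and x: "x \<in> free_words V \<G>"
  shows "\<exists>y \<in> free_words V \<G>. free_eq V \<G> (y @ x) []"
  using x
proof (induction x)
  case Nil
  then show ?case using free_eq.refl by force
next
  case (Cons a x)
  obtain v g where a: "a = (v, g)" by force
  with Cons.prems have v: "v \<in> V" "g \<in> carrier (\<G> v)" and x: "x \<in> free_words V \<G>"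
    by (auto simp: free_words_def)
  interpret group "\<G> v" using G v by blast
  obtain y where y: "y \<in> free_words V \<G>" "free_eq V \<G> (y @ x) []"
    using Cons.IH x by blast
  let ?i = "(v, inv\<^bsub>\<G> v\<^esub> g)"
  have "free_eq V \<G> [?i, (v, g)] [(v, \<one>\<^bsub>\<G> v\<^esub>)]"
    using free_eq.mult[of v V "inv\<^bsub>\<G> v\<^esub> g" \<G> g] v by simp
  then have "free_eq V \<G> [?i, (v, g)] []"
    using free_eq.unit[OF v(1)] by (rule free_eq.trans)
  then have "free_eq V \<G> (y @ [?i, (v, g)] @ x) (y @ [] @ x)"
    using x y by (intro free_eq.append free_eq.refl)
  then have "free_eq V \<G> ((y @ [?i]) @ a # x) []"
    using free_eq.trans[OF _ y(2)] a by simp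
  moreover have "y @ [?i] \<in> free_words V \<G>"
    using y v by (auto simp: free_words_def)
  ultimately show ?case by blast
qed

lemma group_free_product:
  assumes "\<And>v. v \<in> V \<Longrightarrow> group (\<G> v)"
  shows "group (free_product V \<G>)"
proof (rule groupI)
  let ?P = "free_product V \<G>"
  have app: "x @ y \<in> free_words V \<G>" if "x \<in> free_words V \<G>" "y \<in> free_words V \<G>" for x y
    using that by (auto simp: free_words_def)
  have nil: "[] \<in> free_words V \<G>"
    by (simp add: free_words_def)
  have car: "carrier ?P = free_class V \<G> ` free_words V \<G>"
    and one: "\<one>\<^bsub>?P\<^esub> = free_class V \<G> []"
    by (simp_all add: free_product_def)
  show "\<one>\<^bsub>?P\<^esub> \<in> carrier ?P"
    using nil by (simp add: car one)
  fix x assume x: "x \<in> carrier ?P"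
  show "\<one>\<^bsub>?P\<^esub> \<otimes>\<^bsub>?P\<^esub> x = x"
    using x nil by (auto simp: car one free_product_mult)
  show "\<exists>y\<in>carrier ?P. y \<otimes>\<^bsub>?P\<^esub> x = \<one>\<^bsub>?P\<^esub>"
  proof -
    obtain w where w: "w \<in> free_words V \<G>" "x = free_class V \<G> w"
      using x car by auto
    obtain u where u: "u \<in> free_words V \<G>" "free_eq V \<G> (u @ w) []"
      using free_word_inverse[of V \<G> w] assms w by blast
    then have "free_class V \<G> u \<otimes>\<^bsub>?P\<^esub> x = \<one>\<^bsub>?P\<^esub>"
      using w nil by (simp add: free_product_mult free_class_eq_iff one)
    then show ?thesis using u car by blast
  qed
  fix y assume y: "y \<in> carrier ?P"
  show "x \<otimes>\<^bsub>?P\<^esub> y \<in> carrier ?P"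
    using x y app by (auto simp: car free_product_mult)
  fix z assume z: "z \<in> carrier ?P"
  show "x \<otimes>\<^bsub>?P\<^esub> y \<otimes>\<^bsub>?P\<^esub> z = x \<otimes>\<^bsub>?P\<^esub> (y \<otimes>\<^bsub>?P\<^esub> z)"
    using x y z app by (auto simp: car free_product_mult)
qed

lemma free_incl_hom:
  assumes "v \<in> V" "group (\<G> v)"
  shows "free_incl V \<G> v \<in> hom (\<G> v) (free_product V \<G>)"
proof -
  interpret group "\<G> v" by fact
  have w: "[(v, g)] \<in> free_words V \<G>" if "g \<in> carrier (\<G> v)" for g
    using that assms by (auto simp: free_words_def)
  show ?thesis
  proof (rule homI)
    fix g h assume gh: "g \<in> carrier (\<G> v)" "h \<in> carrier (\<G> v)"
    have "free_class V \<G> [(v, g), (v, h)] = free_class V \<G> [(v, g \<otimes>\<^bsub>\<G> v\<^esub> h)]"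
      using free_eq.mult[of v V g \<G> h] assms w gh by (subst free_class_eq_iff) auto
    then show "free_incl V \<G> v (g \<otimes>\<^bsub>\<G> v\<^esub> h)
        = free_incl V \<G> v g \<otimes>\<^bsub>free_product V \<G>\<^esub> free_incl V \<G> v h"
      using w gh by (simp add: free_incl_def free_product_mult)
  qed (use w in \<open>simp add: free_incl_def free_product_def\<close>)
qed

lemma graph_commutators_subset:
  assumes "wf_digraph \<Gamma>" "\<And>v. v \<in> verts \<Gamma> \<Longrightarrow> group (\<G> v)"
  shows "graph_commutators \<Gamma> \<G> \<subseteq> carrier (free_product (verts \<Gamma>) \<G>)"
proof
  let ?P = "free_product (verts \<Gamma>) \<G>"
  interpret P: group ?P using assms(2) by (rule group_free_product)
  fix z assume "z \<in> graph_commutators \<Gamma> \<G>"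
  then obtain u v g h where uv: "u \<rightarrow>\<^bsub>\<Gamma>\<^esub> v" and g: "g \<in> carrier (\<G> u)" "h \<in> carrier (\<G> v)"
    and z: "z = commutator ?P (free_incl (verts \<Gamma>) \<G> u g) (free_incl (verts \<Gamma>) \<G> v h)"
    unfolding graph_commutators_def by blast
  have "u \<in> verts \<Gamma>" "v \<in> verts \<Gamma>"
    using wf_digraph.adj_in_verts[OF assms(1) uv] by auto
  then have "free_incl (verts \<Gamma>) \<G> u \<in> hom (\<G> u) ?P" "free_incl (verts \<Gamma>) \<G> v \<in> hom (\<G> v) ?P"
    by (simp_all add: free_incl_hom assms(2))
  then have "free_incl (verts \<Gamma>) \<G> u g \<in> carrier ?P" "free_incl (verts \<Gamma>) \<G> v h \<in> carrier ?P"
    using g by (auto simp: hom_def)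
  then show "z \<in> carrier ?P"
    unfolding z commutator_def by simp
qed

lemma normal_closure_normal:
  assumes "group K" "S \<subseteq> carrier K"
  shows "normal_closure K S \<lhd> K"
proof -
  interpret group K by fact
  have carr: "carrier K \<lhd> K"
    by (auto simp: normal_inv_iff subgroup_self)
  then have "carrier K \<in> {N. N \<lhd> K \<and> S \<subseteq> N}"
    using assms(2) by simp
  then have ne: "{N. N \<lhd> K \<and> S \<subseteq> N} \<noteq> {}" by blast
  have "subgroup (normal_closure K S) K"
    unfolding normal_closure_def by (rule subgroups_Inter[OF _ ne]) (auto simp: normal_inv_iff)
  then show ?thesis
    by (auto simp: normal_inv_iff normal_closure_def)
qed

lemma group_graph_product:
  assumes "wf_digraph \<Gamma>" "\<And>v. v \<in> verts \<Gamma> \<Longrightarrow> group (\<G> v)"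
  shows "group (graph_product \<Gamma> \<G>)"
  unfolding graph_product_def
  by (intro normal.factorgroup_is_group normal_closure_normal group_free_product
      graph_commutators_subset assms)


section \<open>Word metrics and quasi-geodesics\<close>

definition finite_generating_set :: "('a, 'm) monoid_scheme \<Rightarrow> 'a set \<Rightarrow> bool" where
  "finite_generating_set K S \<longleftrightarrow> finite S \<and> S \<subseteq> carrier K \<and> generate K S = carrier K"

definition finitely_generated :: "('a, 'm) monoid_scheme \<Rightarrow> bool" where
  "finitely_generated K \<longleftrightarrow> (\<exists>S. finite_generating_set K S)"

definition word_length :: "('a, 'm) monoid_scheme \<Rightarrow> 'a set \<Rightarrow> 'a \<Rightarrow> nat" where
  "word_length K S x =
    (LEAST n. \<exists>w. length w = n \<and> set w \<subseteq> S \<union> m_inv K ` S \<and> foldr (monoid.mult K) w \<one>\<^bsub>K\<^esub> = x)"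

definition word_dist :: "('a, 'm) monoid_scheme \<Rightarrow> 'a set \<Rightarrow> 'a \<Rightarrow> 'a \<Rightarrow> real" where
  "word_dist K S x y = real (word_length K S (inv\<^bsub>K\<^esub> x \<otimes>\<^bsub>K\<^esub> y))"

definition qi_embedding ::
    "real \<Rightarrow> real \<Rightarrow> 'x set \<Rightarrow> ('x \<Rightarrow> 'x \<Rightarrow> real) \<Rightarrow> 'y set \<Rightarrow> ('y \<Rightarrow> 'y \<Rightarrow> real) \<Rightarrow> ('x \<Rightarrow> 'y) \<Rightarrow> bool"
  where
  "qi_embedding l c A dA B dB f \<longleftrightarrow>
    f ` A \<subseteq> B \<and>
    (\<forall>x\<in>A. \<forall>y\<in>A. dA x y / l - c \<le> dB (f x) (f y) \<and> dB (f x) (f y) \<le> l * dA x y + c)"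

text \<open>Quasi-geodesics are parametrised by compact real intervals and need not be continuous.\<close>

definition quasi_geodesic ::
    "('a, 'm) monoid_scheme \<Rightarrow> 'a set \<Rightarrow> real \<Rightarrow> real \<Rightarrow> real \<Rightarrow> real \<Rightarrow> (real \<Rightarrow> 'a) \<Rightarrow> bool" where
  "quasi_geodesic K S l c a b p \<longleftrightarrow>
    a \<le> b \<and> qi_embedding l c {a..b} dist (carrier K) (word_dist K S) p"

definition nbhd :: "('a, 'm) monoid_scheme \<Rightarrow> 'a set \<Rightarrow> real \<Rightarrow> 'a set \<Rightarrow> 'a set" where
  "nbhd K S M A = {x \<in> carrier K. \<exists>y\<in>A. word_dist K S x y \<le> M}"


section \<open>Stable and Morse subgroups\<close>

text \<open>Word metrics of different finite generating sets are bilipschitz equivalent, so the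
  notions below do not depend on the choice of the generating sets \<open>S\<close> of \<open>K\<close> and \<open>T\<close> of \<open>H\<close>.\<close>

definition stable_subgroup :: "('a, 'm) monoid_scheme \<Rightarrow> 'a set \<Rightarrow> bool" where
  "stable_subgroup K H \<longleftrightarrow>
    (\<exists>S T. finite_generating_set K S \<and> finite_generating_set (K\<lparr>carrier := H\<rparr>) T \<and>
      (\<exists>l\<ge>1. \<exists>c\<ge>0. qi_embedding l c H (word_dist (K\<lparr>carrier := H\<rparr>) T)
                      (carrier K) (word_dist K S) (\<lambda>x. x)) \<and>
      (\<forall>l\<ge>1. \<forall>c\<ge>0. \<exists>M\<ge>0. \<forall>a b p a' b' q.
        quasi_geodesic K S l c a b p \<and> quasi_geodesic K S l c a' b' q \<and>
        p a = q a' \<and> p b = q b' \<and> p a \<in> H \<and> p b \<in> H \<longrightarrow>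
        p ` {a..b} \<subseteq> nbhd K S M (q ` {a'..b'}) \<and> q ` {a'..b'} \<subseteq> nbhd K S M (p ` {a..b})))"

definition morse_subgroup :: "('a, 'm) monoid_scheme \<Rightarrow> 'a set \<Rightarrow> bool" where
  "morse_subgroup K H \<longleftrightarrow>
    (\<exists>S. finite_generating_set K S \<and>
      (\<forall>l\<ge>1. \<forall>c\<ge>0. \<exists>M\<ge>0. \<forall>a b p.
        quasi_geodesic K S l c a b p \<and> p a \<in> H \<and> p b \<in> H \<longrightarrow>
        p ` {a..b} \<subseteq> nbhd K S M H))"

definition infinite_index :: "('a, 'm) monoid_scheme \<Rightarrow> 'a set \<Rightarrow> bool" where
  "infinite_index K H \<longleftrightarrow> infinite (rcosets\<^bsub>K\<^esub> H)"

end

(* A stable subgroup is Morse because geodesics of H are quasi-geodesics of G. It has infinite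
   index because an edge of the graph gives two commuting infinite subgroups G_u, G_v, and the two
   ways around a large square 1, x, y, xy do not fellow-travel.

   Conversely let H be Morse. The star subgroup of v is the direct product of G_v with the infinite
   subgroup generated by the link of v. If H meets a conjugate of a star in an infinite set, detours
   inside the product (quasi-geodesic with universal constants) force the whole coset into a fixed
   neighbourhood of H; this propagates to the neighbouring vertices and then, the graph being
   connected, to all cosets, so that H has finite index. Hence, for H of infinite index, each coset
   of a star meets any neighbourhood of H in a set of uniformly bounded diameter. An edge, labelled
   in G_v, of a geodesic with ends in H is dual to a hyperplane, which every quasi-geodesic with the
   same ends has to cross within the same coset of the star of v. The two crossing points lie
   near H, so they are close to each other: geodesics stay near quasi-geodesics.

   No normal form theorem is needed: the gate in G_v is defined by reading a word from the left and
   multiplying up the letters from G_v that occur while the prefix lies in the star; this is visibly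
   invariant under the defining relations. *)

theory Submission
  imports Defs
begin

section \<open>Word metrics and geodesics\<close>

text \<open>The main obstacle is uniformity. Absorption has to pass through infinitely many cosets,
  so a radius that grows from one coset to the next would be worthless. The induction therefore
  carries a statement without a radius: infinitely many \<open>a\<close> in the star satisfy
  \<open>g \<otimes> a \<otimes> inv g \<in> H\<close>. Absorption turns it into closeness to
  \<open>H\<close> with a radius chosen once for all cosets, and the pigeonhole principle, applied
  to the finitely many short errors, turns closeness of infinitely many points back into it. The
  constants come from gluing: appending a geodesic that leaves an
  \<open>(l, c)\<close>-quasi-geodesic at a linear rate gives \<open>(5 * l, c + 1)\<close>.
  Starting from \<open>(1, 1)\<close>, two gluings give \<open>(25, 3)\<close> and four give
  \<open>(625, 5)\<close>. A vertex group and its link are undistorted because each is the image of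
  an endomorphism of the whole group that sends every generator to itself or to the unit; such a map
  does not increase word length. Stability and the Morse property each choose their own generating
  set, so both are first moved to one fixed \<open>S\<close>.\<close>

locale word_metric = group K for K :: "('a, 'm) monoid_scheme" (structure) +
  fixes S
  assumes gen: "finite_generating_set K S"
begin

definition letters where "letters = S \<union> m_inv K ` S"

abbreviation wlen where "wlen \<equiv> word_length K S"
abbreviation wdist where "wdist \<equiv> word_dist K S"

definition word_prod where "word_prod w = foldr (\<otimes>) w \<one>"

lemma word_prod_simps [simp]:
  "word_prod [] = \<one>" "word_prod (s # w) = s \<otimes> word_prod w"
  by (simp_all add: word_prod_def)

lemma finite_letters: "finite letters"
  using gen by (auto simp: letters_def finite_generating_set_def)

lemma letters_closed: "letters \<subseteq> carrier K"
  using gen by (auto simp: letters_def finite_generating_set_def)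

lemma letter_carrier [simp]: "s \<in> letters \<Longrightarrow> s \<in> carrier K"
  using letters_closed by auto

lemma letters_inv: "s \<in> letters \<Longrightarrow> inv s \<in> letters"
  using gen by (auto simp: letters_def finite_generating_set_def)

lemma word_prod_closed [simp]: "set w \<subseteq> letters \<Longrightarrow> word_prod w \<in> carrier K"
  by (induction w) auto

lemma word_prod_append:
  "set w \<subseteq> letters \<Longrightarrow> set w' \<subseteq> letters \<Longrightarrow> word_prod (w @ w') = word_prod w \<otimes> word_prod w'"
  by (induction w) (auto simp: m_assoc)

lemma word_prod_rev:
  "set w \<subseteq> letters \<Longrightarrow> word_prod (rev (map (m_inv K) w)) = inv (word_prod w)"
proof (induction w)
  case (Cons s w)
  have "word_prod (rev (map (m_inv K) (s # w))) = inv (word_prod w) \<otimes> word_prod [inv s]"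
    using Cons letters_inv word_prod_append[of "rev (map (m_inv K) w)" "[inv s]"]
    by (auto simp del: word_prod_simps)
  then show ?case
    using Cons.prems by (simp add: inv_mult_group)
qed simp

lemma word_exists: "x \<in> carrier K \<Longrightarrow> \<exists>w. set w \<subseteq> letters \<and> word_prod w = x"
proof -
  assume "x \<in> carrier K"
  then have "x \<in> generate K S"
    using gen by (simp add: finite_generating_set_def)
  then show ?thesis
  proof (induction rule: generate.induct)
    case one
    show ?case by (rule exI[of _ "[]"]) simp
  next
    case (incl h)
    then have "h \<in> letters" by (simp add: letters_def)
    then show ?case by (intro exI[of _ "[h]"]) simp
  next
    case (inv h)
    then have "inv h \<in> letters" by (simp add: letters_def)
    then show ?case by (intro exI[of _ "[inv h]"]) simp
  next
    case (eng h1 h2)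
    then obtain w1 w2 where "set w1 \<subseteq> letters" "word_prod w1 = h1" "set w2 \<subseteq> letters" "word_prod w2 = h2"
      by blast
    then show ?case by (intro exI[of _ "w1 @ w2"]) (simp add: word_prod_append)
  qed
qed

lemma wlen_le: "set w \<subseteq> letters \<Longrightarrow> wlen (word_prod w) \<le> length w"
  unfolding word_length_def word_prod_def letters_def by (rule Least_le) blast

lemma geodesic_word:
  assumes "x \<in> carrier K"
  obtains w where "length w = wlen x" "set w \<subseteq> letters" "word_prod w = x"
proof -
  have "\<exists>n w. length w = n \<and> set w \<subseteq> S \<union> m_inv K ` S \<and> foldr (\<otimes>) w \<one> = x"
    using word_exists[OF assms] by (auto simp: word_prod_def letters_def)
  then have "\<exists>w. length w = wlen x \<and> set w \<subseteq> S \<union> m_inv K ` S \<and> foldr (\<otimes>) w \<one> = x"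
    unfolding word_length_def by (rule LeastI_ex)
  then show ?thesis
    using that by (auto simp: word_prod_def letters_def)
qed

lemma wlen_one [simp]: "wlen \<one> = 0"
  using wlen_le[of "[]"] by simp

lemma wlen_eq_0_iff: "x \<in> carrier K \<Longrightarrow> wlen x = 0 \<longleftrightarrow> x = \<one>"
  by (metis geodesic_word length_0_conv wlen_one word_prod_simps(1))

lemma wlen_mult: "x \<in> carrier K \<Longrightarrow> y \<in> carrier K \<Longrightarrow> wlen (x \<otimes> y) \<le> wlen x + wlen y"
proof -
  assume x: "x \<in> carrier K" and y: "y \<in> carrier K"
  obtain u v where "length u = wlen x" "set u \<subseteq> letters" "word_prod u = x"
    "length v = wlen y" "set v \<subseteq> letters" "word_prod v = y"
    using geodesic_word[OF x] geodesic_word[OF y] by metis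
  then show ?thesis
    using wlen_le[of "u @ v"] by (simp add: word_prod_append)
qed

lemma wlen_inv [simp]: "x \<in> carrier K \<Longrightarrow> wlen (inv x) = wlen x"
proof -
  have le: "wlen (inv x) \<le> wlen x" if x: "x \<in> carrier K" for x
  proof -
    obtain u where u: "length u = wlen x" "set u \<subseteq> letters" "word_prod u = x"
      using geodesic_word[OF x] by metis
    then have "set (rev (map (m_inv K) u)) \<subseteq> letters"
      using letters_inv by auto
    from wlen_le[OF this] u show ?thesis
      by (simp add: word_prod_rev)
  qed
  assume "x \<in> carrier K"
  with le[of x] le[of "inv x"] show ?thesis by simp
qed

lemma wlen_letter: "s \<in> letters \<Longrightarrow> wlen s \<le> 1"
  using wlen_le[of "[s]"] by simp

lemma finite_ball: "finite {x \<in> carrier K. wlen x \<le> n}"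
proof -
  have "{x \<in> carrier K. wlen x \<le> n} \<subseteq> word_prod ` {w. set w \<subseteq> letters \<and> length w \<le> n}"
  proof
    fix x assume "x \<in> {x \<in> carrier K. wlen x \<le> n}"
    then obtain w where "length w = wlen x" "set w \<subseteq> letters" "word_prod w = x" "wlen x \<le> n"
      using geodesic_word by blast
    then show "x \<in> word_prod ` {w. set w \<subseteq> letters \<and> length w \<le> n}" by force
  qed
  then show ?thesis
    using finite_lists_length_le[OF finite_letters] finite_surj by blast
qed

lemma infinite_unbounded:
  assumes "infinite B" "B \<subseteq> carrier K"
  shows "\<exists>b\<in>B. wlen b > n"
proof (rule ccontr)
  assume "\<not> ?thesis"
  then have "B \<subseteq> {x \<in> carrier K. wlen x \<le> n}"
    using assms(2) by (auto simp: not_less)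
  then show False
    using assms(1) finite_ball finite_subset by blast
qed

text \<open>Letters are multiplied on the right, the direction in which a path in the Cayley graph
  grows and in which gates are computed later.\<close>

lemma letters_induct [consumes 1, case_names one mult]:
  assumes "x \<in> carrier K" "P \<one>" "\<And>x s. x \<in> carrier K \<Longrightarrow> s \<in> letters \<Longrightarrow> P x \<Longrightarrow> P (x \<otimes> s)"
  shows "P x"
proof -
  have "P (word_prod w)" if "set w \<subseteq> letters" for w
    using that
  proof (induction w rule: rev_induct)
    case (snoc s w)
    then show ?case
      using assms(3)[of "word_prod w" s] by (simp add: word_prod_append)
  qed (simp add: assms)
  then show ?thesis
    using word_exists[OF assms(1)] by blast
qed

text \<open>Dropping the last letter of a shortest word leaves a shortest word. This drives the
  inductions on word length.\<close>

lemma wlen_Suc: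
  assumes "x \<in> carrier K" "wlen x = Suc n"
  obtains y s where "y \<in> carrier K" "s \<in> letters" "x = y \<otimes> s" "wlen y = n"
proof -
  obtain w where w: "length w = wlen x" "set w \<subseteq> letters" "word_prod w = x"
    using geodesic_word[OF assms(1)] .
  with assms obtain u s where us: "w = u @ [s]"
    by (metis length_Suc_conv_rev)
  have x: "x = word_prod u \<otimes> s" and u: "set u \<subseteq> letters" "s \<in> letters"
    using w us by (auto simp: word_prod_append)
  have "wlen (word_prod u) \<le> n"
    using wlen_le[OF u(1)] w us assms by simp
  moreover have "Suc n \<le> wlen (word_prod u) + 1"
    using wlen_mult[of "word_prod u" s] wlen_letter[OF u(2)] u x assms by simp
  ultimately show ?thesis
    using that[of "word_prod u" s] u x by simp
qed

lemma wdist_nonneg [simp]: "0 \<le> wdist x y"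
  by (simp add: word_dist_def)

lemma wdist_self [simp]: "x \<in> carrier K \<Longrightarrow> wdist x x = 0"
  by (simp add: word_dist_def)

lemma wdist_commute: "x \<in> carrier K \<Longrightarrow> y \<in> carrier K \<Longrightarrow> wdist x y = wdist y x"
  using wlen_inv[of "inv x \<otimes> y"] by (simp add: word_dist_def inv_mult_group)

lemma inv_mult_cancel3:
  "x \<in> carrier K \<Longrightarrow> y \<in> carrier K \<Longrightarrow> z \<in> carrier K \<Longrightarrow> (inv x \<otimes> y) \<otimes> (inv y \<otimes> z) = inv x \<otimes> z"
  by (metis (no_types, lifting) inv_closed inv_solve_left m_assoc m_closed)

lemma wdist_triangle:
  "x \<in> carrier K \<Longrightarrow> y \<in> carrier K \<Longrightarrow> z \<in> carrier K \<Longrightarrow> wdist x z \<le> wdist x y + wdist y z"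
  using wlen_mult[of "inv x \<otimes> y" "inv y \<otimes> z"]
  by (simp add: word_dist_def inv_mult_cancel3)

lemma wdist_left:
  assumes "g \<in> carrier K" "x \<in> carrier K" "y \<in> carrier K"
  shows "wdist (g \<otimes> x) (g \<otimes> y) = wdist x y"
proof -
  have "inv (g \<otimes> x) \<otimes> (g \<otimes> y) = inv x \<otimes> y"
    using assms by (simp add: inv_mult_group m_assoc flip: m_assoc[of "inv g" g y])
  then show ?thesis by (simp add: word_dist_def)
qed

lemma wdist_one [simp]: "x \<in> carrier K \<Longrightarrow> wdist \<one> x = wlen x"
  by (simp add: word_dist_def)

lemma wdist_one' [simp]: "x \<in> carrier K \<Longrightarrow> wdist x \<one> = wlen x"
  by (simp add: word_dist_def)

lemma wdist_mult: "g \<in> carrier K \<Longrightarrow> a \<in> carrier K \<Longrightarrow> wdist g (g \<otimes> a) = wlen a"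
  using wdist_left[of g \<one> a] by simp

text \<open>Geodesics are discrete, with integer times; \<open>geodesic_quasi\<close> passes to real
  times by rounding down.\<close>

definition geodesic where
  "geodesic f n \<longleftrightarrow> (\<forall>i\<le>n. f i \<in> carrier K) \<and> (\<forall>i\<le>n. \<forall>j\<le>n. wdist (f i) (f j) = \<bar>real i - real j\<bar>)"

text \<open>The \<open>n\<close> steps have length at most 1 and the total is \<open>n\<close>, so
  by the triangle inequality no segment can be shorter than its parameter length.\<close>

lemma geodesicI:
  assumes "\<And>i. i \<le> n \<Longrightarrow> f i \<in> carrier K"
    and step: "\<And>i. i < n \<Longrightarrow> wdist (f i) (f (Suc i)) \<le> 1"
    and ends: "wdist (f 0) (f n) = n"
  shows "geodesic f n"
proof -
  have le: "wdist (f i) (f (i + k)) \<le> k" if "i + k \<le> n" for i k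
    using that
  proof (induction k)
    case (Suc k)
    then show ?case
      using wdist_triangle[of "f i" "f (i + k)" "f (i + Suc k)"] step[of "i + k"] assms(1) by force
  qed (simp add: assms)
  have eq: "wdist (f i) (f j) = real (j - i)" if "i \<le> j" "j \<le> n" for i j
  proof (rule antisym)
    show "wdist (f i) (f j) \<le> real (j - i)"
      using le[of i "j - i"] that by simp
    have "real n \<le> wdist (f 0) (f i) + wdist (f i) (f j) + wdist (f j) (f n)"
      using wdist_triangle[of "f 0" "f i" "f n"] wdist_triangle[of "f i" "f j" "f n"] that assms(1) ends by simp
    also have "\<dots> \<le> i + wdist (f i) (f j) + real (n - j)"
      using le[of 0 i] le[of j "n - j"] that by simp
    finally show "real (j - i) \<le> wdist (f i) (f j)"
      using that by (simp add: of_nat_diff)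
  qed
  show ?thesis
    unfolding geodesic_def
  proof (intro conjI allI impI)
    fix i j assume ij: "i \<le> n" "j \<le> n"
    show "wdist (f i) (f j) = \<bar>real i - real j\<bar>"
      using eq[of i j] eq[of j i] wdist_commute[of "f i" "f j"] assms(1) ij
      by (cases "i \<le> j") (auto simp: of_nat_diff)
  qed (use assms in auto)
qed

lemma geodesic_one_exists:
  assumes "x \<in> carrier K"
  shows "\<exists>f. geodesic f (wlen x) \<and> f 0 = \<one> \<and> f (wlen x) = x"
proof -
  obtain w where w: "length w = wlen x" "set w \<subseteq> letters" "word_prod w = x"
    using geodesic_word[OF assms] .
  let ?f = "\<lambda>i. word_prod (take i w)"
  have sub: "set (take i w) \<subseteq> letters" for i
    using w(2) set_take_subset[of i w] by blast
  have "geodesic ?f (wlen x)"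
  proof (rule geodesicI)
    fix i assume "i < wlen x"
    then have i: "i < length w" "w ! i \<in> letters"
      using w nth_mem by (force, metis nth_mem subset_iff)
    have "?f (Suc i) = ?f i \<otimes> w ! i"
      using i sub by (simp add: take_Suc_conv_app_nth word_prod_append)
    then show "wdist (?f i) (?f (Suc i)) \<le> 1"
      using i sub wlen_letter[of "w ! i"] wdist_mult[of "?f i" "w ! i"] by simp
  qed (use w sub assms in auto)
  then show ?thesis
    using w by (intro exI[of _ ?f]) simp
qed

lemma geodesic_translate:
  "geodesic f n \<Longrightarrow> g \<in> carrier K \<Longrightarrow> geodesic (\<lambda>i. g \<otimes> f i) n"
  by (simp add: geodesic_def wdist_left)

lemma geodesic_exists:
  assumes "x \<in> carrier K" "y \<in> carrier K"
  shows "\<exists>f n. geodesic f n \<and> f 0 = x \<and> f n = y"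
proof -
  have "inv x \<otimes> y \<in> carrier K" using assms by simp
  from geodesic_one_exists[OF this] obtain f where f: "geodesic f (wlen (inv x \<otimes> y))"
    "f 0 = \<one>" "f (wlen (inv x \<otimes> y)) = inv x \<otimes> y" by blast
  have "x \<otimes> (inv x \<otimes> y) = y"
    using assms by (simp flip: m_assoc)
  then show ?thesis
    using geodesic_translate[OF f(1) assms(1)] f assms by force
qed

text \<open>Quasi-geodesics are only remembered through their end points and their image, so that
  reversing and concatenating them needs no bookkeeping of parameters.\<close>

definition qconn where
  "qconn l c x y P \<longleftrightarrow> (\<exists>a b p. quasi_geodesic K S l c a b p \<and> p a = x \<and> p b = y \<and> P = p ` {a..b})"

lemma qconn_subset: "qconn l c x y P \<Longrightarrow> P \<subseteq> carrier K \<and> x \<in> P \<and> y \<in> P"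
  by (auto simp: qconn_def quasi_geodesic_def qi_embedding_def)

text \<open>Clearing the division gives bounds on time differences that can be added along a
  concatenation, and symmetry of the metric leaves only ordered parameters.\<close>

lemma quasi_geodesic_iff:
  assumes "l > 0"
  shows "quasi_geodesic K S l c a b p \<longleftrightarrow> a \<le> b \<and> p ` {a..b} \<subseteq> carrier K \<and>
    (\<forall>x\<in>{a..b}. \<forall>y\<in>{a..b}. x \<le> y \<longrightarrow> y - x \<le> l * (wdist (p x) (p y) + c) \<and> wdist (p x) (p y) \<le> l * (y - x) + c)"
  (is "?L \<longleftrightarrow> ?R")
proof -
  have *: "r / l - c \<le> q \<longleftrightarrow> r \<le> l * (q + c)" for r q :: real
    using assms by (simp add: field_simps)
  show ?thesis
  proof
    assume ?L then show ?R
      unfolding quasi_geodesic_def qi_embedding_def * dist_real_def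
      by (metis abs_minus_commute abs_of_nonneg diff_ge_0_iff_ge)
  next
    assume R: ?R
    have "dist x y \<le> l * (wdist (p x) (p y) + c) \<and> wdist (p x) (p y) \<le> l * dist x y + c"
      if xy: "x \<in> {a..b}" "y \<in> {a..b}" for x y
    proof (cases "x \<le> y")
      case True
      then show ?thesis using R xy by (simp add: dist_real_def)
    next
      case False
      moreover have "p x \<in> carrier K" "p y \<in> carrier K" using R xy by auto
      ultimately show ?thesis using R xy wdist_commute[of "p x" "p y"] by (simp add: dist_real_def)
    qed
    with R show ?L
      unfolding quasi_geodesic_def qi_embedding_def * by blast
  qed
qed

lemma qconn_rev:
  assumes "qconn l c x y P"
  shows "qconn l c y x P"
proof -
  obtain a b p where p: "quasi_geodesic K S l c a b p" "p a = x" "p b = y" "P = p ` {a..b}"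
    using assms by (auto simp: qconn_def)
  have im: "(\<lambda>t. p (- t)) ` {-b..-a} = p ` {a..b}"
    by (metis image_image image_uminus_atLeastAtMost minus_minus)
  have "quasi_geodesic K S l c (-b) (-a) (\<lambda>t. p (- t))"
    unfolding quasi_geodesic_def qi_embedding_def
  proof (intro conjI ballI)
    fix s t assume "s \<in> {-b..-a}" "t \<in> {-b..-a}"
    then have "-s \<in> {a..b}" "-t \<in> {a..b}" and d: "dist (-s) (-t) = dist s t"
      by (auto simp: dist_real_def)
    then have "dist (-s) (-t) / l - c \<le> wdist (p (-s)) (p (-t)) \<and>
        wdist (p (-s)) (p (-t)) \<le> l * dist (-s) (-t) + c"
      using p(1) unfolding quasi_geodesic_def qi_embedding_def by blast
    then show "dist s t / l - c \<le> wdist (p (-s)) (p (-t))" "wdist (p (-s)) (p (-t)) \<le> l * dist s t + c"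
      unfolding d by blast+
  qed (use p(1) im in \<open>simp_all add: quasi_geodesic_def qi_embedding_def\<close>)
  then show ?thesis
    unfolding qconn_def using p im by (intro exI[of _ "-b"] exI[of _ "-a"] exI[of _ "\<lambda>t. p (- t)"]) simp
qed

lemma qconn_mono:
  assumes "qconn l c x y P" "1 \<le> l" "l \<le> l'" "c \<le> c'"
  shows "qconn l' c' x y P"
proof -
  have "quasi_geodesic K S l' c' a b p" if "quasi_geodesic K S l c a b p" for a b p
  proof -
    have "r / l - c \<le> q \<Longrightarrow> r / l' - c' \<le> q" if "r \<ge> 0" for r q :: real
      using frac_le[of r r l l'] assms(2-4) that by linarith
    moreover have "q \<le> l * r + c \<Longrightarrow> q \<le> l' * r + c'" if "r \<ge> 0" for r q :: real
      using mult_right_mono[OF assms(3) that] assms by linarith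
    ultimately show ?thesis
      using that unfolding quasi_geodesic_def qi_embedding_def by (meson zero_le_dist)
  qed
  then show ?thesis
    using assms(1) unfolding qconn_def by blast
qed

text \<open>Rounding real times down changes a time difference by less than 1, hence the additive
  constant 1.\<close>

lemma geodesic_quasi:
  assumes "geodesic f n"
  shows "quasi_geodesic K S 1 1 0 (real n) (\<lambda>t. f (nat \<lfloor>t\<rfloor>))"
    and "(\<lambda>t. f (nat \<lfloor>t\<rfloor>)) ` {0..real n} = f ` {..n}"
proof -
  have nf: "nat \<lfloor>t\<rfloor> \<le> n" if "t \<in> {0..real n}" for t
    using that by (simp add: nat_le_iff floor_le_iff)
  show im: "(\<lambda>t. f (nat \<lfloor>t\<rfloor>)) ` {0..real n} = f ` {..n}"
  proof
    show "f ` {..n} \<subseteq> (\<lambda>t. f (nat \<lfloor>t\<rfloor>)) ` {0..real n}"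
    proof
      fix q assume "q \<in> f ` {..n}"
      then obtain i where "i \<le> n" "q = f i" by auto
      then show "q \<in> (\<lambda>t. f (nat \<lfloor>t\<rfloor>)) ` {0..real n}"
        by (intro image_eqI[where x = "real i"]) auto
    qed
  qed (use nf in auto)
  show "quasi_geodesic K S 1 1 0 (real n) (\<lambda>t. f (nat \<lfloor>t\<rfloor>))"
    unfolding quasi_geodesic_iff[OF zero_less_one]
  proof (intro conjI ballI impI)
    show "(0::real) \<le> real n" by simp
    fix x y assume xy: "x \<in> {0..real n}" "y \<in> {0..real n}" "x \<le> y"
    have "wdist (f (nat \<lfloor>x\<rfloor>)) (f (nat \<lfloor>y\<rfloor>)) = \<bar>real (nat \<lfloor>x\<rfloor>) - real (nat \<lfloor>y\<rfloor>)\<bar>"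
      using assms nf xy by (simp add: geodesic_def)
    also have "\<dots> = real_of_int (\<lfloor>y\<rfloor> - \<lfloor>x\<rfloor>)"
      using xy floor_mono[of x y] by simp
    finally have e: "wdist (f (nat \<lfloor>x\<rfloor>)) (f (nat \<lfloor>y\<rfloor>)) = real_of_int (\<lfloor>y\<rfloor> - \<lfloor>x\<rfloor>)" .
    have gen: "y - x \<le> b - a + 1 \<and> b - a \<le> y - x + 1"
      if "a \<le> x" "x < a + 1" "b \<le> y" "y < b + 1" for a b :: real
      using that by linarith
    have floor_less_one: "t < real_of_int \<lfloor>t\<rfloor> + 1" for t :: real
      by linarith
    show "y - x \<le> 1 * (wdist (f (nat \<lfloor>x\<rfloor>)) (f (nat \<lfloor>y\<rfloor>)) + 1)"
      and "wdist (f (nat \<lfloor>x\<rfloor>)) (f (nat \<lfloor>y\<rfloor>)) \<le> 1 * (y - x) + 1"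
      unfolding e using gen[OF of_int_floor_le floor_less_one of_int_floor_le floor_less_one] by simp_all
  next
    show "(\<lambda>t. f (nat \<lfloor>t\<rfloor>)) ` {0..real n} \<subseteq> carrier K"
      unfolding im using assms by (auto simp: geodesic_def)
  qed
qed

lemma geodesic_qconn: "geodesic f n \<Longrightarrow> qconn 1 1 (f 0) (f n) (f ` {..n})"
  unfolding qconn_def using geodesic_quasi[of f n]
  by (intro exI[of _ 0] exI[of _ "real n"] exI[of _ "\<lambda>t. f (nat \<lfloor>t\<rfloor>)"]) simp

lemma geodesic_between:
  "geodesic f n \<Longrightarrow> q \<in> f ` {..n} \<Longrightarrow> wdist (f 0) q + wdist q (f n) = wdist (f 0) (f n)"
  by (auto simp: geodesic_def)

end

section \<open>Quasi-geodesics and the choice of generators\<close>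

context word_metric
begin

text \<open>The hypothesis \<open>near\<close> says that the geodesic leaves \<open>P\<close> at a
  linear rate. If points on the two pieces are at distance \<open>d\<close>, the corner
  \<open>y\<close> is within \<open>2 * d\<close> of the one on the geodesic, hence within
  \<open>3 * d\<close> of the one on \<open>P\<close>. The sum explains the factor 5; rounding the
  times of the geodesic adds 1.\<close>

lemma qconn_append:
  assumes "qconn l c x y P" "1 \<le> l" "0 \<le> c"
    and f: "geodesic f n" "f 0 = y" "f n = z"
    and near: "\<And>q p. q \<in> f ` {..n} \<Longrightarrow> p \<in> P \<Longrightarrow> wdist q y \<le> 2 * wdist q p"
  shows "qconn (5 * l) (c + 1) x z (P \<union> f ` {..n})"
proof -
  obtain a b p where p: "quasi_geodesic K S l c a b p" "p a = x" "p b = y" "P = p ` {a..b}"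
    using assms(1) by (auto simp: qconn_def)
  have l: "l > 0" using assms by simp
  have ab: "a \<le> b" and pK: "p ` {a..b} \<subseteq> carrier K"
    and low: "\<And>s t. a \<le> s \<Longrightarrow> s \<le> t \<Longrightarrow> t \<le> b \<Longrightarrow> t - s \<le> l * (wdist (p s) (p t) + c)"
    and upp: "\<And>s t. a \<le> s \<Longrightarrow> s \<le> t \<Longrightarrow> t \<le> b \<Longrightarrow> wdist (p s) (p t) \<le> l * (t - s) + c"
    using p(1) unfolding quasi_geodesic_iff[OF l] by auto
  let ?g = "\<lambda>t. f (nat \<lfloor>t\<rfloor>)"
  have g: "?g ` {0..real n} = f ` {..n}" "f ` {..n} \<subseteq> carrier K"
    and g2: "\<And>s t. 0 \<le> s \<Longrightarrow> s \<le> t \<Longrightarrow> t \<le> real n \<Longrightarrow> t - s \<le> wdist (?g s) (?g t) + 1"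
     "\<And>s t. 0 \<le> s \<Longrightarrow> s \<le> t \<Longrightarrow> t \<le> real n \<Longrightarrow> wdist (?g s) (?g t) \<le> t - s + 1"
    using geodesic_quasi[OF f(1)] unfolding quasi_geodesic_iff[OF zero_less_one] by auto
  define h where "h t = (if t \<le> b then p t else ?g (t - b))" for t
  \<comment> \<open>At time \<open>b\<close> both branches give the corner \<open>y\<close>, so the
    two closed parameter intervals may overlap there.\<close>
  have hg: "h t = ?g (t - b)" if "t \<ge> b" for t
    using that f p by (cases "t = b") (auto simp: h_def)
  have im: "h ` {a..b + n} = P \<union> f ` {..n}"
  proof -
    have "h ` {a..b} = P"
      using p(4) by (auto simp: h_def)
    moreover have "h ` {b..b + n} = ?g ` ((\<lambda>t. t - b) ` {b..b + n})"
      unfolding image_image using hg by (intro image_cong) auto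
    moreover have "(\<lambda>t. t - b) ` {b..b + n} = {0..real n}"
      by (simp add: image_diff_atLeastAtMost)
    moreover have "{a..b + n} = {a..b} \<union> {b..b + n}"
      using ab by (simp add: ivl_disj_un_two_touch)
    ultimately show ?thesis
      using g(1) by (metis image_Un)
  qed
  have hK: "h t \<in> carrier K" if "a \<le> t" "t \<le> b + n" for t
    using im g(2) pK p(4) that by (metis (no_types, lifting) Un_least atLeastAtMost_iff image_subset_iff)
  have main: "t - s \<le> 5 * l * (wdist (h s) (h t) + (c + 1)) \<and> wdist (h s) (h t) \<le> 5 * l * (t - s) + (c + 1)"
    if st: "a \<le> s" "s \<le> t" "t \<le> b + n" for s t
  proof -
    let ?d = "wdist (h s) (h t)"
    have d0: "?d \<ge> 0" by simp
    consider "t \<le> b" | "b \<le> s" | "s < b" "b < t" by linarith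
    then show ?thesis
    proof cases
      case 1
      then have hh: "h s = p s" "h t = p t" using st by (auto simp: h_def)
      have "t - s \<le> l * (?d + c)" using low[of s t] 1 st hh by simp
      also have "\<dots> \<le> 5 * l * (?d + (c + 1))"
        using assms d0 by (intro mult_mono) auto
      finally have A: "t - s \<le> 5 * l * (?d + (c + 1))" .
      have "l * (t - s) \<le> 5 * l * (t - s)" using assms st by (intro mult_right_mono) auto
      then show ?thesis using A upp[of s t] 1 st hh by simp
    next
      case 2
      then have hh: "h s = ?g (s - b)" "h t = ?g (t - b)" using st hg by auto
      have A: "t - s \<le> ?d + 1" "?d \<le> (t - s) + 1"
        using g2[of "s - b" "t - b"] 2 st hh by auto
      have "1 * (?d + 1) \<le> 5 * l * (?d + (c + 1))"
        using assms d0 by (intro mult_mono) auto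
      moreover have "1 * (t - s) \<le> 5 * l * (t - s)"
        using assms st by (intro mult_right_mono) auto
      ultimately have "t - s \<le> 5 * l * (?d + (c + 1))" "?d \<le> 5 * l * (t - s) + (c + 1)"
        using A assms(3) by simp_all
      then show ?thesis ..
    next
      case 3
      have hh: "h s = p s" "h t = ?g (t - b)" using 3 hg by (auto simp: h_def)
      have K: "h s \<in> carrier K" "h t \<in> carrier K" "y \<in> carrier K"
        using hK st 3 pK p(3) ab by auto
      have "h t \<in> f ` {..n}"
        using g(1) hh 3 st by (metis (no_types, lifting) atLeastAtMost_iff diff_le_eq add.commute imageI less_eq_real_def diff_ge_0_iff_ge)
      moreover have "p s \<in> P" using p(4) st 3 by auto
      ultimately have i: "wdist (h t) y \<le> 2 * ?d"
        using near[of "h t" "p s"] hh wdist_commute[of "h s" "h t"] K by simp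
      have tb: "t - b \<le> wdist (h t) y + 1" "wdist (h t) y \<le> t - b + 1"
        using g2[of 0 "t - b"] 3 st hh f(2) wdist_commute[of "h t" y] K by auto
      have bs: "b - s \<le> l * (wdist (h s) y + c)" "wdist (h s) y \<le> l * (b - s) + c"
        using low[of s b] upp[of s b] 3 st hh p by auto
      have tri: "wdist (h s) y \<le> ?d + wdist (h t) y" "?d \<le> wdist (h s) y + wdist (h t) y"
        using wdist_triangle[of "h s" "h t" y] wdist_triangle[of "h s" y "h t"] K
          wdist_commute[of "h t" y] by auto
      have "l * (wdist (h s) y + c) \<le> l * (3 * ?d + c)"
        using tri(1) i l by (intro mult_left_mono) auto
      moreover have "1 * (2 * ?d + 1) \<le> l * (2 * ?d + 1)"
        using assms d0 by (intro mult_right_mono) auto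
      ultimately have "t - s \<le> l * (3 * ?d + c) + l * (2 * ?d + 1)"
        using bs(1) tb(1) i by simp
      also have "\<dots> = l * (5 * ?d + c + 1)" by (simp add: algebra_simps)
      also have "\<dots> \<le> l * (5 * (?d + (c + 1)))"
        using l assms by (intro mult_left_mono) auto
      finally have A: "t - s \<le> 5 * l * (?d + (c + 1))" by (simp add: algebra_simps)
      have "l * (b - s) \<le> 5 * l * (b - s)" "1 * (t - b) \<le> 5 * l * (t - b)"
        using assms 3 by (intro mult_right_mono; simp)+
      then have "?d \<le> 5 * l * (b - s) + 5 * l * (t - b) + (c + 1)"
        using tri(2) bs(2) tb(2) by simp
      then have "?d \<le> 5 * l * (t - s) + (c + 1)" by (simp add: algebra_simps)
      with A show ?thesis by simp
    qed
  qed
  have "quasi_geodesic K S (5 * l) (c + 1) a (b + n) h"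
    using assms ab main hK by (subst quasi_geodesic_iff) auto
  then show ?thesis
    unfolding qconn_def using im p f hg[of "b + n"] ab
    by (intro exI[of _ a] exI[of _ "b + n"] exI[of _ h]) (auto simp: h_def)
qed


text \<open>A substitute for continuity, with an arbitrary function \<open>\<phi>\<close>: in a unit
  of time a quasi-geodesic jumps by at most \<open>l + c\<close>. If no edge starting that close to
  \<open>P\<close> changed \<open>\<phi>\<close>, every jump could be filled in by edges and
  \<open>\<phi>\<close> would agree at the ends.\<close>

lemma qconn_crossing:
  assumes "qconn l c x y P" "1 \<le> l" "0 \<le> c" "\<phi> x \<noteq> \<phi> y"
  shows "\<exists>q\<in>P. \<exists>g\<in>carrier K. \<exists>s\<in>letters. \<phi> g \<noteq> \<phi> (g \<otimes> s) \<and> wdist q g \<le> l + c"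
proof (rule ccontr)
  assume neg: "\<not> ?thesis"
  obtain a b p where p: "quasi_geodesic K S l c a b p" "p a = x" "p b = y" "P = p ` {a..b}"
    using assms(1) by (auto simp: qconn_def)
  have l: "l > 0" using assms by simp
  have ab: "a \<le> b" and pK: "\<And>t. a \<le> t \<Longrightarrow> t \<le> b \<Longrightarrow> p t \<in> carrier K"
    and upp: "\<And>s t. a \<le> s \<Longrightarrow> s \<le> t \<Longrightarrow> t \<le> b \<Longrightarrow> wdist (p s) (p t) \<le> l * (t - s) + c"
    using p(1) unfolding quasi_geodesic_iff[OF l] by auto
  \<comment> \<open>Every edge of a shortest word for \<open>g\<close>, read from \<open>q\<close>,
    starts in the ball of radius \<open>l + c\<close> about \<open>q\<close>, so by assumption none
    of them changes \<open>\<phi>\<close>.\<close>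
  have loc: "\<phi> (q \<otimes> g) = \<phi> q" if "q \<in> P" "g \<in> carrier K" "wlen g = n" "n \<le> l + c" for q g n
    using that
  proof (induction n arbitrary: g)
    case 0
    then have "g = \<one>" using wlen_eq_0_iff by simp
    then show ?case using 0 p(4) pK by auto
  next
    case (Suc n)
    obtain h s where hs: "h \<in> carrier K" "s \<in> letters" "g = h \<otimes> s" "wlen h = n"
      using wlen_Suc[OF Suc.prems(2,3)] by blast
    have q: "q \<in> carrier K" using Suc.prems(1) p(4) pK by auto
    have "wdist q (q \<otimes> h) \<le> l + c"
      using Suc.prems hs q wdist_mult[of q h] by simp
    then have "\<phi> (q \<otimes> h) = \<phi> (q \<otimes> h \<otimes> s)"
      using neg hs q Suc.prems(1) by blast
    then show ?case
      using Suc hs q by (simp add: m_assoc)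
  qed
  have "\<phi> (p t) = \<phi> x" if "a \<le> t" "t \<le> b" "t \<le> a + real n" for t n
    using that
  proof (induction n arbitrary: t)
    case 0
    then show ?case using p by simp
  next
    case (Suc n)
    \<comment> \<open>One unit of time back; the first interval may be shorter than a unit, hence
      the cut-off at \<open>a\<close>.\<close>
    define r where "r = max a (t - 1)"
    have r: "a \<le> r" "r \<le> t" "t - r \<le> 1" "r \<le> a + n" "r \<le> b"
      using Suc.prems by (auto simp: r_def)
    have K: "p r \<in> carrier K" "p t \<in> carrier K" using pK r Suc.prems by auto
    have "wdist (p r) (p t) \<le> l * (t - r) + c" using upp r Suc.prems by simp
    also have "\<dots> \<le> l + c" using r l by (simp add: mult_left_le)
    finally have "real (wlen (inv (p r) \<otimes> p t)) \<le> l + c" by (simp add: word_dist_def)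
    then have "\<phi> (p r \<otimes> (inv (p r) \<otimes> p t)) = \<phi> (p r)"
      using loc[of "p r" "inv (p r) \<otimes> p t"] K p(4) r by simp
    then show ?case
      using Suc.IH[of r] r K by (simp flip: m_assoc)
  qed
  moreover obtain n where "b \<le> a + real n"
    by (metis add.commute diff_le_eq real_arch_simple)
  ultimately have "\<phi> (p b) = \<phi> x" using ab by blast
  then show False using assms p by simp
qed

text \<open>Closeness in one direction gives closeness in the other. Cut \<open>P\<close> at the
  time of \<open>q\<close>: some point of the geodesic is near both parts, so the two nearby points
  of \<open>P\<close> are close to each other and bound a short time interval that contains the time
  of \<open>q\<close>.\<close>

lemma geodesic_near_qconn:
  assumes "qconn l c x y P" "1 \<le> l" "0 \<le> c" "0 \<le> D"
    and f: "geodesic f n" "f 0 = x" "f n = y"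
    and near: "\<And>i. i \<le> n \<Longrightarrow> \<exists>q\<in>P. wdist (f i) q \<le> D"
    and q: "q \<in> P"
  shows "\<exists>i\<le>n. wdist q (f i) \<le> D + l * (l * (2 * D + 1 + c)) + c"
proof -
  obtain a b p where p: "quasi_geodesic K S l c a b p" "p a = x" "p b = y" "P = p ` {a..b}"
    using assms(1) by (auto simp: qconn_def)
  have l: "l > 0" using assms by simp
  have ab: "a \<le> b" and pK: "\<And>t. a \<le> t \<Longrightarrow> t \<le> b \<Longrightarrow> p t \<in> carrier K"
    and low: "\<And>s t. a \<le> s \<Longrightarrow> s \<le> t \<Longrightarrow> t \<le> b \<Longrightarrow> t - s \<le> l * (wdist (p s) (p t) + c)"
    and upp: "\<And>s t. a \<le> s \<Longrightarrow> s \<le> t \<Longrightarrow> t \<le> b \<Longrightarrow> wdist (p s) (p t) \<le> l * (t - s) + c"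
    using p(1) unfolding quasi_geodesic_iff[OF l] by auto
  have fK: "f i \<in> carrier K" if "i \<le> n" for i
    using f that by (simp add: geodesic_def)
  obtain t where t: "q = p t" "a \<le> t" "t \<le> b" using q p(4) by auto
  \<comment> \<open>Indices of points near the part of \<open>P\<close> up to time \<open>t\<close>.
    The largest of them is either \<open>n\<close>, the common end, or its successor can only be
    near the later part.\<close>
  define I where "I = {i. i \<le> n \<and> (\<exists>s. a \<le> s \<and> s \<le> t \<and> wdist (f i) (p s) \<le> D)}"
  have "0 \<in> I" using f p t ab fK[of 0] pK[of a] assms by (auto simp: I_def intro!: exI[of _ a])
  have "finite I" unfolding I_def by (rule finite_subset[of _ "{..n}"]) auto
  define i where "i = Max I"
  have i: "i \<in> I" and imax: "\<And>j. j \<in> I \<Longrightarrow> j \<le> i"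
    unfolding i_def using Max_in[OF \<open>finite I\<close>] Max_ge[OF \<open>finite I\<close>] \<open>0 \<in> I\<close> by blast+
  obtain s where s: "i \<le> n" "a \<le> s" "s \<le> t" "wdist (f i) (p s) \<le> D"
    using i by (auto simp: I_def)
  have "\<exists>u. t \<le> u \<and> u \<le> b \<and> wdist (f i) (p u) \<le> D + 1"
  proof (cases "i = n")
    case True
    then show ?thesis using t f p pK[of b] ab assms by (auto intro!: exI[of _ b])
  next
    case False
    then have "Suc i \<le> n" using s by simp
    then obtain u where u: "a \<le> u" "u \<le> b" "wdist (f (Suc i)) (p u) \<le> D"
      using near[of "Suc i"] p(4) by auto
    have "Suc i \<notin> I" using imax[of "Suc i"] by auto
    then have "\<not> u \<le> t" using u \<open>Suc i \<le> n\<close> unfolding I_def by blast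
    then have "t \<le> u" by simp
    have "wdist (f i) (f (Suc i)) = 1"
      using f(1) \<open>Suc i \<le> n\<close> by (simp add: geodesic_def)
    then have "wdist (f i) (p u) \<le> D + 1"
      using wdist_triangle[of "f i" "f (Suc i)" "p u"] fK pK u \<open>Suc i \<le> n\<close> by force
    then show ?thesis using u \<open>t \<le> u\<close> by blast
  qed
  then obtain u where u: "t \<le> u" "u \<le> b" "wdist (f i) (p u) \<le> D + 1" by blast
  have K: "p s \<in> carrier K" "p u \<in> carrier K" "p t \<in> carrier K" "f i \<in> carrier K"
    using pK fK s u t by auto
  have "wdist (p s) (p u) \<le> 2 * D + 1"
    using wdist_triangle[of "p s" "f i" "p u"] wdist_commute[of "f i" "p s"] s u K by simp
  then have "l * (wdist (p s) (p u) + c) \<le> l * (2 * D + 1 + c)"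
    using l by (intro mult_left_mono) auto
  then have "t - s \<le> l * (2 * D + 1 + c)"
    using low[of s u] s u t by simp
  then have "l * (t - s) \<le> l * (l * (2 * D + 1 + c))"
    using l by (intro mult_left_mono) auto
  then have "wdist (p s) (p t) \<le> l * (l * (2 * D + 1 + c)) + c"
    using upp[of s t] s t by simp
  then have "wdist (p t) (f i) \<le> D + l * (l * (2 * D + 1 + c)) + c"
    using wdist_triangle[of "p t" "p s" "f i"] wdist_commute[of "f i" "p s"]
      wdist_commute[of "p s" "p t"] s K by simp
  then show ?thesis using s t by blast
qed

definition morse_wrt where
  "morse_wrt H \<longleftrightarrow> (\<forall>l\<ge>1. \<forall>c\<ge>0. \<exists>M\<ge>0. \<forall>x y P.
     qconn l c x y P \<and> x \<in> H \<and> y \<in> H \<longrightarrow> P \<subseteq> nbhd K S M H)"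

text \<open>One inclusion suffices, because \<open>P\<close> and \<open>Q\<close> may be
  exchanged.\<close>

definition fellow_wrt where
  "fellow_wrt H \<longleftrightarrow> (\<forall>l\<ge>1. \<forall>c\<ge>0. \<exists>M\<ge>0. \<forall>x y P Q.
     qconn l c x y P \<and> qconn l c x y Q \<and> x \<in> H \<and> y \<in> H \<longrightarrow> P \<subseteq> nbhd K S M Q)"

end

section \<open>Independence of the finite generating set\<close>

lemma wlen_change:
  assumes "word_metric K S" "word_metric K S'"
  shows "\<exists>k::nat\<ge>1. \<forall>x\<in>carrier K. word_length K S' x \<le> k * word_length K S x"
proof -
  interpret A: word_metric K S by fact
  interpret B: word_metric K S' by fact
  define k where "k = Suc (Max (insert 0 (B.wlen ` A.letters)))"
  have le: "B.wlen s \<le> k" if "s \<in> A.letters" for s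
  proof -
    have "B.wlen s \<le> Max (insert 0 (B.wlen ` A.letters))"
      using that A.finite_letters by (intro Max_ge) auto
    then show ?thesis by (simp add: k_def)
  qed
  have "B.wlen x \<le> k * n" if "x \<in> carrier K" "A.wlen x = n" for x n
    using that
  proof (induction n arbitrary: x)
    case 0
    then show ?case using A.wlen_eq_0_iff by simp
  next
    case (Suc n)
    obtain y s where "y \<in> carrier K" "s \<in> A.letters" "x = y \<otimes>\<^bsub>K\<^esub> s" "A.wlen y = n"
      using A.wlen_Suc[OF Suc.prems] by blast
    then show ?case
      using Suc.IH[of y] B.wlen_mult[of y s] le[of s] by simp
  qed
  then show ?thesis by (intro exI[of _ k]) (auto simp: k_def)
qed

lemma wdist_change:
  assumes "word_metric K S" "word_metric K S'"
  shows "\<exists>k::real\<ge>1. \<forall>x\<in>carrier K. \<forall>y\<in>carrier K. word_dist K S' x y \<le> k * word_dist K S x y"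
proof -
  interpret A: word_metric K S by fact
  obtain k :: nat where k: "k \<ge> 1" "\<And>x. x \<in> carrier K \<Longrightarrow> word_length K S' x \<le> k * word_length K S x"
    using wlen_change[OF assms] by blast
  have "word_dist K S' x y \<le> k * word_dist K S x y" if "x \<in> carrier K" "y \<in> carrier K" for x y
    using k(2)[of "inv\<^bsub>K\<^esub> x \<otimes>\<^bsub>K\<^esub> y"] that unfolding word_dist_def
    by (metis A.inv_closed A.m_closed of_nat_le_iff of_nat_mult)
  then show ?thesis using k(1) by (intro exI[of _ "real k"]) auto
qed

lemma wdist_bilipschitz:
  assumes "word_metric K S" "word_metric K S'"
  obtains k :: real where "k \<ge> 1"
    "\<And>x y. x \<in> carrier K \<Longrightarrow> y \<in> carrier K \<Longrightarrow> word_dist K S' x y \<le> k * word_dist K S x y"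
    "\<And>x y. x \<in> carrier K \<Longrightarrow> y \<in> carrier K \<Longrightarrow> word_dist K S x y \<le> k * word_dist K S' x y"
proof -
  obtain k where k: "k \<ge> 1" "\<And>x y. x \<in> carrier K \<Longrightarrow> y \<in> carrier K \<Longrightarrow> word_dist K S' x y \<le> k * word_dist K S x y"
    using wdist_change[OF assms] by blast
  obtain k' where k': "k' \<ge> 1" "\<And>x y. x \<in> carrier K \<Longrightarrow> y \<in> carrier K \<Longrightarrow> word_dist K S x y \<le> k' * word_dist K S' x y"
    using wdist_change[OF assms(2,1)] by blast
  have "r * d \<le> max k k' * d" if "r \<le> max k k'" "d \<ge> 0" for r d :: real
    using that by (simp add: mult_right_mono)
  note m = this
  show ?thesis
  proof
    show "1 \<le> max k k'" using k by simp
    fix x y assume xy: "x \<in> carrier K" "y \<in> carrier K"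
    show "word_dist K S' x y \<le> max k k' * word_dist K S x y"
      using k(2)[OF xy] m[of k "word_dist K S x y"] by (simp add: word_dist_def)
    show "word_dist K S x y \<le> max k k' * word_dist K S' x y"
      using k'(2)[OF xy] m[of k' "word_dist K S' x y"] by (simp add: word_dist_def)
  qed
qed

text \<open>A change of metric by a factor of at most \<open>k\<close> in either direction
  multiplies both constants by \<open>k\<close>; since \<open>k \<ge> 1\<close>, the additive
  constant of the lower bound survives as well.\<close>

lemma qconn_change:
  assumes "word_metric K S" "word_metric K S'" "k \<ge> 1" "l \<ge> 1" "c \<ge> 0"
    and k: "\<And>x y. x \<in> carrier K \<Longrightarrow> y \<in> carrier K \<Longrightarrow> word_dist K S' x y \<le> k * word_dist K S x y"
    "\<And>x y. x \<in> carrier K \<Longrightarrow> y \<in> carrier K \<Longrightarrow> word_dist K S x y \<le> k * word_dist K S' x y"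
    and q: "word_metric.qconn K S l c x y P"
  shows "word_metric.qconn K S' (k * l) (k * c) x y P"
proof -
  interpret A: word_metric K S by fact
  interpret B: word_metric K S' by fact
  have l: "l > 0" "k * l > 0" using assms by auto
  obtain a b p where p: "quasi_geodesic K S l c a b p" "p a = x" "p b = y" "P = p ` {a..b}"
    using q by (auto simp: A.qconn_def)
  have ab: "a \<le> b" and pK: "p ` {a..b} \<subseteq> carrier K"
    and low: "\<And>s t. a \<le> s \<Longrightarrow> s \<le> t \<Longrightarrow> t \<le> b \<Longrightarrow> t - s \<le> l * (A.wdist (p s) (p t) + c)"
    and upp: "\<And>s t. a \<le> s \<Longrightarrow> s \<le> t \<Longrightarrow> t \<le> b \<Longrightarrow> A.wdist (p s) (p t) \<le> l * (t - s) + c"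
    using p(1) unfolding A.quasi_geodesic_iff[OF l(1)] by auto
  have "t - s \<le> k * l * (B.wdist (p s) (p t) + k * c) \<and> B.wdist (p s) (p t) \<le> k * l * (t - s) + k * c"
    if st: "a \<le> s" "s \<le> t" "t \<le> b" for s t
  proof
    have K: "p s \<in> carrier K" "p t \<in> carrier K" using pK st by auto
    have "c \<le> k * (k * c)"
      using assms mult_mono[of 1 k c "k * c"] mult_right_mono[of 1 k c] by simp
    then have "A.wdist (p s) (p t) + c \<le> k * (B.wdist (p s) (p t) + k * c)"
      using k(2)[OF K] by (simp add: distrib_left)
    then have "l * (A.wdist (p s) (p t) + c) \<le> l * (k * (B.wdist (p s) (p t) + k * c))"
      using l by (intro mult_left_mono) auto
    then show "t - s \<le> k * l * (B.wdist (p s) (p t) + k * c)"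
      using low[OF st] by (simp add: mult_ac)
    have "k * A.wdist (p s) (p t) \<le> k * (l * (t - s) + c)"
      using upp[OF st] assms by (intro mult_left_mono) auto
    then show "B.wdist (p s) (p t) \<le> k * l * (t - s) + k * c"
      using k(1)[OF K] by (simp add: distrib_left mult_ac)
  qed
  then have "quasi_geodesic K S' (k * l) (k * c) a b p"
    using ab pK by (subst B.quasi_geodesic_iff[OF l(2)]) auto
  then show ?thesis using p by (auto simp: B.qconn_def)
qed

lemma nbhd_change:
  assumes "\<And>x y. x \<in> carrier K \<Longrightarrow> y \<in> carrier K \<Longrightarrow> word_dist K S x y \<le> k * word_dist K S' x y"
    "k \<ge> 1" "A \<subseteq> carrier K"
  shows "nbhd K S' M A \<subseteq> nbhd K S (k * M) A"
proof
  fix x assume "x \<in> nbhd K S' M A"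
  then obtain y where y: "x \<in> carrier K" "y \<in> A" "word_dist K S' x y \<le> M"
    by (auto simp: nbhd_def)
  then have "k * word_dist K S' x y \<le> k * M" using assms by (intro mult_left_mono) auto
  then show "x \<in> nbhd K S (k * M) A"
    using assms(1)[of x y] y assms(3) by (force simp: nbhd_def)
qed

lemma morse_wrt_change:
  assumes "word_metric K S" "word_metric K S'" "H \<subseteq> carrier K" "word_metric.morse_wrt K S' H"
  shows "word_metric.morse_wrt K S H"
proof -
  interpret A: word_metric K S by fact
  interpret B: word_metric K S' by fact
  obtain k where k: "k \<ge> 1"
    "\<And>x y. x \<in> carrier K \<Longrightarrow> y \<in> carrier K \<Longrightarrow> word_dist K S' x y \<le> k * word_dist K S x y"
    "\<And>x y. x \<in> carrier K \<Longrightarrow> y \<in> carrier K \<Longrightarrow> word_dist K S x y \<le> k * word_dist K S' x y"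
    using wdist_bilipschitz[OF assms(1,2)] by blast
  show ?thesis
    unfolding A.morse_wrt_def
  proof (intro allI impI)
    fix l c :: real assume lc: "1 \<le> l" "0 \<le> c"
    have "1 \<le> k * l" "0 \<le> k * c" using k lc mult_mono[of 1 k 1 l] by auto
    then obtain M where M: "M \<ge> 0" "\<And>x y P. B.qconn (k * l) (k * c) x y P \<Longrightarrow> x \<in> H \<Longrightarrow> y \<in> H \<Longrightarrow> P \<subseteq> nbhd K S' M H"
      using assms(4)[unfolded B.morse_wrt_def, rule_format, of "k * l" "k * c"] by auto
    have "P \<subseteq> nbhd K S (k * M) H" if "A.qconn l c x y P" "x \<in> H" "y \<in> H" for x y P
    proof -
      have "P \<subseteq> nbhd K S' M H"
        by (rule M(2)[OF qconn_change[OF assms(1,2) k(1) lc k(2,3) that(1)] that(2,3)])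
      also have "\<dots> \<subseteq> nbhd K S (k * M) H"
        by (rule nbhd_change[OF k(3,1) assms(3)])
      finally show ?thesis .
    qed
    then show "\<exists>M\<ge>0. \<forall>x y P. A.qconn l c x y P \<and> x \<in> H \<and> y \<in> H \<longrightarrow> P \<subseteq> nbhd K S M H"
      using M(1) k(1) by (intro exI[of _ "k * M"] conjI allI impI) (simp, blast)
  qed
qed

lemma fellow_wrt_change:
  assumes "word_metric K S" "word_metric K S'" "word_metric.fellow_wrt K S' H"
  shows "word_metric.fellow_wrt K S H"
proof -
  interpret A: word_metric K S by fact
  interpret B: word_metric K S' by fact
  obtain k where k: "k \<ge> 1"
    "\<And>x y. x \<in> carrier K \<Longrightarrow> y \<in> carrier K \<Longrightarrow> word_dist K S' x y \<le> k * word_dist K S x y"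
    "\<And>x y. x \<in> carrier K \<Longrightarrow> y \<in> carrier K \<Longrightarrow> word_dist K S x y \<le> k * word_dist K S' x y"
    using wdist_bilipschitz[OF assms(1,2)] by blast
  show ?thesis
    unfolding A.fellow_wrt_def
  proof (intro allI impI)
    fix l c :: real assume lc: "1 \<le> l" "0 \<le> c"
    have "1 \<le> k * l" "0 \<le> k * c" using k lc mult_mono[of 1 k 1 l] by auto
    then obtain M where M: "M \<ge> 0" "\<And>x y P Q. B.qconn (k * l) (k * c) x y P \<Longrightarrow> B.qconn (k * l) (k * c) x y Q \<Longrightarrow>
        x \<in> H \<Longrightarrow> y \<in> H \<Longrightarrow> P \<subseteq> nbhd K S' M Q"
      using assms(3)[unfolded B.fellow_wrt_def, rule_format, of "k * l" "k * c"] by metis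
    have "P \<subseteq> nbhd K S (k * M) Q" if "A.qconn l c x y P" "A.qconn l c x y Q" "x \<in> H" "y \<in> H" for x y P Q
    proof -
      have "P \<subseteq> nbhd K S' M Q"
        by (rule M(2)[OF qconn_change[OF assms(1,2) k(1) lc k(2,3) that(1)]
              qconn_change[OF assms(1,2) k(1) lc k(2,3) that(2)] that(3,4)])
      also have "\<dots> \<subseteq> nbhd K S (k * M) Q"
        using A.qconn_subset[OF that(2)] by (intro nbhd_change[OF k(3,1)]) auto
      finally show ?thesis .
    qed
    then show "\<exists>M\<ge>0. \<forall>x y P Q. A.qconn l c x y P \<and> A.qconn l c x y Q \<and> x \<in> H \<and> y \<in> H \<longrightarrow> P \<subseteq> nbhd K S M Q"
      using M(1) k(1) by (intro exI[of _ "k * M"] conjI allI impI) (simp, blast)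
  qed
qed

text \<open>The definition asks for some generating set; by the change of generators the fixed
  \<open>S\<close> serves equally well.\<close>

lemma morse_subgroup_iff:
  assumes "word_metric K S" "H \<subseteq> carrier K"
  shows "morse_subgroup K H \<longleftrightarrow> word_metric.morse_wrt K S H"
proof -
  interpret A: word_metric K S by fact
  have eq: "(\<forall>l\<ge>1. \<forall>c\<ge>0. \<exists>M\<ge>0. \<forall>a b p. quasi_geodesic K S' l c a b p \<and> p a \<in> H \<and> p b \<in> H \<longrightarrow>
        p ` {a..b} \<subseteq> nbhd K S' M H) \<longleftrightarrow> word_metric.morse_wrt K S' H" if "word_metric K S'" for S'
  proof -
    interpret B: word_metric K S' by fact
    have "(\<forall>a b p. quasi_geodesic K S' l c a b p \<and> p a \<in> H \<and> p b \<in> H \<longrightarrow> p ` {a..b} \<subseteq> nbhd K S' M H) \<longleftrightarrow>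
      (\<forall>x y P. B.qconn l c x y P \<and> x \<in> H \<and> y \<in> H \<longrightarrow> P \<subseteq> nbhd K S' M H)" for l c M
      unfolding B.qconn_def by blast
    then show ?thesis unfolding B.morse_wrt_def by simp
  qed
  have wm: "word_metric K S' \<longleftrightarrow> finite_generating_set K S'" for S'
    using A.is_group by (simp add: word_metric_def word_metric_axioms_def)
  show ?thesis
  proof
    assume "morse_subgroup K H"
    then obtain S' where S': "finite_generating_set K S'" and
      m: "\<forall>l\<ge>1. \<forall>c\<ge>0. \<exists>M\<ge>0. \<forall>a b p. quasi_geodesic K S' l c a b p \<and> p a \<in> H \<and> p b \<in> H \<longrightarrow>
        p ` {a..b} \<subseteq> nbhd K S' M H"
      unfolding morse_subgroup_def by (elim exE conjE)
    have "word_metric K S'" using wm S' by simp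
    moreover from this have "word_metric.morse_wrt K S' H" using m eq by simp
    ultimately show "A.morse_wrt H" using morse_wrt_change assms by blast
  next
    assume "A.morse_wrt H"
    then show "morse_subgroup K H"
      unfolding morse_subgroup_def using eq[OF assms(1)] A.gen by (intro exI[of _ S] conjI) simp_all
  qed
qed

text \<open>Only the fellow travelling is moved to \<open>S\<close>. The embedding clause keeps its
  own generating sets, the form in which \<open>fellow_wrt_imp_morse_wrt\<close> consumes
  it.\<close>

lemma stable_subgroup_iff:
  assumes "word_metric K S" "H \<subseteq> carrier K"
  shows "stable_subgroup K H \<longleftrightarrow> word_metric.fellow_wrt K S H \<and>
    (\<exists>S T. finite_generating_set K S \<and> finite_generating_set (K\<lparr>carrier := H\<rparr>) T \<and>
      (\<exists>l\<ge>1. \<exists>c\<ge>0. qi_embedding l c H (word_dist (K\<lparr>carrier := H\<rparr>) T)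
                      (carrier K) (word_dist K S) (\<lambda>x. x)))"
proof -
  interpret A: word_metric K S by fact
  have eq: "(\<forall>l\<ge>1. \<forall>c\<ge>0. \<exists>M\<ge>0. \<forall>a b p a' b' q.
        quasi_geodesic K S' l c a b p \<and> quasi_geodesic K S' l c a' b' q \<and>
        p a = q a' \<and> p b = q b' \<and> p a \<in> H \<and> p b \<in> H \<longrightarrow>
        p ` {a..b} \<subseteq> nbhd K S' M (q ` {a'..b'}) \<and> q ` {a'..b'} \<subseteq> nbhd K S' M (p ` {a..b}))
     \<longleftrightarrow> word_metric.fellow_wrt K S' H" if "word_metric K S'" for S'
  proof -
    interpret B: word_metric K S' by fact
    have "(\<forall>a b p a' b' q.
        quasi_geodesic K S' l c a b p \<and> quasi_geodesic K S' l c a' b' q \<and>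
        p a = q a' \<and> p b = q b' \<and> p a \<in> H \<and> p b \<in> H \<longrightarrow>
        p ` {a..b} \<subseteq> nbhd K S' M (q ` {a'..b'}) \<and> q ` {a'..b'} \<subseteq> nbhd K S' M (p ` {a..b})) \<longleftrightarrow>
      (\<forall>x y P Q. B.qconn l c x y P \<and> B.qconn l c x y Q \<and> x \<in> H \<and> y \<in> H \<longrightarrow> P \<subseteq> nbhd K S' M Q)" (is "?A = ?B")
      for l c M
    proof
      assume A: ?A
      show ?B
      proof (intro allI impI, elim conjE)
        fix x y P Q assume "B.qconn l c x y P" "B.qconn l c x y Q" "x \<in> H" "y \<in> H"
        then obtain a b p a' b' q where "quasi_geodesic K S' l c a b p" "quasi_geodesic K S' l c a' b' q"
          "p a = x" "q a' = x" "p b = y" "q b' = y" "P = p ` {a..b}" "Q = q ` {a'..b'}" "x \<in> H" "y \<in> H"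
          unfolding B.qconn_def by blast
        then show "P \<subseteq> nbhd K S' M Q"
          using A[rule_format, of a b p a' b' q] by simp
      qed
    next
      assume B: ?B
      show ?A
      proof (intro allI impI)
        fix a b p a' b' q
        assume H: "quasi_geodesic K S' l c a b p \<and> quasi_geodesic K S' l c a' b' q \<and>
          p a = q a' \<and> p b = q b' \<and> p a \<in> H \<and> p b \<in> H"
        then have "B.qconn l c (p a) (p b) (p ` {a..b})" "B.qconn l c (p a) (p b) (q ` {a'..b'})"
          unfolding B.qconn_def by (blast, metis)
        then show "p ` {a..b} \<subseteq> nbhd K S' M (q ` {a'..b'}) \<and> q ` {a'..b'} \<subseteq> nbhd K S' M (p ` {a..b})"
          using B H by blast
      qed
    qed
    then show ?thesis unfolding B.fellow_wrt_def by simp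
  qed
  have wm: "word_metric K S' \<longleftrightarrow> finite_generating_set K S'" for S'
    using A.is_group by (simp add: word_metric_def word_metric_axioms_def)
  show ?thesis (is "_ \<longleftrightarrow> _ \<and> ?Q")
  proof
    assume "stable_subgroup K H"
    then obtain S' T where S': "finite_generating_set K S'" and T: "finite_generating_set (K\<lparr>carrier := H\<rparr>) T"
      "\<exists>l\<ge>1. \<exists>c\<ge>0. qi_embedding l c H (word_dist (K\<lparr>carrier := H\<rparr>) T)
                      (carrier K) (word_dist K S') (\<lambda>x. x)"
      and m: "\<forall>l\<ge>1. \<forall>c\<ge>0. \<exists>M\<ge>0. \<forall>a b p a' b' q.
        quasi_geodesic K S' l c a b p \<and> quasi_geodesic K S' l c a' b' q \<and>
        p a = q a' \<and> p b = q b' \<and> p a \<in> H \<and> p b \<in> H \<longrightarrow>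
        p ` {a..b} \<subseteq> nbhd K S' M (q ` {a'..b'}) \<and> q ` {a'..b'} \<subseteq> nbhd K S' M (p ` {a..b})"
      unfolding stable_subgroup_def by metis
    have "word_metric K S'" using wm S' by simp
    moreover from this have "word_metric.fellow_wrt K S' H" using m eq by simp
    ultimately have "A.fellow_wrt H" using fellow_wrt_change assms(1) by blast
    then show "A.fellow_wrt H \<and> ?Q" using S' T by (intro conjI exI[of _ S'] exI[of _ T])
  next
    assume "A.fellow_wrt H \<and> ?Q"
    then obtain S' T where "A.fellow_wrt H" "finite_generating_set K S'" and T: "finite_generating_set (K\<lparr>carrier := H\<rparr>) T"
      "\<exists>l\<ge>1. \<exists>c\<ge>0. qi_embedding l c H (word_dist (K\<lparr>carrier := H\<rparr>) T)
                      (carrier K) (word_dist K S') (\<lambda>x. x)" by blast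
    then have S': "word_metric K S'" by (simp add: wm)
    then have "word_metric.fellow_wrt K S' H"
      using fellow_wrt_change[OF S' assms(1)] \<open>A.fellow_wrt H\<close> by blast
    then show "stable_subgroup K H"
      unfolding stable_subgroup_def using eq[OF S'] T \<open>finite_generating_set K S'\<close>
      by (intro exI[of _ S'] exI[of _ T] conjI) simp_all
  qed
qed

section \<open>Undistorted subgroups\<close>

context word_metric
begin

lemma foldr_mult:
  "set w \<subseteq> carrier K \<Longrightarrow> y \<in> carrier K \<Longrightarrow>
    foldr (\<otimes>) w \<one> \<in> carrier K \<and> foldr (\<otimes>) w y = foldr (\<otimes>) w \<one> \<otimes> y"
  by (induction w) (auto simp: m_assoc)

text \<open>The quotients of consecutive members of the chain are short elements of
  \<open>H\<close>, and their product telescopes.\<close>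

lemma chain_word:
  assumes H: "subgroup H K" and k: "\<And>i. i \<le> n \<Longrightarrow> k i \<in> H" "k 0 = \<one>"
    and step: "\<And>i. i < n \<Longrightarrow> wdist (k i) (k (Suc i)) \<le> R"
  shows "\<exists>w. length w = n \<and> set w \<subseteq> {h \<in> H. real (wlen h) \<le> R} \<and> foldr (\<otimes>) w \<one> = k n"
proof -
  have HK: "H \<subseteq> carrier K" using H by (rule subgroup.subset)
  have "\<exists>w. length w = i \<and> set w \<subseteq> {h \<in> H. real (wlen h) \<le> R} \<and> foldr (\<otimes>) w \<one> = k i" if "i \<le> n" for i
    using that
  proof (induction i)
    case 0
    then show ?case using k by (intro exI[of _ "[]"]) simp
  next
    case (Suc i)
    then obtain w where w: "length w = i" "set w \<subseteq> {h \<in> H. real (wlen h) \<le> R}" "foldr (\<otimes>) w \<one> = k i"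
      by auto
    let ?t = "inv (k i) \<otimes> k (Suc i)"
    have K: "k i \<in> carrier K" "k (Suc i) \<in> carrier K" using k(1) Suc.prems HK by auto
    have t: "?t \<in> H" "real (wlen ?t) \<le> R"
      using subgroup.m_closed[OF H] subgroup.m_inv_closed[OF H] k(1) Suc.prems step[of i]
      by (auto simp: word_dist_def)
    have "foldr (\<otimes>) w ?t = foldr (\<otimes>) w \<one> \<otimes> ?t"
      using foldr_mult[of w ?t] w t HK by blast
    then have "foldr (\<otimes>) (w @ [?t]) \<one> = k (Suc i)"
      using w K by (simp flip: m_assoc)
    then show ?case
      using w t by (intro exI[of _ "w @ [?t]"]) simp
  qed
  then show ?thesis by blast
qed

text \<open>An argument in the style of Milnor and Svarc. Each point of a geodesic from the unit to
  \<open>h\<close> is moved into \<open>H\<close> at a cost of at most \<open>M\<close>, so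
  neighbouring points become elements of \<open>H\<close> at distance at most
  \<open>2 * M + 1\<close>. Hence the elements of \<open>H\<close> of that length generate
  \<open>H\<close>, and \<open>h\<close> needs at most \<open>wlen h\<close> of them.\<close>

lemma morse_wrt_undistorted:
  assumes H: "subgroup H K" and m: "morse_wrt H"
  shows "\<exists>T. finite_generating_set (K\<lparr>carrier := H\<rparr>) T \<and>
    (\<exists>l\<ge>1. \<exists>c\<ge>0. qi_embedding l c H (word_dist (K\<lparr>carrier := H\<rparr>) T) (carrier K) wdist (\<lambda>x. x))"
proof -
  have HK: "H \<subseteq> carrier K" using H by (rule subgroup.subset)
  let ?K = "K\<lparr>carrier := H\<rparr>"
  interpret H: group ?K using H is_group by (rule subgroup.subgroup_is_group)
  have invH: "inv\<^bsub>?K\<^esub> h = inv h" if "h \<in> H" for h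
    using m_inv_consistent[OF H that] .
  obtain M where M: "M \<ge> 0" "\<And>x y P. qconn 1 1 x y P \<Longrightarrow> x \<in> H \<Longrightarrow> y \<in> H \<Longrightarrow> P \<subseteq> nbhd K S M H"
    using m[unfolded morse_wrt_def, rule_format, of 1 1] by auto
  define R where "R = 2 * M + 1"
  define T where "T = {h \<in> H. real (wlen h) \<le> R}"
  have T: "T \<subseteq> H" by (auto simp: T_def)
  have short: "\<exists>w. length w = wlen h \<and> set w \<subseteq> T \<and> foldr (\<otimes>) w \<one> = h" if h: "h \<in> H" for h
  proof -
    obtain f where f: "geodesic f (wlen h)" "f 0 = \<one>" "f (wlen h) = h"
      using geodesic_one_exists[of h] h HK by blast
    let ?n = "wlen h"
    have "f ` {..?n} \<subseteq> nbhd K S M H"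
      using M(2)[of "f 0" "f ?n"] geodesic_qconn[OF f(1)] f h subgroup.one_closed[OF H] by simp
    then have "\<forall>i\<le>?n. \<exists>k\<in>H. wdist (f i) k \<le> M" by (force simp: nbhd_def)
    then obtain k' where k': "\<And>i. i \<le> ?n \<Longrightarrow> k' i \<in> H \<and> wdist (f i) (k' i) \<le> M" by metis
    \<comment> \<open>The two ends are kept exactly. If they coincide, \<open>h\<close> has length
      0, so it is the unit and the two values agree.\<close>
    define k where "k i = (if i = 0 then \<one> else if i = ?n then h else k' i)" for i
    have fK: "\<And>i. i \<le> ?n \<Longrightarrow> f i \<in> carrier K" using f by (simp add: geodesic_def)
    have kn: "k ?n = h" using h HK wlen_eq_0_iff[of h] by (auto simp: k_def)
    have k: "k i \<in> H \<and> wdist (f i) (k i) \<le> M" if "i \<le> ?n" for i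
      using that k' subgroup.one_closed[OF H] h HK f M by (auto simp: k_def)
    have "wdist (k i) (k (Suc i)) \<le> R" if "i < ?n" for i
    proof -
      have K: "k i \<in> carrier K" "k (Suc i) \<in> carrier K" "f i \<in> carrier K" "f (Suc i) \<in> carrier K"
        using k[of i] k[of "Suc i"] fK HK that by auto
      have "wdist (f i) (f (Suc i)) = 1" using f(1) that by (simp add: geodesic_def)
      then show ?thesis
        using wdist_triangle[of "k i" "f i" "k (Suc i)"] wdist_triangle[of "f i" "f (Suc i)" "k (Suc i)"]
          wdist_commute[of "k i" "f i"] k[of i] k[of "Suc i"] K that
        unfolding R_def by fastforce
    qed
    then show ?thesis
      using chain_word[OF H, of ?n k R] k kn unfolding T_def by (simp add: k_def)
  qed
  have "finite T"
    by (rule finite_subset[OF _ finite_ball[of "nat \<lceil>R\<rceil>"]]) (use HK in \<open>auto simp: T_def; linarith\<close>)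
  moreover have "generate ?K T = H"
  proof
    show "generate ?K T \<subseteq> H"
      using H.generate_incl[of T] T by simp
    have "foldr (\<otimes>) w \<one> \<in> generate ?K T" if "set w \<subseteq> T" for w
      using that
    proof (induction w)
      case Nil
      then show ?case using generate.one[of ?K T] by simp
    next
      case (Cons t w)
      then show ?case using generate.eng[of t ?K T "foldr (\<otimes>) w \<one>"] generate.incl[of t T ?K] by simp
    qed
    then show "H \<subseteq> generate ?K T"
      using short by blast
  qed
  ultimately have fg: "finite_generating_set ?K T"
    using T by (simp add: finite_generating_set_def)
  interpret H: word_metric ?K T
    using fg by unfold_locales
  have le1: "H.wlen h \<le> wlen h" if h: "h \<in> H" for h
  proof -
    obtain w where w: "length w = wlen h" "set w \<subseteq> T" "foldr (\<otimes>) w \<one> = h"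
      using short[OF h] by blast
    then have "set w \<subseteq> H.letters" by (auto simp: H.letters_def)
    from H.wlen_le[OF this] w show ?thesis by (simp add: H.word_prod_def)
  qed
  have le2: "wlen h \<le> R * H.wlen h" if "h \<in> H" for h
  proof -
    have letter: "real (wlen s) \<le> R" if sl: "s \<in> H.letters" for s
    proof (cases "s \<in> T")
      case False
      then obtain t where t: "t \<in> T" "s = inv\<^bsub>?K\<^esub> t" using sl by (auto simp: H.letters_def)
      then have "t \<in> H" using T by auto
      then have "s = inv t" "t \<in> carrier K" using t invH HK by auto
      then show ?thesis using t by (auto simp: T_def)
    qed (simp add: T_def)
    have "wlen (H.word_prod w) \<le> R * length w \<and> H.word_prod w \<in> H" if "set w \<subseteq> H.letters" for w
      using that
    proof (induction w)
      case (Cons s w)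
      have s: "s \<in> H" using Cons.prems H.letters_closed by auto
      have "wlen (s \<otimes> H.word_prod w) \<le> wlen s + wlen (H.word_prod w)"
        using Cons s HK by (intro wlen_mult) auto
      then have "real (wlen (s \<otimes> H.word_prod w)) \<le> R + R * length w"
        using Cons letter[of s] by fastforce
      then show ?case using Cons s subgroup.m_closed[OF H] by (auto simp: algebra_simps)
    qed (use H.one_closed in simp)
    moreover obtain w where "length w = H.wlen h" "set w \<subseteq> H.letters" "H.word_prod w = h"
      using H.geodesic_word[of h] \<open>h \<in> H\<close> by auto
    ultimately show ?thesis by metis
  qed
  have "qi_embedding R 0 H H.wdist (carrier K) wdist (\<lambda>x. x)"
    unfolding qi_embedding_def
  proof (intro conjI ballI)
    fix x y assume xy: "x \<in> H" "y \<in> H"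
    have e: "H.wdist x y = H.wlen (inv x \<otimes> y)" using xy invH by (simp add: word_dist_def)
    have h: "inv x \<otimes> y \<in> H" using xy subgroup.m_closed[OF H] subgroup.m_inv_closed[OF H] by simp
    have R: "R \<ge> 1" using M by (simp add: R_def)
    have "H.wdist x y / R \<le> H.wdist x y"
      using R frac_le[of "H.wdist x y" "H.wdist x y" 1 R] by simp
    also have "\<dots> \<le> wdist x y" using le1[OF h] by (simp add: e) (simp add: word_dist_def)
    finally show "H.wdist x y / R - 0 \<le> wdist x y" by simp
    show "wdist x y \<le> R * H.wdist x y + 0" using le2[OF h] by (simp add: e) (simp add: word_dist_def)
  qed (use HK in auto)
  then show ?thesis
    using fg M(1) by (intro exI[of _ T] conjI exI[of _ R] exI[of _ 0]) (auto simp: R_def)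
qed

lemma fellow_wrt_imp_morse_wrt:
  assumes H: "subgroup H K" and fel: "fellow_wrt H" and T: "finite_generating_set (K\<lparr>carrier := H\<rparr>) T"
    and S': "finite_generating_set K S'" and l0: "l0 \<ge> 1" "c0 \<ge> 0"
    and qi: "qi_embedding l0 c0 H (word_dist (K\<lparr>carrier := H\<rparr>) T) (carrier K) (word_dist K S') (\<lambda>x. x)"
  shows "morse_wrt H"
proof -
  let ?K = "K\<lparr>carrier := H\<rparr>"
  have HK: "H \<subseteq> carrier K" using H by (rule subgroup.subset)
  interpret H: group ?K using H is_group by (rule subgroup.subgroup_is_group)
  interpret H: word_metric ?K T using T by unfold_locales
  interpret B: word_metric K S' using S' by unfold_locales
  \<comment> \<open>In the additive constant, \<open>c0\<close> comes from the embedding and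
    \<open>l0 + 1\<close> pays for rounding the times of a geodesic of \<open>H\<close>.\<close>
  have path: "\<exists>Q. B.qconn l0 (l0 + c0 + 1) x y Q \<and> Q \<subseteq> H" if xy: "x \<in> H" "y \<in> H" for x y
  proof -
    obtain f n where f: "H.geodesic f n" "f 0 = x" "f n = y"
      using H.geodesic_exists[of x y] xy by auto
    let ?p = "\<lambda>t. f (nat \<lfloor>t\<rfloor>)"
    have q: "?p ` {0..real n} \<subseteq> H"
      "\<And>s t. s \<in> {0..real n} \<Longrightarrow> t \<in> {0..real n} \<Longrightarrow> s \<le> t \<Longrightarrow>
        t - s \<le> H.wdist (?p s) (?p t) + 1 \<and> H.wdist (?p s) (?p t) \<le> t - s + 1"
      using H.geodesic_quasi(1)[OF f(1)] unfolding H.quasi_geodesic_iff[OF zero_less_one] by auto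
    have "t - s \<le> l0 * (B.wdist (?p s) (?p t) + (l0 + c0 + 1)) \<and>
        B.wdist (?p s) (?p t) \<le> l0 * (t - s) + (l0 + c0 + 1)"
      if st: "s \<in> {0..real n}" "t \<in> {0..real n}" "s \<le> t" for s t
    proof
      have K: "?p s \<in> H" "?p t \<in> H" using q(1) st by auto
      have b: "H.wdist (?p s) (?p t) / l0 - c0 \<le> B.wdist (?p s) (?p t)"
        "B.wdist (?p s) (?p t) \<le> l0 * H.wdist (?p s) (?p t) + c0"
        using qi K unfolding qi_embedding_def by auto
      have "H.wdist (?p s) (?p t) \<le> l0 * (B.wdist (?p s) (?p t) + c0)"
        using b(1) l0 by (simp add: field_simps)
      moreover have "1 \<le> l0 * (l0 + 1)"
        using mult_mono[of 1 l0 1 "l0 + 1"] l0 by simp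
      ultimately show "t - s \<le> l0 * (B.wdist (?p s) (?p t) + (l0 + c0 + 1))"
        using q(2)[OF st] by (simp add: distrib_left)
      have "l0 * H.wdist (?p s) (?p t) \<le> l0 * (t - s + 1)"
        using q(2)[OF st] l0 by (intro mult_left_mono) auto
      then show "B.wdist (?p s) (?p t) \<le> l0 * (t - s) + (l0 + c0 + 1)"
        using b(2) by (simp add: distrib_left)
    qed
    then have "quasi_geodesic K S' l0 (l0 + c0 + 1) 0 (real n) ?p"
      using q(1) HK l0 by (subst B.quasi_geodesic_iff) auto
    then show ?thesis
      unfolding B.qconn_def using f q(1) by (intro exI[of _ "?p ` {0..real n}"]) force
  qed
  have wm: "word_metric K S" "word_metric K S'"
    by (rule word_metric_axioms B.word_metric_axioms)+
  have fel': "B.fellow_wrt H" using fellow_wrt_change[OF wm(2,1) fel] .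
  have "B.morse_wrt H"
    unfolding B.morse_wrt_def
  proof (intro allI impI)
    fix l c :: real assume lc: "l \<ge> 1" "c \<ge> 0"
    \<comment> \<open>Fellow travelling compares paths with equal constants; the sums dominate those
      of the given path and those of the path inside \<open>H\<close>.\<close>
    let ?l = "l + l0" and ?c = "c + (l0 + c0 + 1)"
    obtain M where M: "M \<ge> 0" "\<And>x y P Q. B.qconn ?l ?c x y P \<Longrightarrow> B.qconn ?l ?c x y Q \<Longrightarrow> x \<in> H \<Longrightarrow> y \<in> H
       \<Longrightarrow> P \<subseteq> nbhd K S' M Q"
      using fel'[unfolded B.fellow_wrt_def, rule_format, of ?l ?c] lc l0 by force
    have "P \<subseteq> nbhd K S' M H" if P: "B.qconn l c x y P" "x \<in> H" "y \<in> H" for x y P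
    proof -
      obtain Q where Q: "B.qconn l0 (l0 + c0 + 1) x y Q" "Q \<subseteq> H" using path P by blast
      have "P \<subseteq> nbhd K S' M Q"
        using lc l0 by (intro M(2)[OF B.qconn_mono[OF P(1)] B.qconn_mono[OF Q(1)] P(2,3)]) auto
      also have "\<dots> \<subseteq> nbhd K S' M H" using Q(2) by (auto simp: nbhd_def)
      finally show ?thesis .
    qed
    then show "\<exists>M\<ge>0. \<forall>x y P. B.qconn l c x y P \<and> x \<in> H \<and> y \<in> H \<longrightarrow> P \<subseteq> nbhd K S' M H"
      using M(1) by blast
  qed
  then show ?thesis
    using morse_wrt_change[OF wm HK] by blast
qed

text \<open>Left multiplication by \<open>H\<close> is isometric, so the distance from
  \<open>g\<close> to \<open>H\<close> is the least length in the coset \<open>H #> g\<close>.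
  Finitely many cosets have bounded least lengths; conversely a ball is finite and meets only
  finitely many cosets.\<close>

lemma infinite_index_iff:
  assumes "subgroup H K"
  shows "infinite_index K H \<longleftrightarrow> (\<forall>M. \<exists>g\<in>carrier K. \<forall>h\<in>H. wdist g h > M)"
proof -
  have HK: "H \<subseteq> carrier K" using assms by (rule subgroup.subset)
  have "finite (rcosets H) \<longleftrightarrow> (\<exists>M. \<forall>g\<in>carrier K. \<exists>h\<in>H. wdist g h \<le> M)" (is "?L \<longleftrightarrow> ?R")
  proof
    assume ?L
    have "\<forall>C\<in>rcosets H. \<exists>b\<in>carrier K. C = H #> b" by (auto simp: RCOSETS_def)
    then obtain b where b: "\<And>C. C \<in> rcosets H \<Longrightarrow> b C \<in> carrier K \<and> C = H #> b C" by metis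
    define M where "M = Max (insert 0 (wlen ` b ` (rcosets H)))"
    have "\<exists>h\<in>H. wdist g h \<le> M" if g: "g \<in> carrier K" for g
    proof -
      have C: "H #> g \<in> rcosets H" using g HK by (auto simp: RCOSETS_def)
      have "g \<in> H #> b (H #> g)"
        using b[OF C] rcos_self[OF g assms] by metis
      then obtain h where h: "h \<in> H" "g = h \<otimes> b (H #> g)" by (auto simp: r_coset_def)
      have K: "h \<in> carrier K" "b (H #> g) \<in> carrier K" using h HK b[OF C] by auto
      have "wdist g h = wlen (b (H #> g))"
        using wdist_mult[OF K] wdist_commute[of g h] h(2) g K by simp
      also have "\<dots> \<le> M" unfolding M_def using \<open>?L\<close> C by (simp add: Max_ge)
      finally show ?thesis using h by auto
    qed
    then show ?R by blast
  next
    assume ?R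
    then obtain M where M: "\<And>g. g \<in> carrier K \<Longrightarrow> \<exists>h\<in>H. wdist g h \<le> M" by blast
    have "rcosets H \<subseteq> (\<lambda>b. H #> b) ` {b \<in> carrier K. wlen b \<le> nat \<lceil>M\<rceil>}"
    proof
      fix C assume "C \<in> rcosets H"
      then obtain g where g: "g \<in> carrier K" "C = H #> g" by (auto simp: RCOSETS_def)
      obtain h where h: "h \<in> H" "wdist g h \<le> M" using M[OF g(1)] by blast
      have hK: "h \<in> carrier K" using h HK by auto
      have "C = H #> (inv h \<otimes> g)"
        using coset_mult_assoc[of H "inv h" g] coset_join2[of "inv h" H] assms subgroup.m_inv_closed[OF assms h(1)]
          HK hK g by simp
      moreover have "wlen (inv h \<otimes> g) \<le> M"
        using h wdist_commute[of g h] g hK by (simp add: word_dist_def)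
      then have "wlen (inv h \<otimes> g) \<le> nat \<lceil>M\<rceil>" by linarith
      ultimately show "C \<in> (\<lambda>b. H #> b) ` {b \<in> carrier K. wlen b \<le> nat \<lceil>M\<rceil>}" using g hK by auto
    qed
    then show ?L using finite_ball finite_surj by blast
  qed
  then show ?thesis unfolding infinite_index_def by (simp add: not_le)
qed

end

section \<open>Products of commuting subgroups\<close>

context word_metric
begin

text \<open>The abstract form of a vertex group and its link: two commuting retracts whose
  retractions do not increase length and kill the other factor. The notion is symmetric, so that the
  factors can exchange roles.\<close>

definition split_pair where
  "split_pair A B rA rB \<longleftrightarrow> subgroup A K \<and> subgroup B K \<and>
    (\<forall>x\<in>A. \<forall>y\<in>B. x \<otimes> y = y \<otimes> x) \<and> rA \<in> hom K K \<and> rB \<in> hom K K \<and>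
    (\<forall>g\<in>carrier K. wlen (rA g) \<le> wlen g \<and> wlen (rB g) \<le> wlen g \<and> rA g \<in> A \<and> rB g \<in> B) \<and>
    (\<forall>x\<in>A. rA x = x \<and> rB x = \<one>) \<and> (\<forall>y\<in>B. rB y = y \<and> rA y = \<one>)"

lemma split_pair_swap: "split_pair A B rA rB \<Longrightarrow> split_pair B A rB rA"
  unfolding split_pair_def by (auto dest: sym)

text \<open>The retractions read off the two coordinates of a product, so neither coordinate can be
  longer than the product itself.\<close>

lemma split_pairD:
  assumes "split_pair A B rA rB"
  shows "subgroup A K" "subgroup B K" "A \<subseteq> carrier K" "B \<subseteq> carrier K"
    "\<And>x y. x \<in> A \<Longrightarrow> y \<in> B \<Longrightarrow> y \<otimes> x = x \<otimes> y"
    "\<And>x y. x \<in> A \<Longrightarrow> y \<in> B \<Longrightarrow> wlen x \<le> wlen (x \<otimes> y)"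
    "\<And>x y. x \<in> A \<Longrightarrow> y \<in> B \<Longrightarrow> wlen y \<le> wlen (x \<otimes> y)"
proof -
  show A: "subgroup A K" "subgroup B K"
    using assms by (auto simp: split_pair_def)
  then show c: "A \<subseteq> carrier K" "B \<subseteq> carrier K"
    by (simp_all add: subgroup.subset)
  show "\<And>x y. x \<in> A \<Longrightarrow> y \<in> B \<Longrightarrow> y \<otimes> x = x \<otimes> y"
    using assms unfolding split_pair_def by metis
  fix x y assume xy: "x \<in> A" "y \<in> B"
  then have K: "x \<in> carrier K" "y \<in> carrier K" using c by auto
  have "rA (x \<otimes> y) = rA x \<otimes> rA y" "rB (x \<otimes> y) = rB x \<otimes> rB y"
    using assms K by (auto simp: split_pair_def hom_def)
  moreover have "rA x = x" "rA y = \<one>" "rB x = \<one>" "rB y = y"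
    using assms xy by (auto simp: split_pair_def)
  ultimately have "rA (x \<otimes> y) = x" "rB (x \<otimes> y) = y" using K by simp_all
  then show "wlen x \<le> wlen (x \<otimes> y)" "wlen y \<le> wlen (x \<otimes> y)"
    using assms K by (metis m_closed split_pair_def)+
qed

lemma split_pair_dist:
  assumes "split_pair A B rA rB" "g \<in> carrier K" "x \<in> A" "x' \<in> A" "y \<in> B" "y' \<in> B"
  shows "wlen (inv x \<otimes> x') \<le> wdist (g \<otimes> x \<otimes> y) (g \<otimes> x' \<otimes> y')"
    and "wlen (inv y \<otimes> y') \<le> wdist (g \<otimes> x \<otimes> y) (g \<otimes> x' \<otimes> y')"
proof -
  note D = split_pairD[OF assms(1)]
  have K: "x \<in> carrier K" "x' \<in> carrier K" "y \<in> carrier K" "y' \<in> carrier K" using D assms by auto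
  have A: "inv x \<otimes> x' \<in> A" and B: "inv y \<otimes> y' \<in> B"
    using assms D(1,2) by (auto intro!: subgroup.m_closed subgroup.m_inv_closed)
  have "inv (x \<otimes> y) \<otimes> (x' \<otimes> y') = inv y \<otimes> (inv x \<otimes> x') \<otimes> y'"
    using K by (simp add: inv_mult_group m_assoc)
  also have "inv y \<otimes> (inv x \<otimes> x') = (inv x \<otimes> x') \<otimes> inv y"
    using D(5)[OF A] assms D(2) by (auto intro!: subgroup.m_inv_closed)
  also have "(inv x \<otimes> x') \<otimes> inv y \<otimes> y' = (inv x \<otimes> x') \<otimes> (inv y \<otimes> y')"
    using K by (simp add: m_assoc)
  finally have "wdist (x \<otimes> y) (x' \<otimes> y') = wlen ((inv x \<otimes> x') \<otimes> (inv y \<otimes> y'))"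
    by (simp add: word_dist_def)
  then have "wdist (g \<otimes> x \<otimes> y) (g \<otimes> x' \<otimes> y') = wlen ((inv x \<otimes> x') \<otimes> (inv y \<otimes> y'))"
    using wdist_left[of g "x \<otimes> y" "x' \<otimes> y'"] K assms(2) by (simp add: m_assoc)
  then show "wlen (inv x \<otimes> x') \<le> wdist (g \<otimes> x \<otimes> y) (g \<otimes> x' \<otimes> y')"
    and "wlen (inv y \<otimes> y') \<le> wdist (g \<otimes> x \<otimes> y) (g \<otimes> x' \<otimes> y')"
    using D(6,7)[OF A B] by simp_all
qed

text \<open>A geodesic of the whole group may leave \<open>A\<close>; applying \<open>rA\<close>
  brings it back, lengthens no step and fixes the ends, so the result is again a geodesic.\<close>

lemma split_pair_geodesic:
  assumes "split_pair A B rA rB" "g \<in> carrier K" "x \<in> A" "x' \<in> A"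
  shows "\<exists>f n. geodesic f n \<and> f 0 = g \<otimes> x \<and> f n = g \<otimes> x' \<and> (\<forall>i\<le>n. \<exists>z\<in>A. f i = g \<otimes> z) \<and>
    real n = wlen (inv x \<otimes> x')"
proof -
  note D = split_pairD[OF assms(1)]
  let ?a = "inv x \<otimes> x'"
  let ?n = "wlen ?a"
  have a: "?a \<in> A"
    using assms D(1) by (auto intro!: subgroup.m_closed subgroup.m_inv_closed)
  have K: "x \<in> carrier K" "x' \<in> carrier K" "?a \<in> carrier K" using D a assms by auto
  obtain f where f: "geodesic f ?n" "f 0 = \<one>" "f ?n = ?a"
    using geodesic_one_exists[OF K(3)] by blast
  have fK: "f i \<in> carrier K" if "i \<le> ?n" for i using f(1) that by (simp add: geodesic_def)
  have r: "rA \<in> hom K K" "\<And>g. g \<in> carrier K \<Longrightarrow> wlen (rA g) \<le> wlen g \<and> rA g \<in> A"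
     "\<And>x. x \<in> A \<Longrightarrow> rA x = x"
    using assms(1) by (auto simp: split_pair_def)
  have rK: "\<And>g. g \<in> carrier K \<Longrightarrow> rA g \<in> carrier K" using r(2) D(3) by auto
  have rinv: "rA (inv u) = inv (rA u)" if "u \<in> carrier K" for u
    using group_hom.hom_inv[of K K rA u] r(1) that is_group by (simp add: group_hom_def group_hom_axioms_def)
  have lip: "wdist (rA u) (rA v) \<le> wdist u v" if "u \<in> carrier K" "v \<in> carrier K" for u v
  proof -
    have "inv (rA u) \<otimes> rA v = rA (inv u \<otimes> v)"
      using r(1) that rinv by (simp add: hom_def)
    then show ?thesis using r(2)[of "inv u \<otimes> v"] that by (simp add: word_dist_def)
  qed
  have "geodesic (\<lambda>i. rA (f i)) ?n"
  proof (rule geodesicI)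
    show "rA (f i) \<in> carrier K" if "i \<le> ?n" for i using fK rK that by blast
    show "wdist (rA (f i)) (rA (f (Suc i))) \<le> 1" if "i < ?n" for i
      using lip[of "f i" "f (Suc i)"] fK[of i] fK[of "Suc i"] f(1) that by (simp add: geodesic_def)
    have "rA \<one> = \<one>" using r(3) D(1) by (auto intro!: subgroup.one_closed)
    then show "wdist (rA (f 0)) (rA (f ?n)) = ?n"
      using f r(3)[OF a] K by simp
  qed
  then have "geodesic (\<lambda>i. g \<otimes> x \<otimes> rA (f i)) ?n"
    using geodesic_translate[of _ _ "g \<otimes> x"] assms(2) K by simp
  moreover have "g \<otimes> x \<otimes> rA (f 0) = g \<otimes> x" "g \<otimes> x \<otimes> rA (f ?n) = g \<otimes> x'"
    using f r(3)[OF a] r(3)[of \<one>] D(1) K assms(2)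
    by (simp_all add: subgroup.one_closed m_assoc flip: m_assoc[of x "inv x" x'])
  moreover have "\<exists>z\<in>A. g \<otimes> x \<otimes> rA (f i) = g \<otimes> z" if "i \<le> ?n" for i
  proof -
    have z: "rA (f i) \<in> A" using r(2)[OF fK[OF that]] by simp
    then have "x \<otimes> rA (f i) \<in> A" using subgroup.m_closed[OF D(1) assms(3)] by simp
    moreover have "g \<otimes> x \<otimes> rA (f i) = g \<otimes> (x \<otimes> rA (f i))"
      using z D(3) K assms(2) by (auto intro: m_assoc)
    ultimately show ?thesis by blast
  qed
  ultimately show ?thesis
    by (intro exI[of _ "\<lambda>i. g \<otimes> x \<otimes> rA (f i)"] exI[of _ ?n]) blast
qed

text \<open>The long middle segment keeps the two outer segments apart, whatever their lengths.\<close>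

lemma zigzag_path:
  assumes sp: "split_pair A B rA rB" and g: "g \<in> carrier K"
    and A: "x0 \<in> A" "x1 \<in> A" and B: "y0 \<in> B" "y1 \<in> B" "y2 \<in> B"
    and long: "wlen (inv y1 \<otimes> y2) \<le> 2 * wlen (inv x0 \<otimes> x1)"
  shows "\<exists>P. qconn 25 3 (g \<otimes> x0 \<otimes> y0) (g \<otimes> x1 \<otimes> y2) P \<and> g \<otimes> x0 \<otimes> y1 \<in> P \<and>
    (\<forall>p\<in>P. \<exists>x\<in>A. \<exists>y\<in>B. p = g \<otimes> x \<otimes> y)"
proof -
  note D = split_pairD[OF sp]
  note sp' = split_pair_swap[OF sp]
  have K: "x0 \<in> carrier K" "x1 \<in> carrier K" "y0 \<in> carrier K" "y1 \<in> carrier K" "y2 \<in> carrier K"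
    using D A B by auto
  have comm: "g \<otimes> y \<otimes> x = g \<otimes> x \<otimes> y" if "x \<in> A" "y \<in> B" for x y
    using D(5)[OF that] D(3,4) that g by (simp add: m_assoc subset_iff)
  obtain f1 n1 where f1: "geodesic f1 n1" "f1 0 = g \<otimes> x0 \<otimes> y1" "f1 n1 = g \<otimes> x1 \<otimes> y1"
      "\<And>i. i \<le> n1 \<Longrightarrow> \<exists>z\<in>A. f1 i = g \<otimes> z \<otimes> y1"
  proof -
    have "g \<otimes> y1 \<in> carrier K" using g K by simp
    from split_pair_geodesic[OF sp this A] obtain f n where f: "geodesic f n" "f 0 = g \<otimes> y1 \<otimes> x0"
      "f n = g \<otimes> y1 \<otimes> x1" "\<forall>i\<le>n. \<exists>z\<in>A. f i = g \<otimes> y1 \<otimes> z" by blast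
    have "\<exists>z\<in>A. f i = g \<otimes> z \<otimes> y1" if "i \<le> n" for i
      using f(4) that comm[OF _ B(2)] by metis
    then show thesis
      using that[of f n] f(1-3) comm[OF A(1) B(2)] comm[OF A(2) B(2)] by simp
  qed
  obtain f0 n0 where f0: "geodesic f0 n0" "f0 0 = g \<otimes> x0 \<otimes> y1" "f0 n0 = g \<otimes> x0 \<otimes> y0"
      "\<And>i. i \<le> n0 \<Longrightarrow> \<exists>z\<in>B. f0 i = g \<otimes> x0 \<otimes> z"
    using split_pair_geodesic[OF sp', of "g \<otimes> x0" y1 y0] B g K by auto
  obtain f2 n2 where f2: "geodesic f2 n2" "f2 0 = g \<otimes> x1 \<otimes> y1" "f2 n2 = g \<otimes> x1 \<otimes> y2"
      "\<And>i. i \<le> n2 \<Longrightarrow> \<exists>z\<in>B. f2 i = g \<otimes> x1 \<otimes> z" "real n2 = wlen (inv y1 \<otimes> y2)"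
    using split_pair_geodesic[OF sp', of "g \<otimes> x1" y1 y2] B g K by auto
  let ?P1 = "f1 ` {..n1}" and ?P0 = "f0 ` {..n0}" and ?P2 = "f2 ` {..n2}"
  \<comment> \<open>The middle segment comes first, traversed backwards; the outer segments are then
    glued to its two ends, with a reversal in between.\<close>
  have q1: "qconn 1 1 (g \<otimes> x1 \<otimes> y1) (g \<otimes> x0 \<otimes> y1) ?P1"
    using qconn_rev[OF geodesic_qconn[OF f1(1)]] f1 by simp
  have wd: "wdist (g \<otimes> x \<otimes> y) (g \<otimes> x \<otimes> y') = wlen (inv y \<otimes> y')" if "x \<in> carrier K" "y \<in> carrier K" "y' \<in> carrier K" for x y y'
    using wdist_left[of "g \<otimes> x" y y'] that g by (simp add: word_dist_def)
  have "qconn (5 * 1) (1 + 1) (g \<otimes> x1 \<otimes> y1) (g \<otimes> x0 \<otimes> y0) (?P1 \<union> ?P0)"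
  proof (rule qconn_append[OF q1 _ _ f0(1,2,3)])
    fix q p assume "q \<in> ?P0" "p \<in> ?P1"
    then obtain y x where "y \<in> B" "x \<in> A" "q = g \<otimes> x0 \<otimes> y" "p = g \<otimes> x \<otimes> y1"
      using f0(4) f1(4) by blast
    then show "wdist q (g \<otimes> x0 \<otimes> y1) \<le> 2 * wdist q p"
      using split_pair_dist(2)[OF sp g, of x0 x y y1] wd[of x0 y y1] A B K D(4) by auto
  qed simp_all
  then have q2: "qconn 5 2 (g \<otimes> x0 \<otimes> y0) (g \<otimes> x1 \<otimes> y1) (?P1 \<union> ?P0)"
    using qconn_rev by simp
  have "qconn (5 * 5) (2 + 1) (g \<otimes> x0 \<otimes> y0) (g \<otimes> x1 \<otimes> y2) ((?P1 \<union> ?P0) \<union> ?P2)"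
  proof (rule qconn_append[OF q2 _ _ f2(1,2,3)])
    fix q p assume q: "q \<in> ?P2" and p: "p \<in> ?P1 \<union> ?P0"
    obtain y where y: "y \<in> B" "q = g \<otimes> x1 \<otimes> y" using f2(4) q by blast
    then have yK: "y \<in> carrier K" using D(4) by auto
    from p show "wdist q (g \<otimes> x1 \<otimes> y1) \<le> 2 * wdist q p"
    proof
      assume "p \<in> ?P1"
      then obtain x where "x \<in> A" "p = g \<otimes> x \<otimes> y1" using f1(4) by blast
      then show ?thesis
        using split_pair_dist(2)[OF sp g, of x1 x y y1] wd[of x1 y y1] A B K y yK by auto
    next
      \<comment> \<open>Points on the two outer segments differ in \<open>A\<close> by the whole
        middle segment. By \<open>long\<close> this is at least half of \<open>n2\<close>, which
        matches the factor 2 in \<open>qconn_append\<close>.\<close>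
      assume "p \<in> ?P0"
      then obtain y' where "y' \<in> B" "p = g \<otimes> x0 \<otimes> y'" using f0(4) by blast
      then have "wlen (inv x1 \<otimes> x0) \<le> wdist q p"
        using split_pair_dist(1)[OF sp g, of x1 x0 y y'] A y by auto
      moreover have "wlen (inv x1 \<otimes> x0) = wlen (inv x0 \<otimes> x1)"
        using wlen_inv[of "inv x0 \<otimes> x1"] K by (simp add: inv_mult_group)
      moreover have "wdist q (g \<otimes> x1 \<otimes> y1) \<le> n2"
      proof -
        have "wdist (g \<otimes> x1 \<otimes> y1) q + wdist q (g \<otimes> x1 \<otimes> y2) = n2"
          using geodesic_between[OF f2(1) q] f2 wd[of x1 y1 y2] K by simp
        moreover have "wdist q (g \<otimes> x1 \<otimes> y1) = wdist (g \<otimes> x1 \<otimes> y1) q"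
          using wdist_commute y yK g K by simp
        ultimately show ?thesis using wdist_nonneg[of q "g \<otimes> x1 \<otimes> y2"] by linarith
      qed
      ultimately show ?thesis using long f2(5) by simp
    qed
  qed simp_all
  moreover have "g \<otimes> x0 \<otimes> y1 \<in> ?P1" using f1(2) by force
  moreover have "\<exists>x\<in>A. \<exists>y\<in>B. p = g \<otimes> x \<otimes> y" if "p \<in> (?P1 \<union> ?P0) \<union> ?P2" for p
    using that f0(4) f1(4) f2(4) A B by blast
  ultimately show ?thesis by (intro exI[of _ "(?P1 \<union> ?P0) \<union> ?P2"]) auto
qed

section \<open>Absorbing cosets into neighbourhoods of a Morse subgroup\<close>

lemma qconn_extend:
  assumes "qconn l c x y P" "1 \<le> l" "0 \<le> c" "z \<in> carrier K" "wdist y z \<le> M"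
  shows "qconn l (c + M + 1) x z (insert z P)"
proof -
  obtain a b p where p: "quasi_geodesic K S l c a b p" "p a = x" "p b = y" "P = p ` {a..b}"
    using assms(1) by (auto simp: qconn_def)
  have l: "l > 0" using assms by simp
  have M: "M \<ge> 0" using assms(5) wdist_nonneg[of y z] by linarith
  have ab: "a \<le> b" and pK: "p ` {a..b} \<subseteq> carrier K"
    and low: "\<And>s t. a \<le> s \<Longrightarrow> s \<le> t \<Longrightarrow> t \<le> b \<Longrightarrow> t - s \<le> l * (wdist (p s) (p t) + c)"
    and upp: "\<And>s t. a \<le> s \<Longrightarrow> s \<le> t \<Longrightarrow> t \<le> b \<Longrightarrow> wdist (p s) (p t) \<le> l * (t - s) + c"
    using p(1) unfolding quasi_geodesic_iff[OF l] by auto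
  \<comment> \<open>The path jumps by at most \<open>M\<close> and rests at \<open>z\<close> for one
    extra unit of time.\<close>
  define h where "h t = (if t \<le> b then p t else z)" for t
  have im: "h ` {a..b + 1} = insert z P"
  proof
    show "insert z P \<subseteq> h ` {a..b + 1}"
    proof
      fix q assume "q \<in> insert z P"
      then consider "q = h (b + 1)" | t where "t \<in> {a..b}" "q = h t"
        using p(4) by (auto simp: h_def)
      then show "q \<in> h ` {a..b + 1}" using ab by cases auto
    qed
  qed (use p(4) in \<open>auto simp: h_def\<close>)
  have main: "t - s \<le> l * (wdist (h s) (h t) + (c + M + 1)) \<and> wdist (h s) (h t) \<le> l * (t - s) + (c + M + 1)"
    if st: "a \<le> s" "s \<le> t" "t \<le> b + 1" for s t
  proof -
    consider "t \<le> b" | "b < s" | "s \<le> b" "b < t" by linarith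
    then show ?thesis
    proof cases
      case 1
      have "l * (wdist (p s) (p t) + c) \<le> l * (wdist (p s) (p t) + (c + M + 1))"
        using l M by (intro mult_left_mono) auto
      then show ?thesis using low[of s t] upp[of s t] 1 st M by (simp add: h_def)
    next
      case 2
      have "1 \<le> l * (c + M + 1)" using mult_mono[of 1 l 1 "c + M + 1"] assms M by simp
      moreover have "0 \<le> l * (t - s)" using l st by simp
      ultimately show ?thesis using 2 st M assms by (simp add: h_def)
    next
      case 3
      have K: "p s \<in> carrier K" "y \<in> carrier K" using pK p 3 st ab by auto
      have a: "wdist (p s) y \<le> wdist (p s) z + M" "wdist (p s) z \<le> wdist (p s) y + M"
        using wdist_triangle[of "p s" z y] wdist_triangle[of "p s" y z] assms(4,5) K
          wdist_commute[of y z] by auto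
      have "l * (wdist (p s) y + c) \<le> l * (wdist (p s) z + (c + M))"
        using a l by (intro mult_left_mono) auto
      moreover have "b - s \<le> l * (wdist (p s) y + c)" "wdist (p s) y \<le> l * (b - s) + c"
        using low[of s b] upp[of s b] 3 st p by auto
      moreover have "l * (b - s) \<le> l * (t - s)" using l 3 by (intro mult_left_mono) auto
      moreover have "l * (wdist (p s) z + (c + M + 1)) = l * (wdist (p s) z + (c + M)) + l"
        by (simp add: algebra_simps)
      ultimately have "t - s \<le> l * (wdist (p s) z + (c + M + 1))" "wdist (p s) z \<le> l * (t - s) + (c + M + 1)"
        using a 3 st assms(2) by linarith+
      then show ?thesis using 3 by (simp add: h_def)
    qed
  qed
  have "quasi_geodesic K S l (c + M + 1) a (b + 1) h"
    using assms ab main p(4) pK im by (subst quasi_geodesic_iff) auto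
  then show ?thesis
    unfolding qconn_def using im p ab
    by (intro exI[of _ a] exI[of _ "b + 1"] exI[of _ h]) (auto simp: h_def)
qed

text \<open>A zigzag leads from \<open>g \<otimes> x\<close> to
  \<open>g \<otimes> x \<otimes> y\<close>, then across to a far away \<open>x1\<close>, then to
  \<open>g \<otimes> x1\<close>. Its ends are within \<open>M\<close> of \<open>H\<close>; moving
  both into \<open>H\<close> adds \<open>M + 1\<close> twice to the constant 3. The Morse property
  then controls the corner \<open>g \<otimes> x \<otimes> y\<close>.\<close>

lemma absorb_coset:
  assumes sp: "split_pair A B rA rB" and H: "H \<subseteq> carrier K" and inf: "infinite A"
    and M: "0 \<le> M" "\<And>x y P. qconn 25 (3 + 2 * (M + 1)) x y P \<Longrightarrow> x \<in> H \<Longrightarrow> y \<in> H \<Longrightarrow> P \<subseteq> nbhd K S M' H"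
    and g: "g \<in> carrier K" and gA: "\<And>x. x \<in> A \<Longrightarrow> g \<otimes> x \<in> nbhd K S M H"
    and xy: "x \<in> A" "y \<in> B"
  shows "g \<otimes> x \<otimes> y \<in> nbhd K S M' H"
proof -
  note D = split_pairD[OF sp]
  have K: "x \<in> carrier K" "y \<in> carrier K" using D xy by auto
  have one: "\<one> \<in> B" using D(2) by (rule subgroup.one_closed)
  obtain x1 where x1: "x1 \<in> A" "wlen x1 > wlen x + wlen y"
    using infinite_unbounded[OF inf D(3)] by blast
  have x1K: "x1 \<in> carrier K" using x1 D by auto
  have "x1 = x \<otimes> (inv x \<otimes> x1)" using K x1K by (simp flip: m_assoc)
  then have "wlen x1 \<le> wlen x + wlen (inv x \<otimes> x1)"
    using wlen_mult[of x "inv x \<otimes> x1"] K x1K by simp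
  then have "wlen (inv y \<otimes> \<one>) \<le> 2 * wlen (inv x \<otimes> x1)" using x1 K by simp
  from zigzag_path[OF sp g xy(1) x1(1) one xy(2) one this]
  obtain P where P: "qconn 25 3 (g \<otimes> x) (g \<otimes> x1) P" "g \<otimes> x \<otimes> y \<in> P" using g K x1K by auto
  obtain h h1 where h: "h \<in> H" "wdist (g \<otimes> x) h \<le> M" "h1 \<in> H" "wdist (g \<otimes> x1) h1 \<le> M"
    using gA[OF xy(1)] gA[OF x1(1)] by (auto simp: nbhd_def)
  have q1: "qconn 25 (3 + M + 1) (g \<otimes> x) h1 (insert h1 P)"
    using qconn_extend[OF P(1) _ _ _ h(4)] h H by auto
  have "qconn 25 (3 + M + 1 + M + 1) h1 h (insert h (insert h1 P))"
    using qconn_extend[OF qconn_rev[OF q1] _ _ _ h(2)] h H M(1) by auto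
  then have "qconn 25 (3 + 2 * (M + 1)) h1 h (insert h (insert h1 P))"
    by (simp add: algebra_simps)
  from M(2)[OF this h(3,1)] P(2) show ?thesis by auto
qed

text \<open>The path runs through \<open>\<one>\<close>, \<open>g\<close>, \<open>g \<otimes> z\<close>, \<open>g \<otimes> x \<otimes> z\<close>, \<open>g \<otimes> x \<otimes> y\<close> and
  \<open>g \<otimes> x \<otimes> y \<otimes> inv g\<close>; its constants do not depend on the length of \<open>g\<close>.\<close>

lemma absorb_factor:
  assumes sp: "split_pair A B rA rB" and H: "subgroup H K"
    and M: "\<And>x y P. qconn 625 5 x y P \<Longrightarrow> x \<in> H \<Longrightarrow> y \<in> H \<Longrightarrow> P \<subseteq> nbhd K S M H"
    and g: "g \<in> carrier K" and short: "\<And>x y. x \<in> A \<Longrightarrow> y \<in> B \<Longrightarrow> wlen g \<le> wlen (g \<otimes> x \<otimes> y)"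
    and x: "x \<in> A" and y: "y \<in> B" "z \<in> B" and h: "g \<otimes> x \<otimes> y \<otimes> inv g \<in> H"
    and long: "wlen y \<le> wlen x" "wlen z \<le> wlen x" "3 * wlen g \<le> wlen x"
  shows "g \<otimes> z \<in> nbhd K S M H"
proof -
  note D = split_pairD[OF sp]
  have K: "x \<in> carrier K" "y \<in> carrier K" "z \<in> carrier K" using D x y by auto
  have oneA: "\<one> \<in> A" and oneB: "\<one> \<in> B" using D(1,2) by (auto intro: subgroup.one_closed)
  let ?h = "g \<otimes> x \<otimes> y \<otimes> inv g" and ?e = "g \<otimes> x \<otimes> y"
  have hK: "?h \<in> carrier K" "?e \<in> carrier K" using K g by auto
  have "wlen (inv z \<otimes> y) \<le> 2 * wlen (inv \<one> \<otimes> x)"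
    using wlen_mult[of "inv z" y] K long by simp
  from zigzag_path[OF sp g oneA x oneB y(2,1) this]
  obtain P where P: "qconn 25 3 g ?e P" "g \<otimes> z \<in> P" "\<And>p. p \<in> P \<Longrightarrow> \<exists>x\<in>A. \<exists>y\<in>B. p = g \<otimes> x \<otimes> y"
    using g K by auto
  have PK: "P \<subseteq> carrier K" using qconn_subset[OF P(1)] by blast
  obtain f n where f: "geodesic f n" "f 0 = g" "f n = \<one>"
    using geodesic_exists[of g \<one>] g by auto
  obtain f' n' where f': "geodesic f' n'" "f' 0 = ?e" "f' n' = ?h"
    using geodesic_exists[OF hK(2,1)] by auto
  have fK: "f ` {..n} \<subseteq> carrier K" "f' ` {..n'} \<subseteq> carrier K"
    using f(1) f'(1) by (auto simp: geodesic_def)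
  have far1: "wlen g \<le> wdist \<one> p" if "p \<in> P" for p
    using P(3)[OF that] short PK that by auto
  \<comment> \<open>Left translation by \<open>inv ?h\<close> maps the zigzag into the same coset of
    the product, so the minimality of \<open>g\<close> also applies at the end
    \<open>?h\<close>.\<close>
  have far2: "wlen g \<le> wdist ?h p" if p: "p \<in> P" for p
  proof -
    obtain u v where uv: "u \<in> A" "v \<in> B" "p = g \<otimes> u \<otimes> v" using P(3)[OF p] by blast
    have uvK: "u \<in> carrier K" "v \<in> carrier K" using uv D by auto
    have "inv ?h \<otimes> p = g \<otimes> (inv y \<otimes> (inv x \<otimes> u)) \<otimes> v"
      using uv uvK g K by (simp add: inv_mult_group m_assoc flip: m_assoc[of "inv g" g])
    also have "inv y \<otimes> (inv x \<otimes> u) = (inv x \<otimes> u) \<otimes> inv y"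
      using D(1,2) x y uv by (intro D(5)) (auto intro!: subgroup.m_closed subgroup.m_inv_closed)
    also have "g \<otimes> ((inv x \<otimes> u) \<otimes> inv y) \<otimes> v = g \<otimes> (inv x \<otimes> u) \<otimes> (inv y \<otimes> v)"
      using uvK g K by (simp add: m_assoc)
    finally have "wdist ?h p = wlen (g \<otimes> (inv x \<otimes> u) \<otimes> (inv y \<otimes> v))" by (simp add: word_dist_def)
    moreover have "wlen g \<le> wlen (g \<otimes> (inv x \<otimes> u) \<otimes> (inv y \<otimes> v))"
      using D(1,2) x y uv by (intro short) (auto intro!: subgroup.m_closed subgroup.m_inv_closed)
    ultimately show ?thesis by simp
  qed
  have end1: "wdist g \<one> = wlen g" using g by simp
  have end2: "wdist ?e ?h = wlen g"
    using wdist_mult[of ?e "inv g"] g K by simp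
  have "qconn (5 * 25) (3 + 1) ?e \<one> (P \<union> f ` {..n})"
  proof (rule qconn_append[OF qconn_rev[OF P(1)] _ _ f])
    fix q p assume q: "q \<in> f ` {..n}" and p: "p \<in> P"
    have qK: "q \<in> carrier K" "p \<in> carrier K" using q p fK PK by auto
    \<comment> \<open>A geodesic from \<open>g\<close> to the unit cannot approach the zigzag faster
      than it leaves \<open>g\<close>, because no point of the zigzag is closer to the unit than
      \<open>g\<close>.\<close>
    have "wdist q g \<le> wdist q p"
      using geodesic_between[OF f(1) q] f end1 far1[OF p] wdist_triangle[of \<one> q p] qK g
        wdist_commute[of q g] wdist_commute[of q \<one>] by simp
    then show "wdist q g \<le> 2 * wdist q p"
      using wdist_nonneg[of q p] by linarith
  qed simp_all
  then have q1: "qconn 125 4 \<one> ?e (P \<union> f ` {..n})" using qconn_rev by simp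
  have "qconn (5 * 125) (4 + 1) \<one> ?h ((P \<union> f ` {..n}) \<union> f' ` {..n'})"
  proof (rule qconn_append[OF q1 _ _ f'])
    fix q p assume q: "q \<in> f' ` {..n'}" and p: "p \<in> P \<union> f ` {..n}"
    have qK: "q \<in> carrier K" "p \<in> carrier K" using q p fK PK by auto
    have qe: "wdist ?e q + wdist q ?h = wlen g"
      using geodesic_between[OF f'(1) q] f' end2 by simp
    have c: "wdist q ?e = wdist ?e q" "wdist q ?h = wdist ?h q" "wdist q p = wdist p q"
      using wdist_commute qK hK by auto
    from p show "wdist q ?e \<le> 2 * wdist q p"
    proof
      assume "p \<in> P"
      then show ?thesis
        using qe c far2[of p] wdist_triangle[of ?h q p] qK hK wdist_nonneg[of q p] by linarith
    next
      \<comment> \<open>Both outer legs have length \<open>wlen g\<close>, and the points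
        \<open>g\<close> and \<open>?e\<close> where they are attached are at distance at least
        \<open>wlen x\<close>. Since this is at least \<open>3 * wlen g\<close>, the legs stay
        \<open>wlen g\<close> apart.\<close>
      assume pf: "p \<in> f ` {..n}"
      then have "wdist g p \<le> wlen g"
        using geodesic_between[OF f(1) pf, unfolded f(2,3) end1] wdist_nonneg[of p \<one>] by linarith
      moreover have "wlen x \<le> wdist g ?e"
        using split_pair_dist(1)[OF sp g oneA x oneB y(1)] g K by simp
      moreover have "wdist g ?e \<le> wdist g p + wdist p q + wdist q ?e"
        using wdist_triangle[of g p ?e] wdist_triangle[of p q ?e] g qK hK by simp
      ultimately show ?thesis
        using qe c long(3) wdist_nonneg[of q ?h] wdist_nonneg[of q p] by linarith
    qed
  qed simp_all
  then have "qconn 625 5 \<one> ?h ((P \<union> f ` {..n}) \<union> f' ` {..n'})" by simp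
  from M[OF this subgroup.one_closed[OF H] h] P(2) show ?thesis by blast
qed


lemma mult_inv_cancel:
  assumes "x \<in> carrier K" "y \<in> carrier K"
  shows "x \<otimes> (inv x \<otimes> y) = y" "inv x \<otimes> (x \<otimes> y) = y"
  using assms by (simp_all flip: m_assoc)

definition prod_set where "prod_set A B = {x \<otimes> y | x y. x \<in> A \<and> y \<in> B}"

lemma split_pair_subgroup:
  assumes sp: "split_pair A B rA rB"
  shows "subgroup (prod_set A B) K"
proof -
  note D = split_pairD[OF sp]
  have oneA: "\<one> \<in> A" and oneB: "\<one> \<in> B" using D(1,2) by (auto intro: subgroup.one_closed)
  have AK: "\<And>x. x \<in> A \<Longrightarrow> x \<in> carrier K" and BK: "\<And>x. x \<in> B \<Longrightarrow> x \<in> carrier K"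
    using D by auto
  show ?thesis
  proof (rule subgroupI)
    show "prod_set A B \<subseteq> carrier K" using AK BK by (auto simp: prod_set_def)
    show "prod_set A B \<noteq> {}" using oneA oneB by (auto simp: prod_set_def)
  next
    fix a assume "a \<in> prod_set A B"
    then obtain x y where a: "x \<in> A" "y \<in> B" "a = x \<otimes> y" by (auto simp: prod_set_def)
    have i: "inv x \<in> A" "inv y \<in> B" using a D(1,2) by (auto intro: subgroup.m_inv_closed)
    have "inv a = inv x \<otimes> inv y"
      using a AK BK D(5)[OF i] by (simp add: inv_mult_group)
    then show "inv a \<in> prod_set A B" using i by (auto simp: prod_set_def)
  next
    fix a b assume "a \<in> prod_set A B" "b \<in> prod_set A B"
    then obtain x y x' y' where a: "x \<in> A" "y \<in> B" "a = x \<otimes> y" "x' \<in> A" "y' \<in> B" "b = x' \<otimes> y'"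
      by (auto simp: prod_set_def)
    have "a \<otimes> b = x \<otimes> (y \<otimes> x') \<otimes> y'" using a AK BK by (simp add: m_assoc)
    also have "y \<otimes> x' = x' \<otimes> y" using D(5) a by blast
    also have "x \<otimes> (x' \<otimes> y) \<otimes> y' = (x \<otimes> x') \<otimes> (y \<otimes> y')" using a AK BK by (simp add: m_assoc)
    finally show "a \<otimes> b \<in> prod_set A B"
      using a subgroup.m_closed[OF D(1)] subgroup.m_closed[OF D(2)] unfolding prod_set_def by blast
  qed
qed

lemma prod_set_swap:
  assumes "split_pair A B rA rB" shows "prod_set A B = prod_set B A"
  using split_pairD(5)[OF assms] unfolding prod_set_def by (auto; metis)

text \<open>An infinite \<open>C\<close> supplies \<open>A\<close>-coordinates as long as
  \<open>absorb_factor\<close> requires, so every \<open>g \<otimes> z\<close> with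
  \<open>z \<in> B\<close> is within \<open>M\<close> of \<open>H\<close>. Then
  \<open>absorb_coset\<close>, with the factors exchanged, spreads this to the whole coset; hence
  the second radius \<open>M'\<close>.\<close>

lemma coset_absorbed_minimal:
  assumes sp: "split_pair A B rA rB" and inf: "infinite A" "infinite B" and H: "subgroup H K"
    and M: "0 \<le> M" "\<And>x y P. qconn 625 5 x y P \<Longrightarrow> x \<in> H \<Longrightarrow> y \<in> H \<Longrightarrow> P \<subseteq> nbhd K S M H"
      "\<And>x y P. qconn 25 (3 + 2 * (M + 1)) x y P \<Longrightarrow> x \<in> H \<Longrightarrow> y \<in> H \<Longrightarrow> P \<subseteq> nbhd K S M' H"
    and g: "g \<in> carrier K" and short: "\<And>a. a \<in> prod_set A B \<Longrightarrow> wlen g \<le> wlen (g \<otimes> a)"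
    and C: "infinite C" "\<And>a. a \<in> C \<Longrightarrow> \<exists>x\<in>A. \<exists>y\<in>B. a = x \<otimes> y \<and> wlen y \<le> wlen x \<and> g \<otimes> a \<otimes> inv g \<in> H"
    and a: "a \<in> prod_set A B"
  shows "g \<otimes> a \<in> nbhd K S M' H"
proof -
  note D = split_pairD[OF sp]
  have AK: "\<And>x. x \<in> A \<Longrightarrow> x \<in> carrier K" and BK: "\<And>x. x \<in> B \<Longrightarrow> x \<in> carrier K"
    using D by auto
  have gB: "g \<otimes> z \<in> nbhd K S M H" if z: "z \<in> B" for z
  proof -
    have "C \<subseteq> carrier K" using C(2) AK BK by fastforce
    \<comment> \<open>At least half of the length of \<open>b\<close> belongs to its
      \<open>A\<close>-coordinate, the longer one; hence the factor 2.\<close>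
    then obtain b where b: "b \<in> C" "wlen b > 2 * (wlen z + 3 * wlen g)"
      using infinite_unbounded[OF C(1)] by blast
    obtain x y where xy: "x \<in> A" "y \<in> B" "b = x \<otimes> y" "wlen y \<le> wlen x" "g \<otimes> b \<otimes> inv g \<in> H"
      using C(2)[OF b(1)] by blast
    have K: "x \<in> carrier K" "y \<in> carrier K" using xy AK BK by auto
    have "wlen b \<le> 2 * wlen x" using wlen_mult[OF K] xy by simp
    then have long: "wlen z \<le> wlen x" "3 * wlen g \<le> wlen x" using b(2) by simp_all
    have h: "g \<otimes> x \<otimes> y \<otimes> inv g \<in> H" using xy(3,5) K g by (simp add: m_assoc)
    have short': "wlen g \<le> wlen (g \<otimes> u \<otimes> v)" if "u \<in> A" "v \<in> B" for u v
      using short[of "u \<otimes> v"] that AK BK g by (force simp: prod_set_def m_assoc)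
    show ?thesis
      by (rule absorb_factor[OF sp H _ g short' xy(1,2) z h xy(4) long]) (erule (2) M(2))
  qed
  obtain x y where xy: "x \<in> A" "y \<in> B" "a = y \<otimes> x"
    using a D(5) unfolding prod_set_def by force
  have "g \<otimes> y \<otimes> x \<in> nbhd K S M' H"
    by (rule absorb_coset[OF split_pair_swap[OF sp] subgroup.subset[OF H] inf(2) M(1,3) g gB xy(2,1)])
  then show ?thesis using xy AK BK g by (simp add: m_assoc)
qed

text \<open>Replacing \<open>g\<close> by a shortest element of its coset merely conjugates the
  infinite set by an element of the product. The radii \<open>M\<close> and \<open>M'\<close> do not
  depend on \<open>g\<close>.\<close>

lemma coset_absorbed:
  assumes sp: "split_pair A B rA rB" and inf: "infinite A" "infinite B" and H: "subgroup H K"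
    and M: "0 \<le> M" "\<And>x y P. qconn 625 5 x y P \<Longrightarrow> x \<in> H \<Longrightarrow> y \<in> H \<Longrightarrow> P \<subseteq> nbhd K S M H"
      "\<And>x y P. qconn 25 (3 + 2 * (M + 1)) x y P \<Longrightarrow> x \<in> H \<Longrightarrow> y \<in> H \<Longrightarrow> P \<subseteq> nbhd K S M' H"
    and g: "g \<in> carrier K"
    and C: "infinite {a \<in> prod_set A B. g \<otimes> a \<otimes> inv g \<in> H}"
    and a: "a \<in> prod_set A B"
  shows "g \<otimes> a \<in> nbhd K S M' H"
proof -
  let ?U = "prod_set A B"
  note D = split_pairD[OF sp]
  have U: "subgroup ?U K" by (rule split_pair_subgroup[OF sp])
  have UK: "\<And>x. x \<in> ?U \<Longrightarrow> x \<in> carrier K" using subgroup.subset[OF U] by blast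
  obtain a0 where a0: "a0 \<in> ?U" "\<And>a. a \<in> ?U \<Longrightarrow> wlen (g \<otimes> a0) \<le> wlen (g \<otimes> a)"
    using ex_has_least_nat[of "\<lambda>a. a \<in> ?U" a "\<lambda>a. wlen (g \<otimes> a)"] a by blast
  let ?g = "g \<otimes> a0"
  have K: "a0 \<in> carrier K" "?g \<in> carrier K" using a0 UK g by auto
  have short: "wlen ?g \<le> wlen (?g \<otimes> u)" if "u \<in> ?U" for u
    using a0(2)[of "a0 \<otimes> u"] subgroup.m_closed[OF U a0(1) that] that UK g K by (simp add: m_assoc)
  define E where "E = {b \<in> ?U. ?g \<otimes> b \<otimes> inv ?g \<in> H}"
  have "infinite E"
  proof -
    let ?c = "\<lambda>a. inv a0 \<otimes> a \<otimes> a0"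
    have "inj_on ?c {a \<in> ?U. g \<otimes> a \<otimes> inv g \<in> H}"
      using UK K by (intro inj_onI) auto
    moreover have "?c ` {a \<in> ?U. g \<otimes> a \<otimes> inv g \<in> H} \<subseteq> E"
    proof (clarsimp simp: E_def)
      fix u assume u: "u \<in> ?U" "g \<otimes> u \<otimes> inv g \<in> H"
      then have uK: "u \<in> carrier K" using UK by blast
      have "?g \<otimes> ?c u \<otimes> inv ?g = g \<otimes> u \<otimes> inv g"
      proof -
        have "?g \<otimes> ?c u = g \<otimes> u \<otimes> a0"
          using uK K(1) g by (simp add: m_assoc mult_inv_cancel)
        moreover have "inv ?g = inv a0 \<otimes> inv g" using K(1) g by (rule inv_mult_group[rotated])
        ultimately show ?thesis using uK K(1) g by (simp add: m_assoc mult_inv_cancel)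
      qed
      moreover have "?c u \<in> ?U"
        by (rule subgroup.m_closed[OF U subgroup.m_closed[OF U subgroup.m_inv_closed[OF U a0(1)] u(1)] a0(1)])
      ultimately show "?c u \<in> ?U \<and> ?g \<otimes> ?c u \<otimes> inv ?g \<in> H" using u by simp
    qed
    ultimately show ?thesis using C finite_imageD finite_subset by blast
  qed
  \<comment> \<open>Infinitely many elements have the same longer coordinate; if it is the one in
    \<open>B\<close>, the factors exchange roles.\<close>
  define E1 where "E1 = {b \<in> E. \<exists>x\<in>A. \<exists>y\<in>B. b = x \<otimes> y \<and> wlen y \<le> wlen x}"
  define E2 where "E2 = {b \<in> E. \<exists>x\<in>A. \<exists>y\<in>B. b = x \<otimes> y \<and> wlen x \<le> wlen y}"
  have "E \<subseteq> E1 \<union> E2"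
  proof
    fix b assume b: "b \<in> E"
    then obtain x y where "x \<in> A" "y \<in> B" "b = x \<otimes> y" by (auto simp: E_def prod_set_def)
    then show "b \<in> E1 \<union> E2" using b linear[of "wlen x" "wlen y"] unfolding E1_def E2_def by blast
  qed
  then have "infinite E1 \<or> infinite E2"
    using \<open>infinite E\<close> finite_subset by blast
  then have main: "?g \<otimes> u \<in> nbhd K S M' H" if u: "u \<in> ?U" for u
  proof
    assume E1: "infinite E1"
    have E1': "\<exists>x\<in>A. \<exists>y\<in>B. b = x \<otimes> y \<and> wlen y \<le> wlen x \<and> ?g \<otimes> b \<otimes> inv ?g \<in> H" if "b \<in> E1" for b
      using that unfolding E1_def E_def by blast
    show ?thesis
      by (rule coset_absorbed_minimal[OF sp inf H M K(2) short E1 E1' u])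
  next
    assume E2: "infinite E2"
    have E2': "\<exists>x\<in>B. \<exists>y\<in>A. b = x \<otimes> y \<and> wlen y \<le> wlen x \<and> ?g \<otimes> b \<otimes> inv ?g \<in> H" if "b \<in> E2" for b
    proof -
      obtain x y where "x \<in> A" "y \<in> B" "b = x \<otimes> y" "wlen x \<le> wlen y" "?g \<otimes> b \<otimes> inv ?g \<in> H"
        using \<open>b \<in> E2\<close> unfolding E2_def E_def by blast
      then show ?thesis using D(5)[of x y] by (intro bexI[of _ y] bexI[of _ x]) auto
    qed
    have sw: "?U = prod_set B A" by (rule prod_set_swap[OF sp])
    show ?thesis
      by (rule coset_absorbed_minimal[OF split_pair_swap[OF sp] inf(2,1) H M K(2) short[unfolded sw] E2 E2' u[unfolded sw]])
  qed
  have "g \<otimes> a = ?g \<otimes> (inv a0 \<otimes> a)"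
    using K g a UK by (simp add: m_assoc mult_inv_cancel)
  then show ?thesis
    using main[of "inv a0 \<otimes> a"] a a0 subgroup.m_closed[OF U] subgroup.m_inv_closed[OF U] by simp
qed

text \<open>A subgroup of finite index is coarsely dense, so the far corner of the square can be
  moved into \<open>H\<close> by at most \<open>R\<close>, at the same cost for both ways
  around.\<close>

lemma not_fellow_wrt:
  assumes sp: "split_pair A B rA rB" and inf: "infinite A" "infinite B" and H: "subgroup H K"
    and fin: "\<not> infinite_index K H"
  shows "\<not> fellow_wrt H"
proof
  assume fel: "fellow_wrt H"
  note D = split_pairD[OF sp]
  note sp' = split_pair_swap[OF sp]
  have oneA: "\<one> \<in> A" and oneB: "\<one> \<in> B" using D(1,2) by (auto intro: subgroup.one_closed)
  obtain R where R: "\<And>g. g \<in> carrier K \<Longrightarrow> \<exists>h\<in>H. wdist g h \<le> R"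
    using fin infinite_index_iff[OF H] by (auto simp: not_less)
  have R0: "R \<ge> 0" using R[OF one_closed] by (meson order_trans wdist_nonneg)
  have "(5::real) \<ge> 1" "2 + R + 1 \<ge> 0" using R0 by auto
  then obtain M where M: "M \<ge> 0" "\<And>x y P Q. qconn 5 (2 + R + 1) x y P \<Longrightarrow> qconn 5 (2 + R + 1) x y Q \<Longrightarrow>
      x \<in> H \<Longrightarrow> y \<in> H \<Longrightarrow> P \<subseteq> nbhd K S M Q"
    using fel[unfolded fellow_wrt_def, rule_format, of 5 "2 + R + 1"] by metis
  \<comment> \<open>\<open>M\<close> is the fellow travelling bound; \<open>R\<close> covers the
    case that the point found near \<open>x\<close> is the displaced end \<open>h\<close> instead of
    a point of the square.\<close>
  let ?n = "nat \<lceil>M + R\<rceil>"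
  obtain x where x: "x \<in> A" "wlen x > ?n" using infinite_unbounded[OF inf(1) D(3)] by blast
  obtain y where y: "y \<in> B" "wlen y > ?n" using infinite_unbounded[OF inf(2) D(4)] by blast
  have K: "x \<in> carrier K" "y \<in> carrier K" using x y D by auto
  have path: "\<exists>P. qconn 5 2 \<one> (x \<otimes> y) P \<and> x \<in> P \<and> (\<forall>p\<in>P. p \<in> A \<or> (\<exists>v\<in>B. p = x \<otimes> v))"
    if sp: "split_pair A B rA rB" and xy: "x \<in> A" "y \<in> B" for A B rA rB x y
  proof -
    note D = split_pairD[OF sp]
    have one: "\<one> \<in> A" "\<one> \<in> B" using D(1,2) by (auto intro: subgroup.one_closed)
    have AK: "\<And>x. x \<in> A \<Longrightarrow> x \<in> carrier K" and BK: "\<And>x. x \<in> B \<Longrightarrow> x \<in> carrier K"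
      using D by auto
    obtain f n where f: "geodesic f n" "f 0 = \<one>" "f n = x" "\<And>i. i \<le> n \<Longrightarrow> f i \<in> A"
      using split_pair_geodesic[OF sp one_closed one(1) xy(1)] xy AK by fastforce
    obtain f' n' where f': "geodesic f' n'" "f' 0 = x" "f' n' = x \<otimes> y" "\<And>i. i \<le> n' \<Longrightarrow> \<exists>v\<in>B. f' i = x \<otimes> v"
      using split_pair_geodesic[OF split_pair_swap[OF sp] AK[OF xy(1)] one(2) xy(2)] xy AK by auto
    have "qconn (5 * 1) (1 + 1) \<one> (x \<otimes> y) (f ` {..n} \<union> f' ` {..n'})"
    proof (rule qconn_append[OF geodesic_qconn[OF f(1), unfolded f(2,3)] _ _ f'(1-3)])
      fix q p assume "q \<in> f' ` {..n'}" "p \<in> f ` {..n}"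
      then obtain v where v: "v \<in> B" "q = x \<otimes> v" "p \<in> A" using f' f by blast
      have "wlen (inv v \<otimes> \<one>) \<le> wdist (\<one> \<otimes> x \<otimes> v) (\<one> \<otimes> p \<otimes> \<one>)"
        using split_pair_dist(2)[OF sp one_closed xy(1) v(3,1) one(2)] .
      moreover have "wdist q x = wlen v"
        using wdist_mult[of x v] wdist_commute[of q x] v xy AK BK by simp
      ultimately show "wdist q x \<le> 2 * wdist q p"
        using v xy AK BK by simp
    qed simp_all
    then show ?thesis
      using f f' by (intro exI[of _ "f ` {..n} \<union> f' ` {..n'}"]) force
  qed
  obtain P where P: "qconn 5 2 \<one> (x \<otimes> y) P" "x \<in> P"
    using path[OF sp x(1) y(1)] by blast
  obtain Q where Q: "qconn 5 2 \<one> (x \<otimes> y) Q" "\<And>q. q \<in> Q \<Longrightarrow> q \<in> B \<or> (\<exists>v\<in>A. q = y \<otimes> v)"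
    using path[OF sp' y(1) x(1)] D(5)[OF x(1) y(1)] by auto
  obtain h where h: "h \<in> H" "wdist (x \<otimes> y) h \<le> R" using R[of "x \<otimes> y"] K by auto
  have hK: "h \<in> carrier K" using h H subgroup.subset by blast
  have "insert h P \<subseteq> nbhd K S M (insert h Q)"
    using qconn_extend[OF P(1) _ _ hK h(2)] qconn_extend[OF Q(1) _ _ hK h(2)] h(1)
    by (intro M(2)[of \<one> h]) (simp_all add: subgroup.one_closed[OF H])
  then obtain q where q: "q \<in> insert h Q" "wdist x q \<le> M" using P(2) by (auto simp: nbhd_def)
  have big: "wlen x > M + R" "wlen y > M + R" using x(2) y(2) by linarith+
  have far: "wlen x \<le> wdist x q" if "q \<in> B" for q
    using split_pair_dist(1)[OF sp one_closed x(1) oneA oneB that] K that D(4) by auto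
  have far': "wlen y \<le> wdist x (y \<otimes> v)" if "v \<in> A" for v
  proof -
    have "v \<in> carrier K" using that D(3) by auto
    then show ?thesis
      using split_pair_dist(2)[OF sp one_closed x(1) that oneB y(1)] K D(5)[OF that y(1)] by auto
  qed
  have "wlen y \<le> wdist x h + R"
    using wdist_mult[OF K] wdist_triangle[of x h "x \<otimes> y"] wdist_commute[of h "x \<otimes> y"] h K hK by simp
  then show False
    using q far far' Q(2)[of q] big R0 by force
qed

end

section \<open>Groups with the structure of a graph product\<close>

text \<open>All that is used of a graph product except the gates. Those are read off with the help
  of \<open>star\<close>, so they can only be added once this locale has been interpreted. The map
  \<open>ret U\<close> stands for deleting all letters outside \<open>U\<close>.\<close>

locale graph_group_base = word_metric K S for K :: "('a, 'm) monoid_scheme" (structure) and S +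
  fixes V :: "'v set" and adj :: "'v \<Rightarrow> 'v \<Rightarrow> bool" and vert :: "'v \<Rightarrow> 'a set"
    and ret :: "'v set \<Rightarrow> 'a \<Rightarrow> 'a"
  assumes V: "finite V" "V \<noteq> {}" and adj_V: "adj u v \<Longrightarrow> u \<in> V \<and> v \<in> V"
    and adj_sym: "adj u v \<Longrightarrow> adj v u" and adj_irrefl: "\<not> adj v v"
    and adj_connected: "u \<in> V \<Longrightarrow> v \<in> V \<Longrightarrow> adj\<^sup>*\<^sup>* u v" and neighbour: "v \<in> V \<Longrightarrow> \<exists>u. adj u v"
    and vert_subgroup: "v \<in> V \<Longrightarrow> subgroup (vert v) K" and vert_infinite: "v \<in> V \<Longrightarrow> infinite (vert v)"
    and vert_commute: "adj u v \<Longrightarrow> x \<in> vert u \<Longrightarrow> y \<in> vert v \<Longrightarrow> x \<otimes> y = y \<otimes> x"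
    and S_vert: "S \<subseteq> (\<Union>v\<in>V. vert v)"
    and ret_hom: "ret U \<in> hom K K"
    and ret_vert: "v \<in> V \<Longrightarrow> x \<in> vert v \<Longrightarrow> ret U x = (if v \<in> U then x else \<one>)"
begin

definition link where "link v = generate K (\<Union>u\<in>{u. adj u v}. vert u)"

abbreviation star where "star v \<equiv> prod_set (vert v) (link v)"

lemma vert_carrier: "v \<in> V \<Longrightarrow> x \<in> vert v \<Longrightarrow> x \<in> carrier K"
  using vert_subgroup subgroup.subset by blast

lemma letter_vert: "s \<in> letters \<Longrightarrow> \<exists>v\<in>V. s \<in> vert v"
  using S_vert subgroup.m_inv_closed[OF vert_subgroup] unfolding letters_def by blast

lemma ret_one: "ret U \<one> = \<one>"
proof -
  obtain v where "v \<in> V" using V by blast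
  then show ?thesis
    using ret_vert[of v \<one> U] subgroup.one_closed[OF vert_subgroup] by simp
qed

lemma ret_mult: "x \<in> carrier K \<Longrightarrow> y \<in> carrier K \<Longrightarrow> ret U (x \<otimes> y) = ret U x \<otimes> ret U y"
  using ret_hom by (auto simp: hom_def)

lemma ret_closed: "x \<in> carrier K \<Longrightarrow> ret U x \<in> carrier K"
  using ret_hom by (auto simp: hom_def)

lemma ret_letter: "s \<in> letters \<Longrightarrow> ret U s = s \<or> ret U s = \<one>"
  using letter_vert ret_vert by metis

text \<open>The generators are taken from the vertex groups, so each letter of a shortest word is
  either kept or deleted.\<close>

lemma wlen_ret: "x \<in> carrier K \<Longrightarrow> wlen (ret U x) \<le> wlen x"
proof (induction "wlen x" arbitrary: x)
  case 0
  then show ?case using wlen_eq_0_iff[of x] ret_one by simp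
next
  case (Suc n)
  obtain y s where ys: "y \<in> carrier K" "s \<in> letters" "x = y \<otimes> s" "wlen y = n"
    using wlen_Suc[OF Suc.prems Suc.hyps(2)[symmetric]] by blast
  have "wlen (ret U x) \<le> wlen (ret U y) + wlen (ret U s)"
    using ys wlen_mult[OF ret_closed ret_closed] by (simp add: ret_mult)
  moreover have "wlen (ret U s) \<le> 1" using ret_letter[OF ys(2), of U] wlen_letter[OF ys(2)] by auto
  ultimately show ?case using Suc.hyps(1)[of y] Suc.hyps(2) ys by simp
qed

lemma link_subgroup: "v \<in> V \<Longrightarrow> subgroup (link v) K"
  unfolding link_def using adj_V vert_carrier by (intro generate_is_subgroup) blast

lemma vert_link: "adj u v \<Longrightarrow> vert u \<subseteq> link v"
  unfolding link_def by (auto intro: generate.incl)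

lemma link_carrier: "v \<in> V \<Longrightarrow> y \<in> link v \<Longrightarrow> y \<in> carrier K"
  using link_subgroup subgroup.subset by blast

lemma link_infinite: "v \<in> V \<Longrightarrow> infinite (link v)"
  using neighbour vert_link vert_infinite adj_V finite_subset by metis

text \<open>No vertex is its own neighbour, so keeping only the letters at \<open>v\<close> kills
  the link, and keeping only those at the neighbours of \<open>v\<close> kills the vertex
  group.\<close>

lemma vert_split:
  assumes v: "v \<in> V"
  shows "split_pair (vert v) (link v) (ret {v}) (ret {u. adj u v})"
proof -
  have inv_eq: "ret U (inv x) = inv (ret U x)" if "x \<in> carrier K" for U x
    using group_hom.hom_inv[of K K "ret U" x] ret_hom that is_group
    by (simp add: group_hom_def group_hom_axioms_def)
  have comm: "x \<otimes> y = y \<otimes> x" if x: "x \<in> vert v" and "y \<in> link v" for x y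
    using that(2) unfolding link_def
  proof (induction rule: generate.induct)
    case one
    then show ?case using x v vert_carrier by simp
  next
    case (incl h)
    then obtain u where "adj u v" "h \<in> vert u" by blast
    then show ?case using x vert_commute[OF adj_sym] by blast
  next
    case (inv h)
    then obtain u where u: "adj u v" "h \<in> vert u" by blast
    then have "inv h \<in> vert u" using adj_V subgroup.m_inv_closed[OF vert_subgroup] by blast
    then show ?case using x vert_commute[OF adj_sym[OF u(1)]] by blast
  next
    case (eng h1 h2)
    have K: "x \<in> carrier K" "h1 \<in> carrier K" "h2 \<in> carrier K"
      using x v vert_carrier eng(1,2) link_carrier[OF v] by (auto simp: link_def)
    have "x \<otimes> (h1 \<otimes> h2) = h1 \<otimes> x \<otimes> h2" using K eng by (simp flip: m_assoc)
    also have "\<dots> = h1 \<otimes> h2 \<otimes> x" using K eng by (simp add: m_assoc)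
    finally show ?case .
  qed
  have ret_link: "ret {v} y = \<one> \<and> ret {u. adj u v} y = y" if "y \<in> link v" for y
    using that unfolding link_def
  proof (induction rule: generate.induct)
    case (incl h)
    then obtain u where "adj u v" "h \<in> vert u" by blast
    then show ?case using ret_vert[of u h] adj_V adj_irrefl by auto
  next
    case (inv h)
    then obtain u where u: "adj u v" "h \<in> vert u" by blast
    then have "h \<in> carrier K" using adj_V vert_carrier by blast
    then show ?case using inv_eq[of h] ret_vert[of u h] adj_V adj_irrefl u by auto
  next
    case (eng h1 h2)
    have K: "h1 \<in> carrier K" "h2 \<in> carrier K"
      using eng(1,2) link_carrier[OF v] by (auto simp: link_def)
    then show ?case using eng by (simp add: ret_mult)
  qed (simp add: ret_one)
  have ret_vert_in: "ret {v} g \<in> vert v \<and> ret {u. adj u v} g \<in> link v" if "g \<in> carrier K" for g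
    using that
  proof (induction rule: letters_induct)
    case one
    then show ?case
      using ret_one subgroup.one_closed[OF vert_subgroup[OF v]] subgroup.one_closed[OF link_subgroup[OF v]] by simp
  next
    case (mult g s)
    obtain u where u: "u \<in> V" "s \<in> vert u" using letter_vert mult by blast
    have "ret {v} s \<in> vert v"
      using ret_vert[OF u] u subgroup.one_closed[OF vert_subgroup[OF v]] by auto
    moreover have "ret {u. adj u v} s \<in> link v"
      using ret_vert[OF u] u vert_link[of u v] subgroup.one_closed[OF link_subgroup[OF v]] by auto
    ultimately show ?case
      using mult subgroup.m_closed[OF vert_subgroup[OF v]] subgroup.m_closed[OF link_subgroup[OF v]]
      by (simp add: ret_mult)
  qed
  show ?thesis
    unfolding split_pair_def
    using vert_subgroup[OF v] link_subgroup[OF v] comm ret_link ret_vert_in wlen_ret ret_hom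
      ret_vert[OF v] adj_irrefl by auto
qed

lemma star_subgroup: "v \<in> V \<Longrightarrow> subgroup (star v) K"
  using split_pair_subgroup[OF vert_split] .

lemma star_carrier: "v \<in> V \<Longrightarrow> x \<in> star v \<Longrightarrow> x \<in> carrier K"
  using star_subgroup subgroup.subset by blast

lemma vert_star: "v \<in> V \<Longrightarrow> vert v \<subseteq> star v" and link_star: "v \<in> V \<Longrightarrow> link v \<subseteq> star v"
proof -
  assume v: "v \<in> V"
  note one = subgroup.one_closed[OF vert_subgroup[OF v]] subgroup.one_closed[OF link_subgroup[OF v]]
  show "vert v \<subseteq> star v"
  proof
    fix x assume "x \<in> vert v"
    then show "x \<in> star v" unfolding prod_set_def using one vert_carrier[OF v, of x] by force
  qed
  show "link v \<subseteq> star v"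
  proof
    fix x assume "x \<in> link v"
    then show "x \<in> star v" unfolding prod_set_def using one link_carrier[OF v, of x] by force
  qed
qed

text \<open>The consistency of the gates rests on this: letters at \<open>v\<close> or at its
  neighbours belong to the star, so they do not decide whether a prefix lies in it.\<close>

lemma star_mult_iff:
  assumes v: "v \<in> V" and g: "g \<in> carrier K" and u: "u = v \<or> adj u v" "s \<in> vert u"
  shows "g \<otimes> s \<in> star v \<longleftrightarrow> g \<in> star v"
proof -
  have s: "s \<in> star v" using u vert_star[OF v] link_star[OF v] vert_link by blast
  have sK: "s \<in> carrier K" using star_carrier[OF v s] .
  have "g = g \<otimes> s \<otimes> inv s" using g sK by (simp add: m_assoc)
  then show ?thesis
    using s subgroup.m_closed[OF star_subgroup[OF v]] subgroup.m_inv_closed[OF star_subgroup[OF v]] by metis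
qed

end

text \<open>\<open>proj v g\<close> is the gate (nearest point) of \<open>g\<close> in \<open>vert v\<close>: multiplication by a letter
  moves it only from inside the star, which is how a path crosses a hyperplane dual to \<open>vert v\<close>.\<close>

locale graph_group = graph_group_base +
  fixes proj :: "'c \<Rightarrow> 'a \<Rightarrow> 'a"
  assumes proj_one: "v \<in> V \<Longrightarrow> proj v \<one> = \<one>"
    and proj_mult: "v \<in> V \<Longrightarrow> u \<in> V \<Longrightarrow> g \<in> carrier K \<Longrightarrow> s \<in> vert u \<Longrightarrow>
      proj v (g \<otimes> s) = (if u = v \<and> g \<in> star v then proj v g \<otimes> s else proj v g)"
begin

section \<open>Gates in vertex groups and crossings of hyperplanes\<close>

lemma proj_closed:
  assumes v: "v \<in> V" and g: "g \<in> carrier K"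
  shows "proj v g \<in> vert v"
  using g
proof (induction rule: letters_induct)
  case one
  then show ?case using proj_one[OF v] subgroup.one_closed[OF vert_subgroup[OF v]] by simp
next
  case (mult g s)
  obtain u where u: "u \<in> V" "s \<in> vert u" using letter_vert mult by blast
  then show ?case
    using proj_mult[OF v u(1) mult(1) u(2)] mult subgroup.m_closed[OF vert_subgroup[OF v]] by auto
qed

text \<open>Left multiplication by an element of the star does not change which prefixes lie in the
  star, so the same letters are collected, now starting from \<open>a\<close>.\<close>

lemma proj_left:
  assumes v: "v \<in> V" and a: "a \<in> vert v" and g: "g \<in> carrier K"
  shows "proj v (a \<otimes> g) = a \<otimes> proj v g"
  using g
proof (induction rule: letters_induct)
  case one
  have "proj v (\<one> \<otimes> a) = \<one> \<otimes> a"
    using proj_mult[OF v v one_closed a] proj_one[OF v] subgroup.one_closed[OF star_subgroup[OF v]] by simp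
  then show ?case using a v vert_carrier proj_one by simp
next
  case (mult g s)
  obtain u where u: "u \<in> V" "s \<in> vert u" using letter_vert mult by blast
  have K: "a \<in> carrier K" "s \<in> carrier K" "proj v g \<in> carrier K"
    using a u v vert_carrier proj_closed[OF v mult(1)] by auto
  have as: "a \<in> star v" using a vert_star[OF v] by blast
  have "g = inv a \<otimes> (a \<otimes> g)" using K mult by (simp add: mult_inv_cancel)
  then have "a \<otimes> g \<in> star v \<longleftrightarrow> g \<in> star v"
    using as subgroup.m_closed[OF star_subgroup[OF v]] subgroup.m_inv_closed[OF star_subgroup[OF v]] by metis
  moreover have "a \<otimes> (g \<otimes> s) = (a \<otimes> g) \<otimes> s" using K mult by (simp add: m_assoc)
  ultimately show ?case
    using proj_mult[OF v u(1) _ u(2), of "a \<otimes> g"] proj_mult[OF v u(1) mult(1) u(2)] mult K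
    by (simp add: m_assoc)
qed

lemma proj_link:
  assumes v: "v \<in> V" and y: "y \<in> link v" and g: "g \<in> carrier K"
  shows "proj v (g \<otimes> y) = proj v g"
  using y g unfolding link_def
proof (induction arbitrary: g rule: generate.induct)
  case (incl h)
  then obtain u where u: "adj u v" "h \<in> vert u" by blast
  then show ?case using proj_mult[OF v _ incl(2) u(2)] adj_V adj_irrefl by auto
next
  case (inv h)
  then obtain u where u: "adj u v" "h \<in> vert u" by blast
  then have "inv h \<in> vert u" using adj_V subgroup.m_inv_closed[OF vert_subgroup] by blast
  moreover have "u \<in> V" "u \<noteq> v" using u adj_V adj_irrefl by auto
  ultimately show ?case using proj_mult[OF v _ inv(2)] by simp
next
  case (eng h1 h2)
  have K: "h1 \<in> carrier K" "h2 \<in> carrier K"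
    using eng(1,2) link_carrier[OF v] by (auto simp: link_def)
  then show ?case using eng(3)[of g] eng(4)[of "g \<otimes> h1"] eng(5) by (simp add: m_assoc)
qed simp

text \<open>Induction along a shortest word for \<open>g\<close>. When a letter is collected, the
  prefix is \<open>x \<otimes> l\<close> with \<open>l\<close> in the link, and the letter commutes
  past \<open>l\<close> to extend the gate \<open>x\<close>. Any other letter extends only the
  remainder. So the gate lies on a geodesic from the unit to \<open>g\<close>.\<close>

lemma proj_gate:
  assumes v: "v \<in> V" and g: "g \<in> carrier K"
  shows "wlen (proj v g) + wlen (inv (proj v g) \<otimes> g) \<le> wlen g"
  using g
proof (induction "wlen g" arbitrary: g)
  case 0
  then show ?case using wlen_eq_0_iff[of g] proj_one[OF v] by simp
next
  case (Suc n)
  obtain y s where ys: "y \<in> carrier K" "s \<in> letters" "g = y \<otimes> s" "wlen y = n"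
    using wlen_Suc[OF Suc.prems Suc.hyps(2)[symmetric]] by blast
  obtain u where u: "u \<in> V" "s \<in> vert u" using letter_vert ys by blast
  let ?a = "proj v y"
  have K: "?a \<in> carrier K" "s \<in> carrier K"
    using proj_closed[OF v ys(1)] vert_carrier v u by auto
  have IH: "wlen ?a + wlen (inv ?a \<otimes> y) \<le> n" using Suc.hyps(1)[of y] ys by simp
  show ?case
  proof (cases "u = v \<and> y \<in> star v")
    case True
    obtain x l where xl: "x \<in> vert v" "l \<in> link v" "y = x \<otimes> l" using True by (auto simp: prod_set_def)
    have xlK: "x \<in> carrier K" "l \<in> carrier K" using xl vert_carrier[OF v] link_carrier[OF v] by auto
    have "proj v x = x" using proj_left[OF v xl(1) one_closed] proj_one[OF v] xlK by simp
    then have a: "?a = x" using proj_link[OF v xl(2), of x] xl xlK by simp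
    have pg: "proj v g = x \<otimes> s" using proj_mult[OF v u(1) ys(1) u(2)] True ys a by simp
    have sl: "s \<otimes> l = l \<otimes> s"
      using split_pairD(5)[OF vert_split[OF v], of s l] True u xl by simp
    have "g = x \<otimes> s \<otimes> l" using ys xl xlK K sl by (simp add: m_assoc)
    then have "inv (proj v g) \<otimes> g = l" using pg xlK K by (simp add: m_assoc mult_inv_cancel inv_mult_group)
    moreover have "inv ?a \<otimes> y = l" using a xl xlK by (simp add: mult_inv_cancel)
    moreover have "wlen (x \<otimes> s) \<le> wlen x + 1"
      using wlen_mult[of x s] wlen_letter[OF ys(2)] xlK K by simp
    ultimately show ?thesis using IH pg a Suc.hyps(2) by simp
  next
    case False
    have pg: "proj v g = ?a" using proj_mult[OF v u(1) ys(1) u(2)] False ys by auto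
    have "inv ?a \<otimes> g = (inv ?a \<otimes> y) \<otimes> s" using ys K by (simp add: m_assoc)
    then have "wlen (inv ?a \<otimes> g) \<le> wlen (inv ?a \<otimes> y) + 1"
      using wlen_mult[of "inv ?a \<otimes> y" s] wlen_letter[OF ys(2)] ys K by simp
    then show ?thesis using IH pg Suc.hyps(2) by simp
  qed
qed

text \<open>A common gate \<open>a\<close> would be a shortcut: going from \<open>inv y\<close> to
  \<open>t \<otimes> z\<close> through \<open>a\<close> saves \<open>2 * wlen a\<close>, so
  \<open>a\<close> is the unit. Then the gate of \<open>z\<close> is \<open>inv t\<close>, so some
  geodesic to \<open>z\<close> starts with \<open>inv t\<close>, which cancels against
  \<open>t\<close>.\<close>

lemma proj_separates:
  assumes v: "v \<in> V" and y: "y \<in> carrier K" and t: "t \<in> vert v" "wlen t \<le> 1" and z: "z \<in> carrier K"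
    and geo: "wlen (y \<otimes> t \<otimes> z) = wlen y + 1 + wlen z"
  shows "proj v (inv y) \<noteq> proj v (t \<otimes> z)"
proof
  assume eq: "proj v (inv y) = proj v (t \<otimes> z)"
  let ?a = "proj v (t \<otimes> z)"
  have K: "t \<in> carrier K" "?a \<in> carrier K" "proj v z \<in> carrier K"
    using t v vert_carrier proj_closed[OF v] z by auto
  have g1: "wlen ?a + wlen (inv ?a \<otimes> inv y) \<le> wlen y"
    using proj_gate[OF v inv_closed[OF y]] eq y by simp
  have g2: "wlen ?a + wlen (inv ?a \<otimes> (t \<otimes> z)) \<le> wlen (t \<otimes> z)"
    using proj_gate[OF v, of "t \<otimes> z"] K z by simp
  have "y \<otimes> t \<otimes> z = (y \<otimes> ?a) \<otimes> (inv ?a \<otimes> (t \<otimes> z))"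
    using K y z by (simp add: m_assoc mult_inv_cancel)
  then have "wlen (y \<otimes> t \<otimes> z) \<le> wlen (y \<otimes> ?a) + wlen (inv ?a \<otimes> (t \<otimes> z))"
    using wlen_mult[of "y \<otimes> ?a" "inv ?a \<otimes> (t \<otimes> z)"] K y z by simp
  moreover have "wlen (inv ?a \<otimes> inv y) = wlen (y \<otimes> ?a)"
    using wlen_inv[of "y \<otimes> ?a"] K y by (simp add: inv_mult_group)
  moreover have tz: "wlen (t \<otimes> z) \<le> 1 + wlen z" using wlen_mult[of t z] K z t by simp
  ultimately have "wlen ?a = 0" using g1 g2 geo by simp
  then have "?a = \<one>" using wlen_eq_0_iff K by simp
  then have "t \<otimes> proj v z = \<one>" using proj_left[OF v t(1) z] by simp
  then have "proj v z = inv t" using K by (metis inv_equality inv_inv)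
  then have "wlen (t \<otimes> z) \<le> wlen z" using proj_gate[OF v z] K by simp
  moreover have "wlen (y \<otimes> t \<otimes> z) \<le> wlen y + wlen (t \<otimes> z)"
    using wlen_mult[of y "t \<otimes> z"] K y z by (simp add: m_assoc)
  ultimately show False using geo by simp
qed

text \<open>Seen from \<open>f i\<close>, the ends of the geodesic have different gates in the
  vertex group of the edge label \<open>?t\<close>. By \<open>qconn_crossing\<close> some edge near
  \<open>Q\<close> changes the gate, and only edges starting in the coset of the star can do
  that.\<close>

lemma qconn_meets_star:
  assumes f: "geodesic f n" "i < n" and q: "qconn l c (f 0) (f n) Q" "1 \<le> l" "0 \<le> c"
  shows "\<exists>v\<in>V. \<exists>q\<in>Q. \<exists>g\<in>carrier K. inv (f i) \<otimes> g \<in> star v \<and> wdist q g \<le> l + c"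
proof -
  have fK: "\<And>j. j \<le> n \<Longrightarrow> f j \<in> carrier K" and fd: "\<And>j k. j \<le> n \<Longrightarrow> k \<le> n \<Longrightarrow> wdist (f j) (f k) = \<bar>real j - real k\<bar>"
    using f(1) by (auto simp: geodesic_def)
  have K: "f 0 \<in> carrier K" "f i \<in> carrier K" "f (Suc i) \<in> carrier K" "f n \<in> carrier K" using fK f(2) by auto
  let ?y = "inv (f 0) \<otimes> f i" and ?t = "inv (f i) \<otimes> f (Suc i)" and ?z = "inv (f (Suc i)) \<otimes> f n"
  have len: "wlen ?y = i" "wlen ?t = Suc 0" "wlen ?z = n - Suc i" "wlen (inv (f 0) \<otimes> f n) = n"
    using fd[of 0 i] fd[of i "Suc i"] fd[of "Suc i" n] fd[of 0 n] f(2) unfolding word_dist_def by auto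
  have yK: "?y \<in> carrier K" "?t \<in> carrier K" "?z \<in> carrier K" using K by auto
  have tz: "?t \<otimes> ?z = inv (f i) \<otimes> f n" using inv_mult_cancel3 K by simp
  have ytz: "?y \<otimes> ?t \<otimes> ?z = inv (f 0) \<otimes> f n" using inv_mult_cancel3 K by simp
  obtain y' s where s: "y' \<in> carrier K" "s \<in> letters" "?t = y' \<otimes> s" "wlen y' = 0"
    using wlen_Suc[OF yK(2) len(2)] by blast
  then have "?t \<in> letters" using wlen_eq_0_iff[of y'] by simp
  then obtain v where v: "v \<in> V" "?t \<in> vert v" using letter_vert by blast
  define \<phi> where "\<phi> g = proj v (inv (f i) \<otimes> g)" for g
  have "proj v (inv ?y) \<noteq> proj v (?t \<otimes> ?z)"
    using proj_separates[OF v(1) yK(1) v(2) _ yK(3)] len ytz f(2) by simp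
  then have "\<phi> (f 0) \<noteq> \<phi> (f n)"
    using K unfolding \<phi>_def tz by (simp add: inv_mult_group)
  from qconn_crossing[OF q(1,2,3) this] obtain p g s where g: "p \<in> Q" "g \<in> carrier K" "s \<in> letters"
    "\<phi> g \<noteq> \<phi> (g \<otimes> s)" "wdist p g \<le> l + c" by blast
  obtain u where u: "u \<in> V" "s \<in> vert u" using letter_vert[OF g(3)] by blast
  have "inv (f i) \<otimes> (g \<otimes> s) = (inv (f i) \<otimes> g) \<otimes> s" using K g by (simp add: m_assoc)
  then have "inv (f i) \<otimes> g \<in> star v"
    using proj_mult[OF v(1) u(1) _ u(2), of "inv (f i) \<otimes> g"] g K unfolding \<phi>_def by (auto split: if_splits)
  then show ?thesis using v g by blast
qed

text \<open>Pigeonhole: the errors \<open>b c\<close> lie in a finite ball, so infinitely many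
  \<open>c\<close> share one error, which cancels in
  \<open>h c \<otimes> inv (h c0)\<close>.\<close>

lemma infinite_of_near:
  assumes H: "subgroup H K" and v: "v \<in> V" and g: "g \<in> carrier K" and C: "infinite C" "C \<subseteq> star v"
    and near: "\<And>c. c \<in> C \<Longrightarrow> g \<otimes> c \<in> nbhd K S r H"
  shows "infinite {a \<in> star v. g \<otimes> a \<otimes> inv g \<in> H}"
proof -
  have HK: "H \<subseteq> carrier K" using H by (rule subgroup.subset)
  have CK: "\<And>c. c \<in> C \<Longrightarrow> c \<in> carrier K" using C star_carrier[OF v] by blast
  have "\<forall>c\<in>C. \<exists>h\<in>H. wdist (g \<otimes> c) h \<le> r" using near by (auto simp: nbhd_def)
  then obtain h where h: "\<And>c. c \<in> C \<Longrightarrow> h c \<in> H \<and> wdist (g \<otimes> c) (h c) \<le> r" by metis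
  define b where "b c = inv (g \<otimes> c) \<otimes> h c" for c
  have hK: "\<And>c. c \<in> C \<Longrightarrow> h c \<in> carrier K" using h HK by blast
  have "b ` C \<subseteq> {x \<in> carrier K. wlen x \<le> nat \<lfloor>r\<rfloor>}"
  proof
    fix x assume "x \<in> b ` C"
    then obtain c where c: "c \<in> C" "x = b c" by blast
    have "real (wlen x) \<le> r" using h[OF c(1)] c by (simp add: b_def word_dist_def)
    then show "x \<in> {x \<in> carrier K. wlen x \<le> nat \<lfloor>r\<rfloor>}"
      using c CK hK g by (simp add: b_def le_nat_floor)
  qed
  then have "finite (b ` C)" using finite_ball finite_subset by blast
  then obtain c0 where c0: "c0 \<in> C" "infinite {c \<in> C. b c = b c0}"
    using pigeonhole_infinite[OF C(1)] by blast
  let ?C = "{c \<in> C. b c = b c0}"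
  have "(\<lambda>c. c \<otimes> inv c0) ` ?C \<subseteq> {a \<in> star v. g \<otimes> a \<otimes> inv g \<in> H}"
  proof clarify
    fix c assume c: "c \<in> C" "b c = b c0"
    have K: "c \<in> carrier K" "c0 \<in> carrier K" "h c \<in> carrier K" "h c0 \<in> carrier K" "b c0 \<in> carrier K"
      using c c0 CK hK g by (auto simp: b_def)
    have "c \<in> star v" "c0 \<in> star v" using c c0 C by auto
    then have 1: "c \<otimes> inv c0 \<in> star v"
      using subgroup.m_closed[OF star_subgroup[OF v]] subgroup.m_inv_closed[OF star_subgroup[OF v]] by simp
    have "h c = g \<otimes> c \<otimes> b c" "h c0 = g \<otimes> c0 \<otimes> b c0"
      using K g by (simp_all add: b_def mult_inv_cancel)
    then have e: "h c = g \<otimes> c \<otimes> b c0" "h c0 = g \<otimes> c0 \<otimes> b c0" using c(2) by simp_all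
    have "h c \<otimes> inv (h c0) = g \<otimes> (c \<otimes> inv c0) \<otimes> inv g"
      unfolding e using K g by (simp add: inv_mult_group m_assoc mult_inv_cancel)
    moreover have "h c \<otimes> inv (h c0) \<in> H"
      using h c(1) c0(1) subgroup.m_closed[OF H] subgroup.m_inv_closed[OF H] by simp
    ultimately show "c \<otimes> inv c0 \<in> star v \<and> g \<otimes> (c \<otimes> inv c0) \<otimes> inv g \<in> H" using 1 by simp
  qed
  moreover have "inj_on (\<lambda>c. c \<otimes> inv c0) ?C"
    using CK c0 by (intro inj_onI) simp
  ultimately show ?thesis using c0(2) finite_imageD finite_subset by blast
qed

section \<open>Morse subgroups of infinite index and cosets of stars\<close>

lemma morse_finite_stars:
  assumes H: "subgroup H K" and mo: "morse_wrt H" and ii: "infinite_index K H"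
    and v: "v \<in> V" and g: "g \<in> carrier K"
  shows "finite {a \<in> star v. g \<otimes> a \<otimes> inv g \<in> H}"
proof (rule ccontr)
  assume inf: "infinite {a \<in> star v. g \<otimes> a \<otimes> inv g \<in> H}"
  define P where "P g v \<longleftrightarrow> infinite {a \<in> star v. g \<otimes> a \<otimes> inv g \<in> H}" for g v
  obtain M where M: "M \<ge> 0" "\<And>x y P. qconn 625 5 x y P \<Longrightarrow> x \<in> H \<Longrightarrow> y \<in> H \<Longrightarrow> P \<subseteq> nbhd K S M H"
    using mo[unfolded morse_wrt_def, rule_format, of 625 5] by auto
  obtain M' where M': "\<And>x y P. qconn 25 (3 + 2 * (M + 1)) x y P \<Longrightarrow> x \<in> H \<Longrightarrow> y \<in> H \<Longrightarrow> P \<subseteq> nbhd K S M' H"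
    using mo[unfolded morse_wrt_def, rule_format, of 25 "3 + 2 * (M + 1)"] M(1) by (metis add_nonneg_nonneg mult_nonneg_nonneg one_le_numeral zero_le_numeral zero_le_one)
  have absorbed: "g \<otimes> a \<in> nbhd K S M' H" if "P g v" "v \<in> V" "g \<in> carrier K" "a \<in> star v" for g v a
    by (rule coset_absorbed[OF vert_split[OF that(2)] vert_infinite[OF that(2)] link_infinite[OF that(2)] H M M'
          that(3) that(1)[unfolded P_def] that(4)])
  \<comment> \<open>The vertex group of \<open>u\<close> is an infinite part of both stars.
    Absorbing the coset of the star of \<open>v\<close> makes it close to \<open>H\<close>, which
    starts the argument afresh at \<open>u\<close>, with the same radius \<open>M'\<close>.\<close>
  have adj: "P g u" if "P g v" "adj v u" "g \<in> carrier K" for g u v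
  proof -
    have uv: "u \<in> V" "v \<in> V" "adj u v" using that adj_V adj_sym by auto
    show ?thesis
      unfolding P_def
    proof (rule infinite_of_near[OF H uv(1) that(3) vert_infinite[OF uv(1)] vert_star[OF uv(1)]])
      fix c assume "c \<in> vert u"
      then have "c \<in> star v" using vert_link[OF uv(3)] link_star[OF uv(2)] by blast
      then show "g \<otimes> c \<in> nbhd K S M' H" using absorbed[OF that(1) uv(2) that(3)] by blast
    qed
  qed
  have conn: "P g w" if "P g v" "adj\<^sup>*\<^sup>* v w" "g \<in> carrier K" for g v w
    using that(2,1,3) by (induction rule: rtranclp_induct) (use adj in auto)
  \<comment> \<open>For \<open>s \<in> vert u\<close> the cosets of the star of \<open>u\<close>
    through \<open>g \<otimes> x\<close> and \<open>g \<otimes> x \<otimes> s\<close> coincide; this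
    passes a letter, and \<open>conn\<close> then reaches the other vertices.\<close>
  have all: "P (g \<otimes> x) w" if "x \<in> carrier K" "w \<in> V" for x w
    using that
  proof (induction arbitrary: w rule: letters_induct)
    case one
    then show ?case using conn[OF inf[folded P_def] adj_connected[OF v] g] g by simp
  next
    case (mult x s)
    obtain u where u: "u \<in> V" "s \<in> vert u" using letter_vert mult by blast
    have sK: "s \<in> carrier K" "s \<in> star u" using u vert_carrier vert_star by auto
    let ?g = "g \<otimes> x \<otimes> s"
    have "P ?g u"
      unfolding P_def
    proof (rule infinite_of_near[OF H u(1) _ _ subset_refl])
      show "?g \<in> carrier K" using g mult sK by simp
      show "infinite (star u)" using vert_infinite[OF u(1)] vert_star[OF u(1)] finite_subset by blast
      fix c assume c: "c \<in> star u"
      then have "s \<otimes> c \<in> star u" using sK subgroup.m_closed[OF star_subgroup[OF u(1)]] by blast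
      then have "(g \<otimes> x) \<otimes> (s \<otimes> c) \<in> nbhd K S M' H"
        using absorbed[OF mult.IH[OF u(1)] u(1)] g mult by simp
      then show "?g \<otimes> c \<in> nbhd K S M' H"
        using g mult sK star_carrier[OF u(1) c] by (simp add: m_assoc)
    qed
    then have "P ?g w" using conn adj_connected[OF u(1) mult.prems] g mult(1) sK by simp
    then show ?case using g mult(1) sK by (simp add: m_assoc)
  qed
  have "x \<in> nbhd K S M' H" if x: "x \<in> carrier K" for x
  proof -
    have "P x v" using all[of "inv g \<otimes> x" v] x g v by (simp add: mult_inv_cancel)
    from absorbed[OF this v x subgroup.one_closed[OF star_subgroup[OF v]]] show ?thesis using x by simp
  qed
  then have "\<forall>x\<in>carrier K. \<exists>h\<in>H. wdist x h \<le> M'" by (auto simp: nbhd_def)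
  then show False using ii infinite_index_iff[OF H] by (meson not_le)
qed

text \<open>Up to left multiplication by \<open>H\<close> the data are finite in number: the vertex
  and the errors \<open>b\<close>, \<open>b'\<close> of \<open>x\<close> and \<open>y\<close>. For
  fixed data \<open>inv x \<otimes> y\<close> lies in \<open>C v b b'\<close>, which a right
  translation embeds into a set that is finite by \<open>morse_finite_stars\<close>. The maximum
  over the data is a uniform bound.\<close>

lemma morse_bounded_stars:
  assumes H: "subgroup H K" and mo: "morse_wrt H" and ii: "infinite_index K H"
  shows "\<exists>D\<ge>0. \<forall>v\<in>V. \<forall>x\<in>nbhd K S r H. \<forall>y\<in>nbhd K S r H. inv x \<otimes> y \<in> star v \<longrightarrow> wdist x y \<le> D"
proof -
  have HK: "H \<subseteq> carrier K" using H by (rule subgroup.subset)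
  define B where "B = {x \<in> carrier K. wlen x \<le> nat \<lfloor>r\<rfloor>}"
  define C where "C v b b' = {a \<in> star v. b \<otimes> a \<otimes> inv b' \<in> H}" for v b b'
  have fin: "finite (C v b b')" if v: "v \<in> V" and b: "b \<in> carrier K" "b' \<in> carrier K" for v b b'
  proof (cases "C v b b' = {}")
    case False
    then obtain a0 where a0: "a0 \<in> star v" "b \<otimes> a0 \<otimes> inv b' \<in> H" by (auto simp: C_def)
    have a0K: "a0 \<in> carrier K" using star_carrier[OF v a0(1)] .
    have "(\<lambda>a. a \<otimes> inv a0) ` C v b b' \<subseteq> {a \<in> star v. b \<otimes> a \<otimes> inv b \<in> H}"
    proof (clarsimp simp: C_def)
      fix a assume a: "a \<in> star v" "b \<otimes> a \<otimes> inv b' \<in> H"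
      have aK: "a \<in> carrier K" using star_carrier[OF v a(1)] .
      have "(b \<otimes> a \<otimes> inv b') \<otimes> inv (b \<otimes> a0 \<otimes> inv b') \<in> H"
        by (rule subgroup.m_closed[OF H a(2) subgroup.m_inv_closed[OF H a0(2)]])
      also have "(b \<otimes> a \<otimes> inv b') \<otimes> inv (b \<otimes> a0 \<otimes> inv b') = b \<otimes> (a \<otimes> inv a0) \<otimes> inv b"
      proof -
        have "inv (b \<otimes> a0 \<otimes> inv b') = b' \<otimes> (inv a0 \<otimes> inv b)"
          using b a0K by (simp add: inv_mult_group)
        then show ?thesis using b a0K aK by (simp add: m_assoc mult_inv_cancel)
      qed
      finally show "a \<otimes> inv a0 \<in> star v \<and> b \<otimes> (a \<otimes> inv a0) \<otimes> inv b \<in> H"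
        using a(1) a0(1) subgroup.m_closed[OF star_subgroup[OF v]] subgroup.m_inv_closed[OF star_subgroup[OF v]]
        by simp
    qed
    moreover have "inj_on (\<lambda>a. a \<otimes> inv a0) (C v b b')"
    proof (rule inj_onI)
      fix x y assume xy: "x \<in> C v b b'" "y \<in> C v b b'" "x \<otimes> inv a0 = y \<otimes> inv a0"
      then have "x \<in> star v" "y \<in> star v" by (simp_all add: C_def)
      then have "x \<in> carrier K" "y \<in> carrier K" by (simp_all add: star_carrier[OF v])
      then show "x = y" using xy(3) a0K by simp
    qed
    ultimately show ?thesis
      using morse_finite_stars[OF H mo ii v b(1)] inj_on_finite by blast
  qed simp
  have "finite B" unfolding B_def by (rule finite_ball)
  then have finW: "finite (\<Union>v\<in>V. \<Union>b\<in>B. \<Union>b'\<in>B. wlen ` C v b b')"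
    using V fin by (intro finite_UN_I finite_imageI) (auto simp: B_def)
  define D where "D = Max (insert 0 (\<Union>v\<in>V. \<Union>b\<in>B. \<Union>b'\<in>B. wlen ` C v b b'))"
  have "wdist x y \<le> D" if v: "v \<in> V" and x: "x \<in> nbhd K S r H" and y: "y \<in> nbhd K S r H"
    and s: "inv x \<otimes> y \<in> star v" for v x y
  proof -
    obtain h k where hk: "h \<in> H" "wdist x h \<le> r" "k \<in> H" "wdist y k \<le> r" and K: "x \<in> carrier K" "y \<in> carrier K"
      using x y by (auto simp: nbhd_def)
    have hkK: "h \<in> carrier K" "k \<in> carrier K" using hk HK by auto
    have b: "inv h \<otimes> x \<in> B" "inv k \<otimes> y \<in> B"
      using hk wdist_commute[of x h] wdist_commute[of y k] K hkK
      by (auto simp: B_def word_dist_def le_nat_floor)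
    have "(inv h \<otimes> x) \<otimes> (inv x \<otimes> y) \<otimes> inv (inv k \<otimes> y) = inv h \<otimes> k"
      using K hkK by (simp add: inv_mult_group m_assoc mult_inv_cancel)
    also have "inv h \<otimes> k \<in> H"
      using hk subgroup.m_closed[OF H] subgroup.m_inv_closed[OF H] by simp
    finally have "inv x \<otimes> y \<in> C v (inv h \<otimes> x) (inv k \<otimes> y)" using s by (simp add: C_def)
    then have "wlen (inv x \<otimes> y) \<in> (\<Union>v\<in>V. \<Union>b\<in>B. \<Union>b'\<in>B. wlen ` C v b b')" using v b by blast
    then have "wlen (inv x \<otimes> y) \<le> D" unfolding D_def using finW by (intro Max_ge) auto
    then show ?thesis by (simp add: word_dist_def)
  qed
  then show ?thesis by (intro exI[of _ "real D"]) auto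
qed

lemma morse_imp_fellow_wrt:
  assumes H: "subgroup H K" and mo: "morse_wrt H" and ii: "infinite_index K H"
  shows "fellow_wrt H"
  unfolding fellow_wrt_def
proof (intro allI impI)
  fix l c :: real assume lc: "l \<ge> 1" "c \<ge> 0"
  have HK: "H \<subseteq> carrier K" using H by (rule subgroup.subset)
  obtain M where M: "M \<ge> 0" "\<And>x y P. qconn 1 1 x y P \<Longrightarrow> x \<in> H \<Longrightarrow> y \<in> H \<Longrightarrow> P \<subseteq> nbhd K S M H"
    using mo[unfolded morse_wrt_def, rule_format, of 1 1] by auto
  obtain M' where M': "M' \<ge> 0" "\<And>x y P. qconn l c x y P \<Longrightarrow> x \<in> H \<Longrightarrow> y \<in> H \<Longrightarrow> P \<subseteq> nbhd K S M' H"
    using mo[unfolded morse_wrt_def, rule_format, of l c] lc by metis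
  \<comment> \<open>The point \<open>f i\<close> is within \<open>M\<close> of \<open>H\<close>; the
    crossing point \<open>g\<close> is within \<open>l + c\<close> of a point of the quasi-geodesic,
    which is within \<open>M'\<close> of \<open>H\<close>. One radius serves both.\<close>
  define r where "r = M + M' + l + c"
  obtain D where D: "D \<ge> 0" "\<And>v x y. v \<in> V \<Longrightarrow> x \<in> nbhd K S r H \<Longrightarrow> y \<in> nbhd K S r H \<Longrightarrow>
      inv x \<otimes> y \<in> star v \<Longrightarrow> wdist x y \<le> D"
    using morse_bounded_stars[OF H mo ii, of r] by blast
  define D1 where "D1 = D + l + c"
  define D2 where "D2 = D1 + l * (l * (2 * D1 + 1 + c)) + c"
  have D1: "D1 \<ge> 0" using D lc by (simp add: D1_def)
  have D2: "D2 \<ge> 0" using D1 lc unfolding D2_def by (intro add_nonneg_nonneg mult_nonneg_nonneg) auto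
  have near: "\<exists>q\<in>Q. wdist (f i) q \<le> D1"
    if f: "geodesic f n" "f 0 = x" "f n = y" and xy: "x \<in> H" "y \<in> H" and Q: "qconn l c x y Q" and i: "i \<le> n"
    for f n x y Q i
  proof (cases "i = n")
    \<comment> \<open>The last point starts no edge, but it is an end of \<open>Q\<close>.\<close>
    case True
    then show ?thesis using qconn_subset[OF Q] f D1 by (intro bexI[of _ y]) auto
  next
    case False
    then have "i < n" using i by simp
    then obtain v q g where g: "v \<in> V" "q \<in> Q" "g \<in> carrier K" "inv (f i) \<otimes> g \<in> star v" "wdist q g \<le> l + c"
      using qconn_meets_star[OF f(1) _ _ lc, of i Q] f Q by auto
    have K: "f i \<in> carrier K" "q \<in> carrier K" using f(1) i qconn_subset[OF Q] g by (auto simp: geodesic_def)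
    have "f i \<in> nbhd K S M H"
      using M(2)[of x y "f ` {..n}"] geodesic_qconn[OF f(1)] f xy i by auto
    then have fi: "f i \<in> nbhd K S r H" using M' lc by (force simp: nbhd_def r_def)
    have "q \<in> nbhd K S M' H" using M'(2)[OF Q xy] g by blast
    then obtain h where h: "h \<in> H" "wdist q h \<le> M'" by (auto simp: nbhd_def)
    have "wdist g h \<le> wdist g q + wdist q h" using wdist_triangle g h K HK by blast
    then have "wdist g h \<le> r" using h g(5) wdist_commute[of g q] g(3) K M(1) by (simp add: r_def)
    then have "g \<in> nbhd K S r H" using h g by (auto simp: nbhd_def)
    then have "wdist (f i) g \<le> D" using D(2) g fi by blast
    then have "wdist (f i) q \<le> D1"
      using wdist_triangle[of "f i" g q] g wdist_commute[of g q] K by (simp add: D1_def)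
    then show ?thesis using g by blast
  qed
  \<comment> \<open>A geodesic with the same ends mediates: \<open>geodesic_near_qconn\<close> leads
    from \<open>P\<close> to it at cost \<open>D2\<close>, and \<open>near\<close> from it to
    \<open>Q\<close> at cost \<open>D1\<close>.\<close>
  have "P \<subseteq> nbhd K S (D1 + D2) Q"
    if P: "qconn l c x y P" and Q: "qconn l c x y Q" and xy: "x \<in> H" "y \<in> H" for x y P Q
  proof
    fix p assume p: "p \<in> P"
    obtain f n where f: "geodesic f n" "f 0 = x" "f n = y"
      using geodesic_exists[of x y] xy HK by blast
    obtain i where i: "i \<le> n" "wdist p (f i) \<le> D2"
      using geodesic_near_qconn[OF P lc D1 f near[OF f xy P] p] by (auto simp: D2_def)
    obtain q where q: "q \<in> Q" "wdist (f i) q \<le> D1" using near[OF f xy Q i(1)] by blast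
    have K: "p \<in> carrier K" "q \<in> carrier K" "f i \<in> carrier K"
      using qconn_subset[OF P] qconn_subset[OF Q] p q f(1) i by (auto simp: geodesic_def)
    have "wdist p q \<le> D1 + D2" using wdist_triangle[of p "f i" q] K q i by simp
    then show "p \<in> nbhd K S (D1 + D2) Q" using K q by (auto simp: nbhd_def)
  qed
  then show "\<exists>M\<ge>0. \<forall>x y P Q. qconn l c x y P \<and> qconn l c x y Q \<and> x \<in> H \<and> y \<in> H \<longrightarrow> P \<subseteq> nbhd K S M Q"
    using D1 D2 by (intro exI[of _ "D1 + D2"] conjI allI impI) (simp, blast)
qed

theorem stable_iff_morse:
  assumes H: "subgroup H K"
  shows "stable_subgroup K H \<longleftrightarrow> infinite_index K H \<and> morse_subgroup K H"
proof -
  have HK: "H \<subseteq> carrier K" using H by (rule subgroup.subset)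
  note st = stable_subgroup_iff[OF word_metric_axioms HK]
  note mo = morse_subgroup_iff[OF word_metric_axioms HK]
  show ?thesis
  proof
    assume s: "stable_subgroup K H"
    then have fel: "fellow_wrt H" using st by simp
    obtain v where v: "v \<in> V" using V by blast
    have "infinite_index K H"
      using not_fellow_wrt[OF vert_split[OF v] vert_infinite[OF v] link_infinite[OF v] H] fel by blast
    moreover have "morse_wrt H"
      using s[unfolded st] fellow_wrt_imp_morse_wrt[OF H fel] by blast
    ultimately show "infinite_index K H \<and> morse_subgroup K H" using mo by simp
  next
    assume m: "infinite_index K H \<and> morse_subgroup K H"
    then have "morse_wrt H" using mo by simp
    then show "stable_subgroup K H"
      unfolding st using morse_imp_fellow_wrt[OF H] morse_wrt_undistorted[OF H] m gen by blast
  qed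
qed

end

section \<open>Graph products\<close>

locale group_family = graph \<Gamma> for \<Gamma> :: "('v, 'e) pre_digraph" +
  fixes \<G> :: "'v \<Rightarrow> ('g, 'm) monoid_scheme"
  assumes vertex_group: "v \<in> verts \<Gamma> \<Longrightarrow> Group.group (\<G> v)"
begin

abbreviation words where "words \<equiv> free_words (verts \<Gamma>) \<G>"
abbreviation cls where "cls \<equiv> free_class (verts \<Gamma>) \<G>"
abbreviation FP where "FP \<equiv> free_product (verts \<Gamma>) \<G>"
abbreviation N where "N \<equiv> normal_closure FP (graph_commutators \<Gamma> \<G>)"
abbreviation GP where "GP \<equiv> graph_product \<Gamma> \<G>"

definition ev where "ev w = N #>\<^bsub>FP\<^esub> cls w"

text \<open>The congruence of the presentation of the graph product on words. It replaces the
  quotient by a normal closure, which has no induction principle, by an induction over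
  relations.\<close>

inductive word_eq where
  free: "free_eq (verts \<Gamma>) \<G> x y \<Longrightarrow> word_eq x y"
| comm: "u \<rightarrow>\<^bsub>\<Gamma>\<^esub> v \<Longrightarrow> g \<in> carrier (\<G> u) \<Longrightarrow> h \<in> carrier (\<G> v) \<Longrightarrow> word_eq [(u, g), (v, h)] [(v, h), (u, g)]"
| sym: "word_eq x y \<Longrightarrow> word_eq y x"
| trans: "word_eq x y \<Longrightarrow> word_eq y z \<Longrightarrow> word_eq x z"
| append: "word_eq x y \<Longrightarrow> word_eq x' y' \<Longrightarrow> word_eq (x @ x') (y @ y')"

lemma words_simps [simp]:
  "[] \<in> words" "x @ y \<in> words \<longleftrightarrow> x \<in> words \<and> y \<in> words"
  "(v, g) # x \<in> words \<longleftrightarrow> v \<in> verts \<Gamma> \<and> g \<in> carrier (\<G> v) \<and> x \<in> words"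
  by (auto simp: free_words_def)

lemma word_eq_words: "word_eq x y \<Longrightarrow> x \<in> words \<and> y \<in> words"
proof (induction rule: word_eq.induct)
  case (free x y)
  then show ?case using free_eq_words vertex_group by blast
next
  case (comm u v g h)
  then show ?case using adj_in_verts by simp
qed auto

lemma word_eq_refl: "x \<in> words \<Longrightarrow> word_eq x x"
  by (intro word_eq.free free_eq.refl)

lemma FP_group: "Group.group FP"
  using vertex_group by (rule group_free_product)

lemma N_normal: "N \<lhd> FP"
  using FP_group graph_commutators_subset[OF wf_digraph_axioms] vertex_group by (intro normal_closure_normal) blast+

lemma GP_group: "Group.group GP"
  using wf_digraph_axioms vertex_group by (rule group_graph_product)

lemma FP_carrier: "carrier FP = cls ` words" and FP_one: "\<one>\<^bsub>FP\<^esub> = cls []"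
  by (simp_all add: free_product_def)

lemma cls_closed: "x \<in> words \<Longrightarrow> cls x \<in> carrier FP"
  by (simp add: FP_carrier)

lemma cls_mult: "x \<in> words \<Longrightarrow> y \<in> words \<Longrightarrow> cls x \<otimes>\<^bsub>FP\<^esub> cls y = cls (x @ y)"
  by (rule free_product_mult)

lemma cls_inv:
  assumes "x \<in> words" "y \<in> words" "free_eq (verts \<Gamma>) \<G> (y @ x) []"
  shows "inv\<^bsub>FP\<^esub> cls x = cls y"
proof -
  interpret FP: Group.group FP by (rule FP_group)
  have "cls y \<otimes>\<^bsub>FP\<^esub> cls x = \<one>\<^bsub>FP\<^esub>"
    using assms by (simp add: cls_mult FP_one free_class_eq_iff)
  then show ?thesis using assms cls_closed by (intro FP.inv_equality)
qed

lemma word_inverse: "x \<in> words \<Longrightarrow> \<exists>y\<in>words. free_eq (verts \<Gamma>) \<G> (y @ x) [] \<and> inv\<^bsub>FP\<^esub> cls x = cls y"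
  using free_word_inverse[of "verts \<Gamma>" \<G> x] vertex_group cls_inv by blast

lemma free_eq_cancel:
  assumes "v \<in> verts \<Gamma>" "g \<in> carrier (\<G> v)"
  shows "free_eq (verts \<Gamma>) \<G> [(v, inv\<^bsub>\<G> v\<^esub> g), (v, g)] []"
    "free_eq (verts \<Gamma>) \<G> [(v, g), (v, inv\<^bsub>\<G> v\<^esub> g)] []"
proof -
  interpret G: Group.group "\<G> v" using vertex_group assms by blast
  show "free_eq (verts \<Gamma>) \<G> [(v, inv\<^bsub>\<G> v\<^esub> g), (v, g)] []"
    using free_eq.mult[of v "verts \<Gamma>" "inv\<^bsub>\<G> v\<^esub> g" \<G> g] free_eq.unit[of v "verts \<Gamma>" \<G>] assms
    by (auto intro: free_eq.trans)
  show "free_eq (verts \<Gamma>) \<G> [(v, g), (v, inv\<^bsub>\<G> v\<^esub> g)] []"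
    using free_eq.mult[of v "verts \<Gamma>" g \<G> "inv\<^bsub>\<G> v\<^esub> g"] free_eq.unit[of v "verts \<Gamma>" \<G>] assms
    by (auto intro: free_eq.trans)
qed

lemma commutator_cls:
  assumes "u \<in> verts \<Gamma>" "v \<in> verts \<Gamma>" "g \<in> carrier (\<G> u)" "h \<in> carrier (\<G> v)"
  shows "commutator FP (free_incl (verts \<Gamma>) \<G> u g) (free_incl (verts \<Gamma>) \<G> v h)
    = cls [(u, g), (v, h), (u, inv\<^bsub>\<G> u\<^esub> g), (v, inv\<^bsub>\<G> v\<^esub> h)]"
proof -
  have i: "inv\<^bsub>\<G> u\<^esub> g \<in> carrier (\<G> u)" "inv\<^bsub>\<G> v\<^esub> h \<in> carrier (\<G> v)"
    using assms vertex_group group.inv_closed by metis+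
  have "inv\<^bsub>FP\<^esub> cls [(u, g)] = cls [(u, inv\<^bsub>\<G> u\<^esub> g)]"
    by (rule cls_inv) (use assms i free_eq_cancel in simp_all)
  moreover have "inv\<^bsub>FP\<^esub> cls [(v, h)] = cls [(v, inv\<^bsub>\<G> v\<^esub> h)]"
    by (rule cls_inv) (use assms i free_eq_cancel in simp_all)
  ultimately show ?thesis
    unfolding commutator_def free_incl_def using assms i by (simp add: cls_mult)
qed

text \<open>The classes of words equivalent to the empty word form a normal subgroup that contains
  the commutators, and the normal closure is the least such subgroup.\<close>

lemma N_word_eq: "N \<subseteq> cls ` {x \<in> words. word_eq x []}"
proof -
  interpret FP: Group.group FP by (rule FP_group)
  let ?M = "cls ` {x \<in> words. word_eq x []}"
  have M: "cls x \<in> ?M" if "word_eq x []" for x using that word_eq_words by blast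
  have sub: "subgroup ?M FP"
  proof (rule FP.subgroupI)
    show "?M \<subseteq> carrier FP" by (auto simp: FP_carrier)
    show "?M \<noteq> {}" using M[OF word_eq_refl] by auto
  next
    fix a assume "a \<in> ?M"
    then obtain x where x: "x \<in> words" "word_eq x []" "a = cls x" by blast
    obtain y where y: "y \<in> words" "free_eq (verts \<Gamma>) \<G> (y @ x) []" "inv\<^bsub>FP\<^esub> cls x = cls y"
      using word_inverse x by blast
    have "word_eq (y @ []) (y @ x)"
      using x y by (intro word_eq.append word_eq_refl word_eq.sym[of x])
    then have "word_eq y []" using word_eq.trans word_eq.free[OF y(2)] by simp
    then show "inv\<^bsub>FP\<^esub> a \<in> ?M" using M y x by simp
  next
    fix a b assume "a \<in> ?M" "b \<in> ?M"
    then obtain x y where "x \<in> words" "word_eq x []" "a = cls x" "y \<in> words" "word_eq y []" "b = cls y" by blast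
    then show "a \<otimes>\<^bsub>FP\<^esub> b \<in> ?M" using M word_eq.append[of x "[]" y "[]"] by (simp add: cls_mult)
  qed
  have "?M \<lhd> FP"
    unfolding FP.normal_inv_iff
  proof (intro conjI ballI)
    fix c a assume "c \<in> carrier FP" "a \<in> ?M"
    then obtain z x where z: "z \<in> words" "c = cls z" and x: "x \<in> words" "word_eq x []" "a = cls x"
      by (auto simp: FP_carrier)
    obtain y where y: "y \<in> words" "free_eq (verts \<Gamma>) \<G> (y @ z) []" "inv\<^bsub>FP\<^esub> cls z = cls y"
      using word_inverse z by blast
    have "cls z \<otimes>\<^bsub>FP\<^esub> inv\<^bsub>FP\<^esub> cls z = \<one>\<^bsub>FP\<^esub>" using z cls_closed by simp
    then have zy: "free_eq (verts \<Gamma>) \<G> (z @ y) []" using y z by (simp add: cls_mult FP_one free_class_eq_iff)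
    have "word_eq ((z @ x) @ y) ((z @ []) @ y)"
      using x y z by (intro word_eq.append word_eq_refl)
    then have "word_eq (z @ x @ y) []" using word_eq.trans word_eq.free[OF zy] by simp
    then show "c \<otimes>\<^bsub>FP\<^esub> a \<otimes>\<^bsub>FP\<^esub> inv\<^bsub>FP\<^esub> c \<in> ?M" using M x y z by (simp add: cls_mult)
  qed (rule sub)
  moreover have "graph_commutators \<Gamma> \<G> \<subseteq> ?M"
  proof
    fix c assume "c \<in> graph_commutators \<Gamma> \<G>"
    then obtain u v g h where uv: "u \<rightarrow>\<^bsub>\<Gamma>\<^esub> v" "g \<in> carrier (\<G> u)" "h \<in> carrier (\<G> v)"
      and c: "c = commutator FP (free_incl (verts \<Gamma>) \<G> u g) (free_incl (verts \<Gamma>) \<G> v h)"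
      unfolding graph_commutators_def by blast
    have V: "u \<in> verts \<Gamma>" "v \<in> verts \<Gamma>" using adj_in_verts uv by auto
    let ?g = "inv\<^bsub>\<G> u\<^esub> g" and ?h = "inv\<^bsub>\<G> v\<^esub> h"
    have i: "?g \<in> carrier (\<G> u)" "?h \<in> carrier (\<G> v)"
      using V uv vertex_group group.inv_closed by metis+
    have "word_eq ([(u, g), (v, h)] @ [(u, ?g), (v, ?h)]) ([(v, h), (u, g)] @ [(u, ?g), (v, ?h)])"
      using uv i V by (intro word_eq.append word_eq.comm word_eq_refl) auto
    moreover have "word_eq ([(v, h)] @ [(u, g), (u, ?g)] @ [(v, ?h)]) ([(v, h)] @ [] @ [(v, ?h)])"
      using uv i V free_eq_cancel by (intro word_eq.append word_eq.free[of "[(u, g), (u, ?g)]"] word_eq_refl) auto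
    moreover have "word_eq [(v, h), (v, ?h)] []"
      using uv V free_eq_cancel by (intro word_eq.free) auto
    ultimately have "word_eq [(u, g), (v, h), (u, ?g), (v, ?h)] []"
      using word_eq.trans by (metis append_Cons append_Nil)
    then show "c \<in> ?M" using M c commutator_cls[OF V uv(2,3)] by simp
  qed
  ultimately show ?thesis unfolding normal_closure_def by (intro Inter_lower) simp
qed

section \<open>Words as elements of the graph product\<close>

lemma GP_carrier: "carrier GP = ev ` words"
  unfolding graph_product_def ev_def carrier_FactGroup FP_carrier by (simp add: image_image)

lemma ev_closed: "x \<in> words \<Longrightarrow> ev x \<in> carrier GP"
  by (simp add: GP_carrier)

lemma ev_append: "x \<in> words \<Longrightarrow> y \<in> words \<Longrightarrow> ev (x @ y) = ev x \<otimes>\<^bsub>GP\<^esub> ev y"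
  unfolding graph_product_def ev_def
  using normal.rcos_sum[OF N_normal cls_closed cls_closed] by (simp add: cls_mult)

lemma ev_Nil: "ev [] = \<one>\<^bsub>GP\<^esub>"
proof -
  interpret FP: Group.group FP by (rule FP_group)
  have "N #>\<^bsub>FP\<^esub> \<one>\<^bsub>FP\<^esub> = N"
    using subgroup.subset[OF normal.axioms(1)[OF N_normal]] by (rule FP.coset_mult_one)
  then show ?thesis unfolding ev_def graph_product_def by (simp add: FP_one)
qed

lemma ev_eq_iff:
  assumes "x \<in> words" "y \<in> words"
  shows "ev x = ev y \<longleftrightarrow> cls x \<otimes>\<^bsub>FP\<^esub> inv\<^bsub>FP\<^esub> cls y \<in> N"
proof -
  interpret FP: Group.group FP by (rule FP_group)
  have N: "subgroup N FP" using N_normal by (rule normal.axioms(1))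
  have K: "cls x \<in> carrier FP" "cls y \<in> carrier FP" using assms cls_closed by auto
  show ?thesis
  proof
    assume "ev x = ev y"
    then have "cls x \<in> N #>\<^bsub>FP\<^esub> cls y" using FP.rcos_self[OF K(1) N] by (simp add: ev_def)
    then show "cls x \<otimes>\<^bsub>FP\<^esub> inv\<^bsub>FP\<^esub> cls y \<in> N" using subgroup.rcos_module_imp[OF N FP_group K(2)] by blast
  next
    assume "cls x \<otimes>\<^bsub>FP\<^esub> inv\<^bsub>FP\<^esub> cls y \<in> N"
    then have "cls x \<in> N #>\<^bsub>FP\<^esub> cls y" using subgroup.rcos_module_rev[OF N FP_group K(2,1)] by blast
    then show "ev x = ev y" using FP.repr_independence[OF _ K(2) N] by (simp add: ev_def)
  qed
qed

text \<open>With this direction, a map defined by reading words descends to the graph product as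
  soon as it respects the relations.\<close>

lemma ev_eq_word_eq:
  assumes "x \<in> words" "y \<in> words" "ev x = ev y"
  shows "word_eq x y"
proof -
  obtain z where z: "z \<in> words" "free_eq (verts \<Gamma>) \<G> (z @ y) []" "inv\<^bsub>FP\<^esub> cls y = cls z"
    using word_inverse assms by blast
  have "cls (x @ z) \<in> cls ` {x \<in> words. word_eq x []}"
    using assms z ev_eq_iff N_word_eq by (auto simp: cls_mult)
  then obtain w where w: "w \<in> words" "word_eq w []" "cls (x @ z) = cls w" by blast
  then have "word_eq (x @ z) []"
    using word_eq.trans[OF word_eq.free] free_class_eq_iff by blast
  then have "word_eq ((x @ z) @ y) ([] @ y)" using assms by (intro word_eq.append word_eq_refl)
  moreover have "word_eq (x @ []) (x @ (z @ y))"
    using assms z by (intro word_eq.append word_eq_refl word_eq.sym[of "z @ y"] word_eq.free)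
  ultimately show ?thesis using word_eq.trans by simp
qed

lemma ev_free_eq: "free_eq (verts \<Gamma>) \<G> x y \<Longrightarrow> ev x = ev y"
proof -
  assume xy: "free_eq (verts \<Gamma>) \<G> x y"
  then have "y \<in> words" using free_eq_words[of "verts \<Gamma>" \<G> x y] vertex_group by blast
  then have "cls x = cls y" using free_class_eq_iff xy by blast
  then show ?thesis by (simp add: ev_def)
qed

lemma ev_unit: "v \<in> verts \<Gamma> \<Longrightarrow> ev [(v, \<one>\<^bsub>\<G> v\<^esub>)] = \<one>\<^bsub>GP\<^esub>"
  using ev_free_eq[OF free_eq.unit] ev_Nil by simp

lemma ev_mult:
  assumes "v \<in> verts \<Gamma>" "g \<in> carrier (\<G> v)" "h \<in> carrier (\<G> v)"
  shows "ev [(v, g \<otimes>\<^bsub>\<G> v\<^esub> h)] = ev [(v, g)] \<otimes>\<^bsub>GP\<^esub> ev [(v, h)]"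
  using ev_free_eq[OF free_eq.mult[where \<G> = \<G>, OF assms]] ev_append[of "[(v, g)]" "[(v, h)]"] assms by simp

lemma ev_comm:
  assumes uv: "u \<rightarrow>\<^bsub>\<Gamma>\<^esub> v" "g \<in> carrier (\<G> u)" "h \<in> carrier (\<G> v)"
  shows "ev [(u, g)] \<otimes>\<^bsub>GP\<^esub> ev [(v, h)] = ev [(v, h)] \<otimes>\<^bsub>GP\<^esub> ev [(u, g)]"
proof -
  interpret FP: Group.group FP by (rule FP_group)
  have V: "u \<in> verts \<Gamma>" "v \<in> verts \<Gamma>" using adj_in_verts uv by auto
  let ?a = "cls [(u, g)]" and ?b = "cls [(v, h)]"
  have K: "?a \<in> carrier FP" "?b \<in> carrier FP" using V uv by (auto intro: cls_closed)
  have c: "commutator FP ?a ?b \<in> N"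
  proof -
    have "commutator FP ?a ?b \<in> graph_commutators \<Gamma> \<G>"
      using uv unfolding graph_commutators_def free_incl_def by blast
    then show ?thesis unfolding normal_closure_def by blast
  qed
  have "commutator FP ?a ?b = (?a \<otimes>\<^bsub>FP\<^esub> ?b) \<otimes>\<^bsub>FP\<^esub> inv\<^bsub>FP\<^esub> (?b \<otimes>\<^bsub>FP\<^esub> ?a)"
    unfolding commutator_def using K by (simp add: FP.inv_mult_group FP.m_assoc)
  also have "\<dots> = cls [(u, g), (v, h)] \<otimes>\<^bsub>FP\<^esub> inv\<^bsub>FP\<^esub> cls [(v, h), (u, g)]"
    using V uv by (simp add: cls_mult)
  finally have "ev [(u, g), (v, h)] = ev [(v, h), (u, g)]"
    using c ev_eq_iff V uv by simp
  then show ?thesis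
    using ev_append[of "[(u, g)]" "[(v, h)]"] ev_append[of "[(v, h)]" "[(u, g)]"] V uv by simp
qed

text \<open>The universal property in the form of an automaton: the letters act on states, and an
  action that respects the relations depends only on the element represented. General states admit
  maps that are not homomorphisms, such as the gates.\<close>

lemma foldl_word_eq:
  assumes closed: "\<And>st v g. st \<in> A \<Longrightarrow> v \<in> verts \<Gamma> \<Longrightarrow> g \<in> carrier (\<G> v) \<Longrightarrow> \<delta> st (v, g) \<in> A"
    and unit: "\<And>st v. st \<in> A \<Longrightarrow> v \<in> verts \<Gamma> \<Longrightarrow> \<delta> st (v, \<one>\<^bsub>\<G> v\<^esub>) = st"
    and mult: "\<And>st v g h. st \<in> A \<Longrightarrow> v \<in> verts \<Gamma> \<Longrightarrow> g \<in> carrier (\<G> v) \<Longrightarrow> h \<in> carrier (\<G> v) \<Longrightarrow>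
      \<delta> (\<delta> st (v, g)) (v, h) = \<delta> st (v, g \<otimes>\<^bsub>\<G> v\<^esub> h)"
    and commute: "\<And>st u v g h. st \<in> A \<Longrightarrow> u \<rightarrow>\<^bsub>\<Gamma>\<^esub> v \<Longrightarrow> g \<in> carrier (\<G> u) \<Longrightarrow> h \<in> carrier (\<G> v) \<Longrightarrow>
      \<delta> (\<delta> st (u, g)) (v, h) = \<delta> (\<delta> st (v, h)) (u, g)"
  shows "word_eq x y \<Longrightarrow> st \<in> A \<Longrightarrow> foldl \<delta> st x = foldl \<delta> st y"
proof -
  have cl: "foldl \<delta> st x \<in> A" if "x \<in> words" "st \<in> A" for x st
    using that
  proof (induction x arbitrary: st)
    case (Cons a x)
    obtain v g where "a = (v, g)" by force
    then show ?case using Cons closed by simp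
  qed simp
  have fr: "foldl \<delta> st x = foldl \<delta> st y" if "free_eq (verts \<Gamma>) \<G> x y" "st \<in> A" for x y st
    using that
  proof (induction arbitrary: st rule: free_eq.induct)
    case (append x y x' y')
    then have "y \<in> words" using free_eq_words[of "verts \<Gamma>" \<G> x y] vertex_group by blast
    then show ?case using append cl by simp
  qed (simp_all add: unit mult)
  show "word_eq x y \<Longrightarrow> st \<in> A \<Longrightarrow> foldl \<delta> st x = foldl \<delta> st y"
  proof (induction arbitrary: st rule: word_eq.induct)
    case (free x y)
    then show ?case using fr by blast
  next
    case (comm u v g h)
    then show ?case using commute by simp
  next
    case (append x y x' y')
    then show ?case using word_eq_words cl by simp
  qed simp_all
qed

text \<open>The choice of a representing word is immaterial for the readings to which
  \<open>foldl_word_eq\<close> applies.\<close>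

definition lift where "lift \<delta> st k = foldl \<delta> st (SOME w. w \<in> words \<and> ev w = k)"

lemma lift_ev:
  assumes "\<And>x y. word_eq x y \<Longrightarrow> foldl \<delta> st x = foldl \<delta> st y" "w \<in> words"
  shows "lift \<delta> st (ev w) = foldl \<delta> st w"
proof -
  let ?w = "SOME w'. w' \<in> words \<and> ev w' = ev w"
  have "?w \<in> words \<and> ev ?w = ev w" using assms(2) by (intro someI_ex[of "\<lambda>w'. w' \<in> words \<and> ev w' = ev w"]) blast
  then show ?thesis unfolding lift_def using assms ev_eq_word_eq by blast
qed

definition retract where "retract U = lift (\<lambda>k (v, g). if v \<in> U then k \<otimes>\<^bsub>GP\<^esub> ev [(v, g)] else k) \<one>\<^bsub>GP\<^esub>"

lemma ev_filter_closed: "w \<in> words \<Longrightarrow> filter p w \<in> words"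
  by (auto simp: free_words_def)

lemma retract_ev:
  assumes "w \<in> words"
  shows "retract U (ev w) = ev (filter (\<lambda>(v, g). v \<in> U) w)"
proof -
  interpret GP: Group.group GP by (rule GP_group)
  let ?\<delta> = "\<lambda>k (v, g). if v \<in> U then k \<otimes>\<^bsub>GP\<^esub> ev [(v, g)] else k"
  have K: "ev [(v, g)] \<in> carrier GP" if "v \<in> verts \<Gamma>" "g \<in> carrier (\<G> v)" for v g
    using that by (intro ev_closed) simp
  have inv: "foldl ?\<delta> st x = foldl ?\<delta> st y" if "word_eq x y" "st \<in> carrier GP" for x y st
  proof (rule foldl_word_eq[where A = "carrier GP", OF _ _ _ _ that])
    fix st u v g h assume st: "st \<in> carrier GP" and uv: "u \<rightarrow>\<^bsub>\<Gamma>\<^esub> v" "g \<in> carrier (\<G> u)" "h \<in> carrier (\<G> v)"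
    have V: "u \<in> verts \<Gamma>" "v \<in> verts \<Gamma>" using adj_in_verts uv by auto
    show "?\<delta> (?\<delta> st (u, g)) (v, h) = ?\<delta> (?\<delta> st (v, h)) (u, g)"
      using ev_comm[OF uv] K V uv st by (simp add: GP.m_assoc)
  next
    fix st v g h assume st: "st \<in> carrier GP" and v: "v \<in> verts \<Gamma>" "g \<in> carrier (\<G> v)" "h \<in> carrier (\<G> v)"
    then show "?\<delta> (?\<delta> st (v, g)) (v, h) = ?\<delta> st (v, g \<otimes>\<^bsub>\<G> v\<^esub> h)"
      using K by (simp add: ev_mult GP.m_assoc)
  qed (use that K in \<open>auto simp: ev_unit\<close>)
  have "foldl ?\<delta> st w = st \<otimes>\<^bsub>GP\<^esub> ev (filter (\<lambda>(v, g). v \<in> U) w)" if "st \<in> carrier GP" for st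
    using assms that
  proof (induction w arbitrary: st)
    case (Cons a w)
    obtain v g where a: "a = (v, g)" by force
    then have vg: "v \<in> verts \<Gamma>" "g \<in> carrier (\<G> v)" "w \<in> words" using Cons.prems by auto
    have "ev ([(v, g)] @ filter (\<lambda>(v, g). v \<in> U) w) = ev [(v, g)] \<otimes>\<^bsub>GP\<^esub> ev (filter (\<lambda>(v, g). v \<in> U) w)"
      using vg by (intro ev_append ev_filter_closed) auto
    then show ?case
      using Cons.IH[OF vg(3)] Cons.prems vg K a ev_closed[OF ev_filter_closed[OF vg(3)]]
      by (simp add: GP.m_assoc)
  qed (simp add: ev_Nil)
  then show ?thesis
    unfolding retract_def using lift_ev[OF inv assms] ev_closed[OF ev_filter_closed[OF assms]] by simp
qed

lemma retract_hom: "retract U \<in> hom GP GP"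
proof (rule homI)
  fix x y assume "x \<in> carrier GP" "y \<in> carrier GP"
  then obtain w w' where w: "w \<in> words" "x = ev w" "w' \<in> words" "y = ev w'" by (auto simp: GP_carrier)
  show "retract U (x \<otimes>\<^bsub>GP\<^esub> y) = retract U x \<otimes>\<^bsub>GP\<^esub> retract U y"
    using w retract_ev[of "w @ w'" U] ev_filter_closed[OF w(1)] ev_filter_closed[OF w(3)]
    by (simp add: ev_append retract_ev)
qed (auto simp: GP_carrier retract_ev ev_filter_closed)

section \<open>Vertex groups inside the graph product\<close>

definition vgrp where "vgrp v = (\<lambda>g. ev [(v, g)]) ` carrier (\<G> v)"

lemma ev_hom: "v \<in> verts \<Gamma> \<Longrightarrow> group_hom (\<G> v) GP (\<lambda>g. ev [(v, g)])"
  using vertex_group GP_group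
  by (auto simp: group_hom_def group_hom_axioms_def hom_def ev_mult intro!: ev_closed)

text \<open>Multiplying up the letters at \<open>v\<close> and ignoring all others is a left
  inverse. It respects the commutation relations because adjacent vertices are distinct.\<close>

lemma ev_inj:
  assumes v: "v \<in> verts \<Gamma>"
  shows "inj_on (\<lambda>g. ev [(v, g)]) (carrier (\<G> v))"
proof (rule inj_on_inverseI)
  interpret G: Group.group "\<G> v" using vertex_group v by blast
  let ?\<delta> = "\<lambda>k (u, g). if u = v then k \<otimes>\<^bsub>\<G> v\<^esub> g else k"
  have inv: "foldl ?\<delta> st x = foldl ?\<delta> st y" if "word_eq x y" "st \<in> carrier (\<G> v)" for x y st
  proof (rule foldl_word_eq[where A = "carrier (\<G> v)", OF _ _ _ _ that])
    fix st u w g h assume "u \<rightarrow>\<^bsub>\<Gamma>\<^esub> w"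
    then have "u \<noteq> w" using adj_not_same by blast
    then show "?\<delta> (?\<delta> st (u, g)) (w, h) = ?\<delta> (?\<delta> st (w, h)) (u, g)" by auto
  qed (use that in \<open>auto simp: G.m_assoc\<close>)
  fix g assume "g \<in> carrier (\<G> v)"
  then show "lift ?\<delta> \<one>\<^bsub>\<G> v\<^esub> (ev [(v, g)]) = g"
    using lift_ev[OF inv[of _ _ "\<one>\<^bsub>\<G> v\<^esub>"], of "[(v, g)]"] v by simp
qed

lemma ev_generate:
  assumes T: "\<And>v. v \<in> verts \<Gamma> \<Longrightarrow> T v \<subseteq> carrier (\<G> v) \<and> generate (\<G> v) (T v) = carrier (\<G> v)"
  shows "generate GP (\<Union>v\<in>verts \<Gamma>. (\<lambda>g. ev [(v, g)]) ` T v) = carrier GP" (is "generate GP ?S = _")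
proof
  interpret GP: Group.group GP by (rule GP_group)
  have "ev [(v, g)] \<in> carrier GP" if "v \<in> verts \<Gamma>" "g \<in> T v" for v g
    using T[OF that(1)] that by (intro ev_closed) auto
  then have S: "?S \<subseteq> carrier GP" by blast
  then show "generate GP ?S \<subseteq> carrier GP" by (rule GP.generate_incl)
  have letter: "ev [(v, g)] \<in> generate GP ?S" if v: "v \<in> verts \<Gamma>" "g \<in> carrier (\<G> v)" for v g
  proof -
    have "(\<lambda>g. ev [(v, g)]) ` generate (\<G> v) (T v) = generate GP ((\<lambda>g. ev [(v, g)]) ` T v)"
      using group_hom.generate_img[OF ev_hom[OF v(1)]] T v by simp
    moreover have "\<dots> \<subseteq> generate GP ?S" using v by (intro GP.mono_generate) blast
    ultimately show ?thesis using T[OF v(1)] v(2) by blast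
  qed
  have "ev w \<in> generate GP ?S" if "w \<in> words" for w
    using that
  proof (induction w)
    case Nil
    then show ?case by (simp add: ev_Nil generate.one)
  next
    case (Cons a w)
    obtain v g where a: "a = (v, g)" by force
    then show ?case
      using Cons letter[of v g] ev_append[of "[(v, g)]" w] generate.eng[of "ev [(v, g)]" GP ?S "ev w"] by simp
  qed
  then show "carrier GP \<subseteq> generate GP ?S" by (auto simp: GP_carrier)
qed

end

theorem theorem1p5:
  fixes \<Gamma> :: "('v, 'e) pre_digraph"
    and \<G> :: "'v \<Rightarrow> ('g, 'm) monoid_scheme"
    and H :: "('v \<times> 'g) list set set set"
  assumes "graph \<Gamma>" and "Digraph_Component.connected \<Gamma>" and "card (verts \<Gamma>) \<ge> 2"
    and "\<And>v. v \<in> verts \<Gamma> \<Longrightarrow> Group.group (\<G> v)"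
    and "\<And>v. v \<in> verts \<Gamma> \<Longrightarrow> finitely_generated (\<G> v)"
    and "\<And>v. v \<in> verts \<Gamma> \<Longrightarrow> infinite (carrier (\<G> v))"
    and "subgroup H (graph_product \<Gamma> \<G>)"
  shows "stable_subgroup (graph_product \<Gamma> \<G>) H \<longleftrightarrow>
    infinite_index (graph_product \<Gamma> \<G>) H \<and> morse_subgroup (graph_product \<Gamma> \<G>) H"
proof -
  interpret graph \<Gamma> by fact
  interpret group_family \<Gamma> \<G> by (intro group_family.intro group_family_axioms.intro) fact+
  interpret GP: Group.group GP by (rule GP_group)
  let ?V = "verts \<Gamma>" and ?adj = "dominates \<Gamma>"
  have "\<forall>v\<in>?V. \<exists>S. finite_generating_set (\<G> v) S" using assms(5) by (simp add: finitely_generated_def)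
  then obtain T where T: "\<And>v. v \<in> ?V \<Longrightarrow> finite_generating_set (\<G> v) (T v)" by metis
  define S where "S = (\<Union>v\<in>?V. (\<lambda>g. ev [(v, g)]) ` T v)"
  have T': "T v \<subseteq> carrier (\<G> v) \<and> generate (\<G> v) (T v) = carrier (\<G> v)" "finite (T v)" if "v \<in> ?V" for v
    using T[OF that] by (auto simp: finite_generating_set_def)
  have S: "S \<subseteq> (\<Union>v\<in>?V. vgrp v)" using T'(1) unfolding S_def vgrp_def by blast
  moreover have "(\<Union>v\<in>?V. vgrp v) \<subseteq> carrier GP" by (auto simp: vgrp_def intro!: ev_closed)
  moreover have "finite S" using T'(2) finite_verts by (simp add: S_def)
  moreover have "generate GP S = carrier GP" unfolding S_def using ev_generate T' by blast
  ultimately have gen: "finite_generating_set GP S" by (simp add: finite_generating_set_def)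
  have sym: "?adj v u" if "?adj u v" for u v
    using that sym_arcs by (simp add: arcs_ends_symmetric)
  have conn: "?adj\<^sup>*\<^sup>* u v" if "u \<in> ?V" "v \<in> ?V" for u v
  proof -
    have "u \<rightarrow>\<^sup>*\<^bsub>mk_symmetric \<Gamma>\<^esub> v"
      using assms(2) that by (simp add: Digraph_Component.connected_def strongly_connected_def)
    then have "u \<rightarrow>\<^sup>*\<^bsub>\<Gamma>\<^esub> v" using reachable_mk_symmetric_eq sym_arcs by blast
    then show ?thesis
      by (induction rule: reachable_induct) (simp, rule rtranclp.rtrancl_into_rtrancl)
  qed
  \<comment> \<open>A path to a second vertex begins with an edge at \<open>v\<close>; the neighbour
    is what makes the link infinite.\<close>
  have nbr: "\<exists>u. ?adj u v" if v: "v \<in> ?V" for v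
  proof -
    have "\<not> ?V \<subseteq> {v}"
    proof
      assume "?V \<subseteq> {v}"
      then have "card ?V \<le> card {v}" by (intro card_mono) auto
      then show False using assms(3) by simp
    qed
    then obtain u where u: "u \<in> ?V" "u \<noteq> v" by blast
    from conn[OF v u(1)] show ?thesis using u(2) sym by (cases rule: converse_rtranclpE) auto
  qed
  have vgrp_ret: "retract U x = (if v \<in> U then x else \<one>\<^bsub>GP\<^esub>)" if "v \<in> ?V" "x \<in> vgrp v" for v x U
    using that by (auto simp: vgrp_def retract_ev ev_Nil)
  \<comment> \<open>Interpreted before the gates exist, because the reading that defines them refers
    to \<open>B.star\<close>.\<close>
  interpret B: graph_group_base GP S ?V ?adj vgrp retract
  proof (intro graph_group_base.intro graph_group_base_axioms.intro word_metric.intro word_metric_axioms.intro)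
    show "?V \<noteq> {}" using assms(3) by auto
    show "u \<in> ?V \<and> v \<in> ?V" if "?adj u v" for u v using adj_in_verts that by blast
    show "\<not> ?adj v v" for v using adj_not_same by blast
    show "subgroup (vgrp v) GP" if "v \<in> ?V" for v
      unfolding vgrp_def using group_hom.img_is_subgroup[OF ev_hom[OF that]] .
    show "infinite (vgrp v)" if "v \<in> ?V" for v
      unfolding vgrp_def using finite_imageD[OF _ ev_inj[OF that]] assms(6)[OF that] by blast
    show "x \<otimes>\<^bsub>GP\<^esub> y = y \<otimes>\<^bsub>GP\<^esub> x" if "?adj u v" "x \<in> vgrp u" "y \<in> vgrp v" for u v x y
      using that ev_comm[OF that(1)] unfolding vgrp_def by blast
  qed (fact GP_group gen finite_verts sym conn nbr S retract_hom vgrp_ret)+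
  \<comment> \<open>A state consists of the product of the letters read so far, which decides
    membership in the star, and the gate collected so far.\<close>
  let ?\<delta> = "\<lambda>v (k, a) (u, s). (k \<otimes>\<^bsub>GP\<^esub> ev [(u, s)], if u = v \<and> k \<in> B.star v then a \<otimes>\<^bsub>GP\<^esub> ev [(u, s)] else a)"
  define proj where "proj v k = snd (lift (?\<delta> v) (\<one>\<^bsub>GP\<^esub>, \<one>\<^bsub>GP\<^esub>) k)" for v k
  have K: "ev [(v, g)] \<in> carrier GP" "ev [(v, g)] \<in> vgrp v" if "v \<in> ?V" "g \<in> carrier (\<G> v)" for v g
    using that by (auto simp: vgrp_def intro!: ev_closed)
  have inv: "foldl (?\<delta> v) st x = foldl (?\<delta> v) st y"
    if v: "v \<in> ?V" and xy: "word_eq x y" and st: "st \<in> carrier GP \<times> carrier GP" for x y st v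
  proof (rule foldl_word_eq[where A = "carrier GP \<times> carrier GP", OF _ _ _ _ xy st])
    fix st u w g h assume st: "st \<in> carrier GP \<times> carrier GP"
      and uw: "u \<rightarrow>\<^bsub>\<Gamma>\<^esub> w" "g \<in> carrier (\<G> u)" "h \<in> carrier (\<G> w)"
    have V: "u \<in> ?V" "w \<in> ?V" using adj_in_verts uw by auto
    have ne: "u \<noteq> w" using uw adj_not_same by blast
    obtain k a where ka: "st = (k, a)" "k \<in> carrier GP" "a \<in> carrier GP" using st by auto
    \<comment> \<open>If one of two commuting letters is at \<open>v\<close>, the other is at a
      neighbour of \<open>v\<close> and does not affect membership of the prefix in the star; so the
      same letters are collected in either order.\<close>
    have "k \<otimes>\<^bsub>GP\<^esub> ev [(w, h)] \<in> B.star v \<longleftrightarrow> k \<in> B.star v" if "u = v"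
      using B.star_mult_iff[OF v ka(2), of w] sym[OF uw(1)] K[OF V(2) uw(3)] that by blast
    moreover have "k \<otimes>\<^bsub>GP\<^esub> ev [(u, g)] \<in> B.star v \<longleftrightarrow> k \<in> B.star v" if "w = v"
      using B.star_mult_iff[OF v ka(2), of u] uw(1) K[OF V(1) uw(2)] that by blast
    ultimately show "?\<delta> v (?\<delta> v st (u, g)) (w, h) = ?\<delta> v (?\<delta> v st (w, h)) (u, g)"
      using ka ne ev_comm[OF uw] K V uw by (auto simp: GP.m_assoc)
  next
    fix st u g h assume st: "st \<in> carrier GP \<times> carrier GP" and u: "u \<in> ?V" "g \<in> carrier (\<G> u)" "h \<in> carrier (\<G> u)"
    obtain k a where ka: "st = (k, a)" "k \<in> carrier GP" "a \<in> carrier GP" using st by auto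
    \<comment> \<open>Consecutive letters at \<open>v\<close> are either both collected or both
      ignored, since the first one lies in the star.\<close>
    have "k \<otimes>\<^bsub>GP\<^esub> ev [(u, g)] \<in> B.star v \<longleftrightarrow> k \<in> B.star v" if "u = v"
      using B.star_mult_iff[OF v ka(2), of u] K[OF u(1,2)] that by blast
    then show "?\<delta> v (?\<delta> v st (u, g)) (u, h) = ?\<delta> v st (u, g \<otimes>\<^bsub>\<G> u\<^esub> h)"
      using ka K u by (auto simp: ev_mult GP.m_assoc)
  next
    show "?\<delta> v st (u, g) \<in> carrier GP \<times> carrier GP"
      if "st \<in> carrier GP \<times> carrier GP" "u \<in> ?V" "g \<in> carrier (\<G> u)" for st u g
      using that K(1)[of u g] by (auto simp: split_beta)
  qed (use K v in \<open>simp_all add: ev_unit mem_Times_iff split_beta cong: if_cong\<close>)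
  have lift: "lift (?\<delta> v) (\<one>\<^bsub>GP\<^esub>, \<one>\<^bsub>GP\<^esub>) (ev w) = foldl (?\<delta> v) (\<one>\<^bsub>GP\<^esub>, \<one>\<^bsub>GP\<^esub>) w" if "v \<in> ?V" "w \<in> words" for v w
    using that inv[OF that(1)] by (intro lift_ev) auto
  have fst: "fst (foldl (?\<delta> v) (k, a) w) = k \<otimes>\<^bsub>GP\<^esub> ev w" if "k \<in> carrier GP" "w \<in> words" for v k a w
    using that
  proof (induction w arbitrary: k a)
    case (Cons c w)
    obtain u s where c: "c = (u, s)" by force
    have "ev ([(u, s)] @ w) = ev [(u, s)] \<otimes>\<^bsub>GP\<^esub> ev w" using Cons.prems c by (intro ev_append) auto
    then show ?case using Cons c K ev_closed[of w] by (simp add: GP.m_assoc)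
  qed (simp add: ev_Nil)
  interpret graph_group GP S ?V ?adj vgrp retract proj
  proof (intro graph_group.intro graph_group_axioms.intro B.graph_group_base_axioms)
    show "proj v \<one>\<^bsub>GP\<^esub> = \<one>\<^bsub>GP\<^esub>" if "v \<in> ?V" for v
      using lift[OF that, of "[]"] by (simp add: proj_def ev_Nil)
    show "proj v (g \<otimes>\<^bsub>GP\<^esub> s) = (if u = v \<and> g \<in> B.star v then proj v g \<otimes>\<^bsub>GP\<^esub> s else proj v g)"
      if v: "v \<in> ?V" "u \<in> ?V" and gs: "g \<in> carrier GP" "s \<in> vgrp u" for u v g s
    proof -
      obtain w where w: "w \<in> words" "g = ev w" using gs GP_carrier by auto
      obtain h where h: "h \<in> carrier (\<G> u)" "s = ev [(u, h)]" using gs by (auto simp: vgrp_def)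
      have e: "g \<otimes>\<^bsub>GP\<^esub> s = ev (w @ [(u, h)])" using w h v by (simp add: ev_append)
      have "fst (foldl (?\<delta> v) (\<one>\<^bsub>GP\<^esub>, \<one>\<^bsub>GP\<^esub>) w) = g" using fst[of "\<one>\<^bsub>GP\<^esub>" w v "\<one>\<^bsub>GP\<^esub>"] w gs by simp
      then show ?thesis
        using lift[OF v(1) w(1)] lift[OF v(1), of "w @ [(u, h)]"] w h v
        unfolding proj_def e by (simp add: case_prod_unfold)
    qed
  qed
  show ?thesis by (rule stable_iff_morse[OF assms(7)])
qed

end
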